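(* Let $\mathcal M(R,F)$ be a quantum matrix algebra of BMW-type. Then the algebra $\mathcal P(R,F)$ (with the $\star$-product) is commutative. As a $\mathcal C(R,F)$-module it is spanned by the matrices $$M^{\overline n}\quad\text{and}\quad \mathsf T_M(M^{\overline{n+2}}),\qquad n=0,1,2,\dots,$$ where $\mathsf T_M(N):=M\cdot\xi(N)$.
   Context: Operators. $V$ is a complex vector space of finite dimension $N$ with a fixed basis (operators on $V^{\otimes n}$ are matrices), $I$ the identity, $P$ the flip on $V\otimes V$. For $X\in\mathrm{End}(V^{\otimes 2})$, $X_{mr}$ is $X$ acting in the tensor factors $m,r$ and trivially elsewhere, $X_m:=X_{m\,m+1}$; for an $N\times N$ matrix $Y$, $Y_m$ is $Y$ in factor $m$. $\mathrm{Tr}_{(i)}$ is the trace over the $i$-th factor. $X$ is skew invertible if there is $\Psi_X\in\mathrm{End}(V^{\otimes2})$ with $\mathrm{Tr}_{(2)}X_{12}(\Psi_X)_{23}=\mathrm{Tr}_{(2)}(\Psi_X)_{12}X_{23}=P_{13}$; then $C_X:=\mathrm{Tr}_{(1)}(\Psi_X)_{12}$, $D_X:=\mathrm{Tr}_{(2)}(\Psi_X)_{12}$, and $X$ is strict skew invertible if $C_X$ or $D_X$ is invertible. An R-matrix is an invertible $R\in\mathrm{End}(V^{\otimes 2})$ with $R_1R_2R_1=R_2R_1R_2$; it gives representations $\rho_R$ of the braid groups $\mathcal B_n$ (Artin generators $\sigma_1,\dots,\sigma_{n-1}$, $\mathcal B_1=\{1\}$) and of $\mathbb C\mathcal B_n$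 on $V^{\otimes n}$, $\sigma_i\mapsto R_i$. A pair $\{R,F\}$ is compatible if $R_1F_2F_1=F_2F_1R_2$ and $R_2F_1F_2=F_1F_2R_1$. For skew invertible $R$ the R-trace over spaces $i_1,\dots,i_s$ is $\mathrm{Tr}_{R(i_1,\dots,i_s)}X:=\mathrm{Tr}_{(i_1,\dots,i_s)}\big((D_R)_{i_1}\cdots(D_R)_{i_s}X\big)$. BMW-type. Let $q\in\mathbb C\setminus\{0,\pm1\}$, $\mu\in\mathbb C\setminus\{0,q,-q^{-1}\}$. An R-matrix $R$ is of BMW-type if its minimal polynomial relation is $(qI-R)(q^{-1}I+R)(\mu I-R)=0$ and $K:=\mu^{-1}(q-q^{-1})^{-1}(qI-R)(q^{-1}I+R)$ satisfies $K_2K_1=R_1^{\pm1}R_2^{\pm1}K_1$ and $K_1K_2K_1=K_1$. Quantum matrix algebra. Let $\{R,F\}$ be a compatible pair of strict skew invertible R-matrices. For an $N\times N$ matrix $M$ put $M_{\overline1}:=M_1$, $M_{\overline i}:=F_{i-1}M_{\overline{i-1}}F_{i-1}^{-1}$. $\mathcal M(R,F)$ is the unital associative $\mathbb C$-algebra generated by the entries $M_a^b$ of $M$ with relations $R_1M_{\overline1}M_{\overline2}=M_{\overline1}M_{\overline2}R_1$; it is of BMW-type if $R$ is. The characteristic subalgebra $\mathcal C(R,F)$ is the linear span of $1$ and all $ch(\alpha):=\mathrm{Tr}_{R(1,\dots,n)}(M_{\overline1}\cdots M_{\overline n}\,\rho_R(\alpha))$, $\alpha\in\mathbb C\mathcal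 B_n$, $n\ge1$; it is a commutative subalgebra. $\mathcal P(R,F)$ is the linear subspace of $\mathrm{Mat}_N(\mathcal M(R,F))$ spanned by $I\,c$ ($c\in\mathcal C(R,F)$) and the matrices $M^{\alpha}$, $(M^{\alpha})_1:=\mathrm{Tr}_{R(2,\dots,n)}(M_{\overline1}\cdots M_{\overline n}\rho_R(\alpha))$, $\alpha\in\mathbb C\mathcal B_n$, $n\ge1$ ($M^1=M$ for $n=1$). It is a right $\mathcal C(R,F)$-module by entrywise multiplication and an associative algebra under $M^{\alpha}\star M^{\beta}:=M^{\alpha\star\beta}$, $\alpha\star\beta:=\alpha\,\beta^{\uparrow n}(\sigma_n\cdots\sigma_2\sigma_1\sigma_2^{-1}\cdots\sigma_n^{-1})$ for $\alpha\in\mathbb C\mathcal B_n$, $\beta\in\mathbb C\mathcal B_i$ ($\beta^{\uparrow n}$: image under $\sigma_j\mapsto\sigma_{j+n}$; $\alpha$ viewed in $\mathbb C\mathcal B_{n+i}$ via $\sigma_j\mapsto\sigma_j$), and $(Ic)\star N=N\star(Ic)=Nc$. $M^{\overline0}:=I$ and $M^{\overline n}:=M\star\cdots\star M$ ($n$ factors). $\xi(N)_1:=\mathrm{Tr}_{R(2)}(F_{12}N_1F_{12}^{-1}K_{12})$, and "$\cdot$" is the usual matrix product; $\mathsf T_M$ maps $\mathcal P(R,F)$ to itself. *)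

theory Defs
  imports
    "HOL-Analysis.Analysis"
    "HOL-Computational_Algebra.Polynomial"
    "HOL-Library.Poly_Mapping"
begin

section \<open>Braid groups and their group algebras\<close>

text \<open>
  Strands and tensor factors are counted from \<open>0\<close>: the letter \<open>(k, True)\<close> is the Artin generator
  usually written \<open>\<sigma>\<close> with index \<open>k + 1\<close>, and \<open>(k, False)\<close> is its inverse.
  All braid groups are realised inside the group on infinitely many strands, the group with
  \<open>n\<close> strands being the subgroup generated by the first \<open>n - 1\<close> generators; the homomorphism
  that sends each generator to the generator of the same name is then an inclusion.
\<close>

type_synonym braid_word = "(nat \<times> bool) list"

inductive braid_eq :: "braid_word \<Rightarrow> braid_word \<Rightarrow> bool" where
  refl: "braid_eq u u"
| sym: "braid_eq u v \<Longrightarrow> braid_eq v u"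
| trans: "braid_eq u v \<Longrightarrow> braid_eq v w \<Longrightarrow> braid_eq u w"
| cong: "braid_eq u u' \<Longrightarrow> braid_eq v v' \<Longrightarrow> braid_eq (u @ v) (u' @ v')"
| cancel: "braid_eq [(k, s), (k, \<not> s)] []"
| far: "Suc i < j \<Longrightarrow> braid_eq [(i, True), (j, True)] [(j, True), (i, True)]"
| near: "braid_eq [(i, True), (Suc i, True), (i, True)] [(Suc i, True), (i, True), (Suc i, True)]"

definition inv_word :: "braid_word \<Rightarrow> braid_word" where
  "inv_word w = rev (map (\<lambda>(k, s). (k, \<not> s)) w)"

definition shift_word :: "nat \<Rightarrow> braid_word \<Rightarrow> braid_word" where
  "shift_word n w = map (\<lambda>(k, s). (n + k, s)) w"

lemma braid_eq_inv_right: "braid_eq (w @ inv_word w) []"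
proof (induction w)
  case Nil
  show ?case by (simp add: inv_word_def braid_eq.refl)
next
  case (Cons a w)
  obtain k s where a: "a = (k, s)" by force
  have "braid_eq ([a] @ ((w @ inv_word w) @ [(k, \<not> s)])) ([a] @ ([] @ [(k, \<not> s)]))"
    by (intro braid_eq.cong braid_eq.refl Cons.IH)
  then show ?case
    using braid_eq.trans[OF _ braid_eq.cancel[of k s]] by (simp add: a inv_word_def)
qed

lemma inv_word_inv_word [simp]: "inv_word (inv_word w) = w"
  by (simp add: inv_word_def rev_map comp_def case_prod_unfold)

lemma braid_eq_inv_left: "braid_eq (inv_word w @ w) []"
  using braid_eq_inv_right[of "inv_word w"] by simp

lemma braid_eq_inv_word:
  assumes "braid_eq u v" shows "braid_eq (inv_word u) (inv_word v)"
proof -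
  have "braid_eq (inv_word u @ (v @ inv_word v)) (inv_word u @ [])"
    by (intro braid_eq.cong braid_eq.refl braid_eq_inv_right)
  moreover have "braid_eq (inv_word u @ (v @ inv_word v)) (inv_word u @ (u @ inv_word v))"
    by (intro braid_eq.cong braid_eq.refl braid_eq.sym[OF assms])
  moreover have "braid_eq ((inv_word u @ u) @ inv_word v) ([] @ inv_word v)"
    by (intro braid_eq.cong braid_eq.refl braid_eq_inv_left)
  ultimately show ?thesis by (metis append.assoc append_Nil append_Nil2 braid_eq.sym braid_eq.trans)
qed

lemma braid_eq_shift_word:
  "braid_eq u v \<Longrightarrow> braid_eq (shift_word n u) (shift_word n v)"
proof (induction rule: braid_eq.induct)
  case (near i)
  show ?case using braid_eq.near[of "n + i"] by (simp add: shift_word_def)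
qed (auto simp: shift_word_def intro: braid_eq.intros)

quotient_type braid = braid_word / braid_eq
  by (intro equivpI reflpI sympI transpI) (blast intro: braid_eq.intros)+

text \<open>
  The group law is written additively, so that the convolution ring
  \<open>braid \<Rightarrow>\<^sub>0 complex\<close> of \<^theory>\<open>HOL-Library.Poly_Mapping\<close> is the group algebra.
\<close>

instantiation braid :: group_add
begin

lift_definition zero_braid :: braid is "[]" .
lift_definition plus_braid :: "braid \<Rightarrow> braid \<Rightarrow> braid" is "(@)" by (rule braid_eq.cong)
lift_definition uminus_braid :: "braid \<Rightarrow> braid" is inv_word by (rule braid_eq_inv_word)
definition minus_braid :: "braid \<Rightarrow> braid \<Rightarrow> braid" where "minus_braid a b = a + - b"

instance
proof
  fix a b c :: braid
  show "a + b + c = a + (b + c)" by transfer (simp add: braid_eq.refl)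
  show "0 + a = a" by transfer (simp add: braid_eq.refl)
  show "a + 0 = a" by transfer (simp add: braid_eq.refl)
  show "- a + a = 0" by transfer (rule braid_eq_inv_left)
  show "a + - b = a - b" by (simp add: minus_braid_def)
qed

end

lift_definition shift_braid :: "nat \<Rightarrow> braid \<Rightarrow> braid" is shift_word
  by (rule braid_eq_shift_word)

definition words_on :: "nat \<Rightarrow> braid_word set" where
  "words_on n = {w. \<forall>(k, s) \<in> set w. Suc k < n}"

definition braid_group :: "nat \<Rightarrow> braid set" where
  "braid_group n = abs_braid ` words_on n"

type_synonym braid_algebra = "braid \<Rightarrow>\<^sub>0 complex"

definition group_algebra :: "nat \<Rightarrow> braid_algebra set" where
  "group_algebra n = {\<alpha>. Poly_Mapping.keys \<alpha> \<subseteq> braid_group n}"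

definition shift_algebra :: "nat \<Rightarrow> braid_algebra \<Rightarrow> braid_algebra" where
  "shift_algebra n \<beta> =
    (\<Sum>b\<in>Poly_Mapping.keys \<beta>. Poly_Mapping.single (shift_braid n b) (Poly_Mapping.lookup \<beta> b))"

text \<open>For \<open>\<alpha>\<close> on \<open>n\<close> strands; in one-based notation the last factor is
  \<open>\<sigma>\<^sub>n \<dots> \<sigma>\<^sub>2 \<sigma>\<^sub>1\<close> followed by the inverses of \<open>\<sigma>\<^sub>2, \<dots>, \<sigma>\<^sub>n\<close> in this order.\<close>

definition braid_star :: "nat \<Rightarrow> braid_algebra \<Rightarrow> braid_algebra \<Rightarrow> braid_algebra" where
  "braid_star n \<alpha> \<beta> = \<alpha> * shift_algebra n \<beta> *
    Poly_Mapping.single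
      (abs_braid (map (\<lambda>k. (k, True)) (rev [0..<n]) @ map (\<lambda>k. (k, False)) [1..<n])) 1"


section \<open>Operators on tensor powers\<close>

text \<open>
  The basis of \<open>V\<close> is indexed by the finite type \<open>'n\<close>, the basis of the \<open>n\<close>-th tensor power by the
  lists of length \<open>n\<close>. An operator on the \<open>n\<close>-th tensor power is a function of a row index and a
  column index that vanishes unless both have length \<open>n\<close>. On \<open>V\<close> and \<open>V \<otimes> V\<close> library matrices
  \<open>X $ row $ column\<close> are used.
\<close>

type_synonym ('n, 'a) tensor_op = "'n list \<Rightarrow> 'n list \<Rightarrow> 'a"
type_synonym ('n, 'a) mat1 = "'a ^ 'n ^ 'n"
type_synonym ('n, 'a) mat2 = "'a ^ ('n \<times> 'n) ^ ('n \<times> 'n)"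

definition tid :: "nat \<Rightarrow> ('n::finite, 'a::zero_neq_one) tensor_op" where
  "tid n a b = (if length a = n \<and> a = b then 1 else 0)"

definition tmult ::
    "nat \<Rightarrow> ('n::finite, 'a::semiring_1) tensor_op \<Rightarrow> ('n, 'a) tensor_op \<Rightarrow> ('n, 'a) tensor_op" where
  "tmult n X Y a b = (\<Sum>c | length c = n. X a c * Y c b)"

definition tprod :: "nat \<Rightarrow> ('n::finite, 'a::semiring_1) tensor_op list \<Rightarrow> ('n, 'a) tensor_op" where
  "tprod n Xs = foldr (tmult n) Xs (tid n)"

definition act1 :: "('n::finite, 'a::zero) mat1 \<Rightarrow> nat \<Rightarrow> nat \<Rightarrow> ('n, 'a) tensor_op" where
  "act1 X m n a b =
    (if length a = n \<and> length b = n \<and> (\<forall>k<n. k \<noteq> m \<longrightarrow> a ! k = b ! k)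
     then X $ (a ! m) $ (b ! m) else 0)"

definition act2 :: "('n::finite, 'a::zero) mat2 \<Rightarrow> nat \<Rightarrow> nat \<Rightarrow> nat \<Rightarrow> ('n, 'a) tensor_op" where
  "act2 X m r n a b =
    (if length a = n \<and> length b = n \<and> (\<forall>k<n. k \<noteq> m \<and> k \<noteq> r \<longrightarrow> a ! k = b ! k)
     then X $ (a ! m, a ! r) $ (b ! m, b ! r) else 0)"

abbreviation adj :: "('n::finite, 'a::zero) mat2 \<Rightarrow> nat \<Rightarrow> nat \<Rightarrow> ('n, 'a) tensor_op" where
  "adj X m n \<equiv> act2 X m (Suc m) n"


section \<open>R-matrices\<close>

definition flip :: "('n::finite, complex) mat2" where
  "flip = (\<chi> i j. if fst i = snd j \<and> snd i = fst j then 1 else 0)"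

text \<open>The partial trace over the middle one of three factors.\<close>

definition trace_mid :: "('n::finite, complex) tensor_op \<Rightarrow> ('n, complex) mat2" where
  "trace_mid X = (\<chi> i j. \<Sum>x\<in>UNIV. X [fst i, x, snd i] [fst j, x, snd j])"

definition is_skew_inverse :: "('n::finite, complex) mat2 \<Rightarrow> ('n, complex) mat2 \<Rightarrow> bool" where
  "is_skew_inverse X \<Psi> \<longleftrightarrow>
    trace_mid (tmult 3 (act2 X 0 1 3) (act2 \<Psi> 1 2 3)) = flip \<and>
    trace_mid (tmult 3 (act2 \<Psi> 0 1 3) (act2 X 1 2 3)) = flip"

definition skew_invertible :: "('n::finite, complex) mat2 \<Rightarrow> bool" where
  "skew_invertible X \<longleftrightarrow> (\<exists>\<Psi>. is_skew_inverse X \<Psi>)"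

text \<open>The two conditions determine \<open>\<Psi>\<close>: they make the partially transposed matrices of \<open>X\<close> and
  \<open>\<Psi>\<close> inverse to each other.\<close>

definition skew_inv :: "('n::finite, complex) mat2 \<Rightarrow> ('n, complex) mat2" where
  "skew_inv X = (THE \<Psi>. is_skew_inverse X \<Psi>)"

definition C_mat :: "('n::finite, complex) mat2 \<Rightarrow> ('n, complex) mat1" where
  "C_mat X = (\<chi> i j. \<Sum>a\<in>UNIV. skew_inv X $ (a, i) $ (a, j))"

definition D_mat :: "('n::finite, complex) mat2 \<Rightarrow> ('n, complex) mat1" where
  "D_mat X = (\<chi> i j. \<Sum>a\<in>UNIV. skew_inv X $ (i, a) $ (j, a))"

definition strict_skew_invertible :: "('n::finite, complex) mat2 \<Rightarrow> bool" where
  "strict_skew_invertible X \<longleftrightarrow>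
    skew_invertible X \<and> (invertible (C_mat X) \<or> invertible (D_mat X))"

definition R_matrix :: "('n::finite, complex) mat2 \<Rightarrow> bool" where
  "R_matrix R \<longleftrightarrow> invertible R \<and>
    tprod 3 [adj R 0 3, adj R 1 3, adj R 0 3] = tprod 3 [adj R 1 3, adj R 0 3, adj R 1 3]"

definition compatible :: "('n::finite, complex) mat2 \<Rightarrow> ('n, complex) mat2 \<Rightarrow> bool" where
  "compatible R F \<longleftrightarrow>
    tprod 3 [adj R 0 3, adj F 1 3, adj F 0 3] = tprod 3 [adj F 1 3, adj F 0 3, adj R 1 3] \<and>
    tprod 3 [adj R 1 3, adj F 0 3, adj F 1 3] = tprod 3 [adj F 0 3, adj F 1 3, adj R 0 3]"

definition matrix_poly :: "complex poly \<Rightarrow> complex ^ 'k ^ 'k \<Rightarrow> complex ^ 'k ^ 'k" where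
  "matrix_poly p X = (\<Sum>i\<le>degree p. mat (coeff p i) ** (((**) X ^^ i) (mat 1)))"

definition minimal_polynomial :: "complex ^ 'k ^ 'k \<Rightarrow> complex poly \<Rightarrow> bool" where
  "minimal_polynomial X p \<longleftrightarrow>
    lead_coeff p = 1 \<and> matrix_poly p X = 0 \<and>
    (\<forall>r. r \<noteq> 0 \<and> matrix_poly r X = 0 \<longrightarrow> degree p \<le> degree r)"

definition K_mat :: "complex \<Rightarrow> complex \<Rightarrow> ('n::finite, complex) mat2 \<Rightarrow> ('n, complex) mat2" where
  "K_mat q \<mu> R =
    mat (inverse \<mu> * inverse (q - inverse q)) ** (mat q - R) ** (mat (inverse q) + R)"

text \<open>The cubic \<open>(q - x)(1/q + x)(\<mu> - x)\<close> is monic.\<close>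

definition BMW_type :: "complex \<Rightarrow> complex \<Rightarrow> ('n::finite, complex) mat2 \<Rightarrow> bool" where
  "BMW_type q \<mu> R \<longleftrightarrow> R_matrix R \<and>
    minimal_polynomial R ([:q, -1:] * [:inverse q, 1:] * [:\<mu>, -1:]) \<and>
    (let K = K_mat q \<mu> R; S = matrix_inv R in
      tprod 3 [adj K 1 3, adj K 0 3] = tprod 3 [adj R 0 3, adj R 1 3, adj K 0 3] \<and>
      tprod 3 [adj K 1 3, adj K 0 3] = tprod 3 [adj S 0 3, adj S 1 3, adj K 0 3] \<and>
      tprod 3 [adj K 0 3, adj K 1 3, adj K 0 3] = adj K 0 3)"

text \<open>The value does not depend on the chosen word when \<open>R\<close> is an R-matrix and the braid has at
  most \<open>n\<close> strands.\<close>

definition rho_braid :: "('n::finite, complex) mat2 \<Rightarrow> nat \<Rightarrow> braid \<Rightarrow> ('n, complex) tensor_op" where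
  "rho_braid R n b =
    tprod n (map (\<lambda>(k, s). adj (if s then R else matrix_inv R) k n)
      (SOME w. w \<in> words_on n \<and> abs_braid w = b))"

definition rho :: "('n::finite, complex) mat2 \<Rightarrow> nat \<Rightarrow> braid_algebra \<Rightarrow> ('n, complex) tensor_op" where
  "rho R n \<alpha> x y =
    (\<Sum>b\<in>Poly_Mapping.keys \<alpha>. Poly_Mapping.lookup \<alpha> b * rho_braid R n b x y)"


section \<open>Complex algebras and presentations\<close>

text \<open>A complex algebra is a ring with a unital homomorphism from \<open>\<complex>\<close> to its centre.\<close>

definition complex_algebra :: "(complex \<Rightarrow> 'a::ring_1) \<Rightarrow> bool" where
  "complex_algebra emb \<longleftrightarrow>
    emb 1 = 1 \<and> (\<forall>x y. emb (x + y) = emb x + emb y) \<and> (\<forall>x y. emb (x * y) = emb x * emb y) \<and>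
    (\<forall>x a. emb x * a = a * emb x)"

datatype 'g fmon = FMon (letters: "'g list")

instantiation fmon :: (type) monoid_add
begin

definition zero_fmon :: "'g fmon" where "zero_fmon = FMon []"
definition plus_fmon :: "'g fmon \<Rightarrow> 'g fmon \<Rightarrow> 'g fmon" where
  "plus_fmon u v = FMon (letters u @ letters v)"

instance by standard (simp_all add: zero_fmon_def plus_fmon_def)

end

text \<open>The free algebra on \<open>'g\<close> is the monoid algebra of the free monoid.\<close>

type_synonym 'g free_algebra = "'g fmon \<Rightarrow>\<^sub>0 complex"

definition free_emb :: "complex \<Rightarrow> 'g free_algebra" where
  "free_emb c = Poly_Mapping.single 0 c"

definition free_gen :: "'g \<Rightarrow> 'g free_algebra" where
  "free_gen g = Poly_Mapping.single (FMon [g]) 1"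

definition free_eval :: "(complex \<Rightarrow> 'a::ring_1) \<Rightarrow> ('g \<Rightarrow> 'a) \<Rightarrow> 'g free_algebra \<Rightarrow> 'a" where
  "free_eval emb f p =
    (\<Sum>w\<in>Poly_Mapping.keys p. emb (Poly_Mapping.lookup p w) * prod_list (map f (letters w)))"

inductive_set two_sided_ideal :: "'r::ring_1 set \<Rightarrow> 'r set" for S where
  zero: "0 \<in> two_sided_ideal S"
| gen: "s \<in> S \<Longrightarrow> s \<in> two_sided_ideal S"
| add: "x \<in> two_sided_ideal S \<Longrightarrow> y \<in> two_sided_ideal S \<Longrightarrow> x + y \<in> two_sided_ideal S"
| mult: "x \<in> two_sided_ideal S \<Longrightarrow> a * x * b \<in> two_sided_ideal S"

text \<open>The canonical homomorphism from the free algebra is onto, with kernel the ideal of the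
  relators.\<close>

definition presented_by ::
    "(complex \<Rightarrow> 'a::ring_1) \<Rightarrow> ('g \<Rightarrow> 'a) \<Rightarrow> 'g free_algebra set \<Rightarrow> bool" where
  "presented_by emb f S \<longleftrightarrow> complex_algebra emb \<and>
    surj (free_eval emb f) \<and> {p. free_eval emb f p = 0} = two_sided_ideal S"


section \<open>Quantum matrix algebras\<close>

text \<open>
  In \<open>qma_data\<close> the base field is embedded into the ring \<open>'a\<close> by \<open>emb\<close>, and \<open>M\<close> is any matrix
  over \<open>'a\<close>. It is used with the free algebra to form the relators, and with the quantum matrix
  algebra itself.
\<close>

locale qma_data =
  fixes R F :: "('n::finite, complex) mat2"
    and emb :: "complex \<Rightarrow> 'a::ring_1"
    and M :: "('n, 'a) mat1"
begin

definition lift_op :: "('n, complex) tensor_op \<Rightarrow> ('n, 'a) tensor_op" where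
  "lift_op X a b = emb (X a b)"

text \<open>\<open>bar N i n\<close> is the copy of \<open>N\<close> with bar index \<open>i + 1\<close>, acting on \<open>n\<close> factors.\<close>

primrec bar :: "('n, 'a) mat1 \<Rightarrow> nat \<Rightarrow> nat \<Rightarrow> ('n, 'a) tensor_op" where
  "bar N 0 n = act1 N 0 n"
| "bar N (Suc i) n =
    tprod n [lift_op (adj F i n), bar N i n, lift_op (adj (matrix_inv F) i n)]"

definition M_string :: "nat \<Rightarrow> ('n, 'a) tensor_op" where
  "M_string n = tprod n (map (\<lambda>i. bar M i n) [0..<n])"

definition relators :: "'a set" where
  "relators =
    {tmult 2 (lift_op (adj R 0 2)) (M_string 2) a b - tmult 2 (M_string 2) (lift_op (adj R 0 2)) a b
      | a b. length a = 2 \<and> length b = 2}"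

text \<open>The R-trace over all factors, and over all factors but the first.\<close>

definition R_trace :: "nat \<Rightarrow> ('n, 'a) tensor_op \<Rightarrow> 'a" where
  "R_trace n X =
    (\<Sum>a | length a = n.
      tmult n (tprod n (map (\<lambda>i. lift_op (act1 (D_mat R) i n)) [0..<n])) X a a)"

definition R_trace_tail :: "nat \<Rightarrow> ('n, 'a) tensor_op \<Rightarrow> ('n, 'a) mat1" where
  "R_trace_tail n X =
    (\<chi> i j. \<Sum>a | Suc (length a) = n.
      tmult n (tprod n (map (\<lambda>k. lift_op (act1 (D_mat R) k n)) [1..<n])) X (i # a) (j # a))"

definition ch :: "nat \<Rightarrow> braid_algebra \<Rightarrow> 'a" where
  "ch n \<alpha> = R_trace n (tmult n (M_string n) (lift_op (rho R n \<alpha>)))"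

definition char_subalgebra :: "'a set" where
  "char_subalgebra = module.span (\<lambda>c a. emb c * a)
    (insert 1 {ch n \<alpha> | n \<alpha>. 1 \<le> n \<and> \<alpha> \<in> group_algebra n})"

definition M_braid :: "nat \<Rightarrow> braid_algebra \<Rightarrow> ('n, 'a) mat1" where
  "M_braid n \<alpha> = R_trace_tail n (tmult n (M_string n) (lift_op (rho R n \<alpha>)))"

definition mscale :: "complex \<Rightarrow> ('n, 'a) mat1 \<Rightarrow> ('n, 'a) mat1" where
  "mscale c X = (\<chi> i j. emb c * X $ i $ j)"

definition P_space :: "('n, 'a) mat1 set" where
  "P_space = module.span mscale
    ({mat c | c. c \<in> char_subalgebra} \<union> {M_braid n \<alpha> | n \<alpha>. 1 \<le> n \<and> \<alpha> \<in> group_algebra n})"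

definition rmult :: "('n, 'a) mat1 \<Rightarrow> 'a \<Rightarrow> ('n, 'a) mat1" where
  "rmult X c = (\<chi> i j. X $ i $ j * c)"

definition right_span :: "('n, 'a) mat1 set \<Rightarrow> ('n, 'a) mat1 set" where
  "right_span S =
    {\<Sum>X\<in>T. rmult X (c X) | T c. finite T \<and> T \<subseteq> S \<and> (\<forall>X\<in>T. c X \<in> char_subalgebra)}"

text \<open>The graph of the star product: the defining rules, closed under linear combinations in either
  argument. The product is well defined on \<open>P_space\<close>.\<close>

inductive star_graph :: "('n, 'a) mat1 \<Rightarrow> ('n, 'a) mat1 \<Rightarrow> ('n, 'a) mat1 \<Rightarrow> bool" where
  braid: "1 \<le> n \<Longrightarrow> 1 \<le> i \<Longrightarrow> \<alpha> \<in> group_algebra n \<Longrightarrow> \<beta> \<in> group_algebra i \<Longrightarrow>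
    star_graph (M_braid n \<alpha>) (M_braid i \<beta>) (M_braid (n + i) (braid_star n \<alpha> \<beta>))"
| scalar_left: "c \<in> char_subalgebra \<Longrightarrow> N \<in> P_space \<Longrightarrow> star_graph (mat c) N (rmult N c)"
| scalar_right: "c \<in> char_subalgebra \<Longrightarrow> N \<in> P_space \<Longrightarrow> star_graph N (mat c) (rmult N c)"
| linear_left: "star_graph X Y Z \<Longrightarrow> star_graph X' Y Z' \<Longrightarrow>
    star_graph (mscale c X + mscale d X') Y (mscale c Z + mscale d Z')"
| linear_right: "star_graph X Y Z \<Longrightarrow> star_graph X Y' Z' \<Longrightarrow>
    star_graph X (mscale c Y + mscale d Y') (mscale c Z + mscale d Z')"

definition star :: "('n, 'a) mat1 \<Rightarrow> ('n, 'a) mat1 \<Rightarrow> ('n, 'a) mat1" where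
  "star X Y = (THE Z. star_graph X Y Z)"

text \<open>The bracketing of the factors is immaterial, the product being associative.\<close>

primrec M_power :: "nat \<Rightarrow> ('n, 'a) mat1" where
  "M_power 0 = mat 1"
| "M_power (Suc n) = star M (M_power n)"

definition xi :: "complex \<Rightarrow> complex \<Rightarrow> ('n, 'a) mat1 \<Rightarrow> ('n, 'a) mat1" where
  "xi q \<mu> N = R_trace_tail 2
    (tprod 2 [lift_op (adj F 0 2), act1 N 0 2, lift_op (adj (matrix_inv F) 0 2),
              lift_op (adj (K_mat q \<mu> R) 0 2)])"

definition T_M :: "complex \<Rightarrow> complex \<Rightarrow> ('n, 'a) mat1 \<Rightarrow> ('n, 'a) mat1" where
  "T_M q \<mu> N = M ** xi q \<mu> N"

end

definition qma_relators ::
    "('n::finite, complex) mat2 \<Rightarrow> ('n, complex) mat2 \<Rightarrow> ('n \<times> 'n) free_algebra set" where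
  "qma_relators R F = qma_data.relators R F free_emb (\<chi> i j. free_gen (i, j))"

definition quantum_matrix_algebra ::
    "('n::finite, complex) mat2 \<Rightarrow> ('n, complex) mat2 \<Rightarrow> (complex \<Rightarrow> 'a::ring_1) \<Rightarrow> ('n, 'a) mat1
      \<Rightarrow> bool" where
  "quantum_matrix_algebra R F emb M \<longleftrightarrow>
    R_matrix R \<and> R_matrix F \<and> strict_skew_invertible R \<and> strict_skew_invertible F \<and>
    compatible R F \<and> presented_by emb (\<lambda>(i, j). M $ i $ j) (qma_relators R F)"

end

theory Submission
  imports Defs
begin

text \<open>
  Write \<open>A N = M \<star> N\<close> and \<open>T N = T\<^sub>M(N)\<close>. Both raise the number of strands by one: for \<open>\<alpha>\<close> on \<open>n\<close>
  strands, \<open>A M\<^sup>\<alpha>\<close> and \<open>T M\<^sup>\<alpha>\<close> are the matrices of \<open>\<alpha>\<close>, shifted by one strand, times \<open>\<sigma>\<^sub>1\<close> and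
  \<open>K\<^sub>1\<close>. By the BMW relations the image of the braid group algebra on \<open>n + 1\<close> strands is spanned by the
  products \<open>a t b\<close>, where \<open>a\<close> and \<open>b\<close> avoid the first strand and \<open>t\<close> is \<open>1\<close>, \<open>R\<^sub>1\<close> or \<open>K\<^sub>1\<close>, and by
  cyclicity of the \<open>R\<close>-trace the matrix of \<open>a t b\<close> is \<open>M\<close> times an element of the characteristic
  subalgebra, or \<open>A\<close> or \<open>T\<close> of the matrix of \<open>b a\<close>. By induction the matrix of a braid is that of
  the reversed word, and reversal exchanges the factors of the \<open>\<star>\<close>-product, so that this is commutative.
  Moreover everything is generated from \<open>I\<close> by \<open>A\<close> and \<open>T\<close>, and the relations
  \<open>T T A = A T T\<close>, \<open>A T A = T T T - \<lambda> A T T + \<lambda> \<mu>\<^sup>-\<^sup>1 M ch(T T)\<close> with \<open>\<lambda> = q - q\<^sup>-\<^sup>1\<close>, \<open>T M = I c\<close> and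
  \<open>T I = \<mu> M\<close> reduce any word in \<open>A\<close> and \<open>T\<close> to \<open>A\<^sup>n I\<close> and \<open>T A\<^sup>n I\<close>.
\<close>

section \<open>Matrices and characters of a tower of operators\<close>

text \<open>Three points shape the proof. A matrix is known only through a braid that represents it,
  and neither reversal nor the star product is visibly independent of this choice. So words travel
  in pairs with their reversals, and each product is computed by two functions, each linear in the
  matrix of one factor. Their agreement gives well-definedness, and it lets a reversal be removed
  from one factor alone. The scalar c in \<open>T M = I c\<close> exists because \<open>K\<close>
  has rank one: \<open>M_1 M_2\<close> commutes with \<open>K\<close>, hence
  \<open>M_1 M_2 K = K g\<close> and c is \<mu> g. That g is characteristic follows from
  \<open>ch_2(K) = \<mu> d g\<close> with d the trace of \<open>D\<close>. The trace of the skein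
  relation gives \<open>lam * d = (q - \<mu>) * (1/q + \<mu>)\<close>, which is nonzero because
  \<mu> differs from q and -1/q. Operators on tensor powers of different lengths are compared
  throughout, so all of them are placed in one ring with an increasing chain of subrings
  \<open>A n\<close>; only these axioms enter the algebraic part, and a concrete ring is supplied at
  the end.\<close>

text \<open>\<open>A n\<close> consists of the operators on the first \<open>n\<close> factors with entries in the quantum matrix
  algebra, \<open>E n\<close> is the \<open>R\<close>-trace over the factor with index \<open>n\<close>, \<open>R n\<close> and \<open>F n\<close> act in the factors \<open>n\<close>
  and \<open>n + 1\<close>, and \<open>M n\<close> is the barred copy of \<open>M\<close> ending in factor \<open>n\<close>.\<close>

locale r_tower =
  fixes sc :: "complex \<Rightarrow> 'r::ring_1" and A :: "nat \<Rightarrow> 'r set" and E :: "nat \<Rightarrow> 'r \<Rightarrow> 'r"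
    and R R' F F' M :: "nat \<Rightarrow> 'r"
  assumes sc_1 [simp]: "sc 1 = 1"
    and sc_add: "sc (c + d) = sc c + sc d"
    and sc_mult: "sc (c * d) = sc c * sc d"
    and sc_central: "x * sc c = sc c * x"
    and sc_A [simp]: "sc c \<in> A n"
    and A_add: "x \<in> A n \<Longrightarrow> y \<in> A n \<Longrightarrow> x + y \<in> A n"
    and A_mult: "x \<in> A n \<Longrightarrow> y \<in> A n \<Longrightarrow> x * y \<in> A n"
    and A_Suc: "A n \<subseteq> A (Suc n)"
    and E_add: "E n (x + y) = E n x + E n y"
    and E_left: "a \<in> A n \<Longrightarrow> E n (a * x) = a * E n x"
    and E_right: "a \<in> A n \<Longrightarrow> E n (x * a) = E n x * a"
    and E_A: "x \<in> A (Suc n) \<Longrightarrow> E n x \<in> A n"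
    and R_A: "R n \<in> A (Suc (Suc n))" and R'_A: "R' n \<in> A (Suc (Suc n))"
    and F_A: "F n \<in> A (Suc (Suc n))" and F'_A: "F' n \<in> A (Suc (Suc n))"
    and R_comm: "x \<in> A n \<Longrightarrow> n \<le> m \<Longrightarrow> R m * x = x * R m"
    and F_comm: "x \<in> A n \<Longrightarrow> n \<le> m \<Longrightarrow> F m * x = x * F m"
    and RR' [simp]: "R n * R' n = 1" and R'R [simp]: "R' n * R n = 1"
    and FF' [simp]: "F n * F' n = 1" and F'F [simp]: "F' n * F n = 1"
    and R_braid: "R n * R (Suc n) * R n = R (Suc n) * R n * R (Suc n)"
    and F_braid: "F n * F (Suc n) * F n = F (Suc n) * F n * F (Suc n)"
    and RFF: "R n * F (Suc n) * F n = F (Suc n) * F n * R (Suc n)"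
    and FFR: "R (Suc n) * F n * F (Suc n) = F n * F (Suc n) * R n"
    and M0_A: "M 0 \<in> A (Suc 0)"
    and M_Suc: "M (Suc n) = F n * M n * F' n"
    and RMM_0: "R 0 * (M 0 * M (Suc 0)) = M 0 * M (Suc 0) * R 0"
    and E_R: "E (Suc n) (R n) = 1"
    and E_F: "x \<in> A (Suc n) \<Longrightarrow> E (Suc n) (F n * x * F' n) = E n x"
    and E_cyc: "x \<in> A (Suc (Suc n)) \<Longrightarrow> E n (E (Suc n) (R n * x)) = E n (E (Suc n) (x * R n))"
begin

lemma commute_inverse:
  fixes a b x :: 'r
  assumes "a * b = 1" "b * a = 1" "a * x = x * a"
  shows "b * x = x * b"
  by (metis assms mult.assoc mult.left_neutral mult.right_neutral)

lemma commute_mult: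
  fixes a b x :: 'r
  assumes "a * x = x * a" "b * x = x * b"
  shows "a * b * x = x * (a * b)"
  by (metis assms mult.assoc)

lemma inverse_cancel_left [simp]:
  "R n * (R' n * x) = x" "R' n * (R n * x) = x" "F n * (F' n * x) = x" "F' n * (F n * x) = x"
  by (simp_all flip: mult.assoc)

lemma sc_left: "x * (sc c * y) = sc c * (x * y)"
  by (simp add: sc_central flip: mult.assoc)

lemma sc_0 [simp]: "sc 0 = 0"
  using sc_add[of 0 0] by simp

lemma sc_uminus: "sc (- a) = - sc a"
  using sc_add[of a "- a"] by (simp add: eq_neg_iff_add_eq_0 add.commute)

lemma sc_diff: "sc (a - b) = sc a - sc b"
  using sc_add[of a "- b"] by (simp add: sc_uminus)

lemma A_1 [simp]: "1 \<in> A n"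
  using sc_A[of 1 n] by simp

lemma A_uminus: "x \<in> A n \<Longrightarrow> - x \<in> A n"
  using A_mult[OF sc_A[of "- 1" n], of x] by (simp add: sc_uminus)

lemma A_diff: "x \<in> A n \<Longrightarrow> y \<in> A n \<Longrightarrow> x - y \<in> A n"
  using A_add[of x n "- y"] A_uminus[of y n] by simp

lemma A_mono: "x \<in> A m \<Longrightarrow> m \<le> n \<Longrightarrow> x \<in> A n"
  using lift_Suc_mono_le[of A, OF A_Suc] by blast

lemma R_mem [intro]: "Suc k < n \<Longrightarrow> R k \<in> A n"
  and R'_mem [intro]: "Suc k < n \<Longrightarrow> R' k \<in> A n"
  and F_mem [intro]: "Suc k < n \<Longrightarrow> F k \<in> A n"
  and F'_mem [intro]: "Suc k < n \<Longrightarrow> F' k \<in> A n"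
  by (meson A_mono R_A R'_A F_A F'_A Suc_leI)+

lemma R'_comm: "x \<in> A n \<Longrightarrow> n \<le> m \<Longrightarrow> R' m * x = x * R' m"
  by (meson commute_inverse R_comm RR' R'R)

lemma F'_comm: "x \<in> A n \<Longrightarrow> n \<le> m \<Longrightarrow> F' m * x = x * F' m"
  by (meson commute_inverse F_comm FF' F'F)

lemma E_0 [simp]: "E n 0 = 0"
  using E_add[of n 0 0] by simp

lemma E_uminus: "E n (- x) = - E n x"
  using E_add[of n x "- x"] by (simp add: eq_neg_iff_add_eq_0 add.commute)

lemma E_diff: "E n (x - y) = E n x - E n y"
  using E_add[of n x "- y"] by (simp add: E_uminus)

section \<open>Iterated traces\<close>

definition Er :: "nat \<Rightarrow> nat \<Rightarrow> 'r \<Rightarrow> 'r" where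
  "Er m n x = foldr E [m..<n] x"

lemma Er_refl [simp]: "n \<le> m \<Longrightarrow> Er m n x = x"
  by (simp add: Er_def)

lemma Er_Suc: "m \<le> n \<Longrightarrow> Er m (Suc n) x = Er m n (E n x)"
  by (simp add: Er_def)

lemma Er_split: "m \<le> k \<Longrightarrow> k \<le> n \<Longrightarrow> Er m n x = Er m k (Er k n x)"
  using upt_add_eq_append[of m k "n - k"] by (simp add: Er_def)

lemma Er_first: "m < n \<Longrightarrow> Er m n x = E m (Er (Suc m) n x)"
  by (simp add: Er_def upt_conv_Cons)

lemma Er_A: "x \<in> A n \<Longrightarrow> m \<le> n \<Longrightarrow> Er m n x \<in> A m"
proof (induction n arbitrary: x)
  case (Suc n)
  then show ?case
    by (cases "m = Suc n") (auto simp: Er_Suc le_Suc_eq intro!: Suc.IH E_A)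
qed simp

lemma Er_add: "Er m n (x + y) = Er m n x + Er m n y"
proof (induction n arbitrary: x y)
  case (Suc n)
  then show ?case
    by (cases "m \<le> n") (auto simp: Er_Suc E_add)
qed simp

lemma Er_left: "a \<in> A m \<Longrightarrow> Er m n (a * x) = a * Er m n x"
proof (induction n arbitrary: x)
  case (Suc n)
  then show ?case
    by (cases "m \<le> n") (auto simp: Er_Suc E_left A_mono)
qed simp

lemma Er_right: "a \<in> A m \<Longrightarrow> Er m n (x * a) = Er m n x * a"
proof (induction n arbitrary: x)
  case (Suc n)
  then show ?case
    by (cases "m \<le> n") (auto simp: Er_Suc E_right A_mono)
qed simp

text \<open>The traces over factors beyond \<open>k + 1\<close> are linear over \<open>R k\<close>
  on both sides, so they leave an element to which \<open>E_cyc\<close> applies; the traces over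
  factors below \<open>k\<close> then act on equal arguments.\<close>

lemma Er_cyc_R:
  assumes "m \<le> k" "Suc k < n" "x \<in> A n"
  shows "Er m n (R k * x) = Er m n (x * R k)"
proof -
  have split: "Er m n z = Er m k (E k (E (Suc k) (Er (Suc (Suc k)) n z)))" for z
    using assms Er_split[of m k n z] Er_first[of k n z] Er_first[of "Suc k" n z] by simp
  have "Er (Suc (Suc k)) n x \<in> A (Suc (Suc k))"
    using assms by (intro Er_A) auto
  then show ?thesis
    unfolding split by (simp add: Er_left Er_right R_A E_cyc)
qed

section \<open>The shift by one strand, twisted by \<open>F\<close>\<close>

primrec Fs :: "nat \<Rightarrow> 'r" where
  "Fs 0 = 1"
| "Fs (Suc n) = Fs n * F n"

primrec Fs' :: "nat \<Rightarrow> 'r" where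
  "Fs' 0 = 1"
| "Fs' (Suc n) = F' n * Fs' n"

lemma Fs_inv [simp]: "Fs n * Fs' n = 1" "Fs' n * Fs n = 1"
proof (induction n)
  case (Suc n)
  case 1
  have "Fs n * F n * (F' n * Fs' n) = Fs n * (F n * F' n) * Fs' n" by (simp only: mult.assoc)
  then show ?case using Suc by simp
next
  case (Suc n)
  case 2
  have "F' n * Fs' n * (Fs n * F n) = F' n * (Fs' n * Fs n) * F n" by (simp only: mult.assoc)
  then show ?case using Suc by simp
qed simp_all

lemma Fs_cancel_left [simp]: "Fs n * (Fs' n * x) = x" "Fs' n * (Fs n * x) = x"
  by (simp_all flip: mult.assoc)

lemma Fs_A: "Fs n \<in> A (Suc n)" "Fs' n \<in> A (Suc n)"
  by (induction n) (auto intro!: A_mult intro: A_mono)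

definition Sh :: "nat \<Rightarrow> 'r \<Rightarrow> 'r" where
  "Sh n x = Fs n * x * Fs' n"

text \<open>Conjugation by \<open>F 0 * F 1 * ... * F (n - 1)\<close> gives the same result for
  every \<open>n\<close> with \<open>x \<in> A n\<close>, because the later \<open>F\<close> commute
  with \<open>x\<close>. Taking the least such \<open>n\<close> turns these conjugations into one
  map on the union of the levels. Moving the tensor factors without this twist would not send
  \<open>M k\<close> to the barred copy \<open>M (Suc k)\<close>.\<close>

definition S :: "'r \<Rightarrow> 'r" where
  "S x = Sh (LEAST n. x \<in> A n) x"

lemma Sh_stable: "x \<in> A m \<Longrightarrow> m \<le> n \<Longrightarrow> Sh n x = Sh m x"
proof (induction n)
  case (Suc n)
  show ?case
  proof (cases "m = Suc n")
    case False
    then have "m \<le> n" using Suc by simp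
    then have "F n * x = x * F n" using F_comm Suc by blast
    then have "Fs n * F n * x * (F' n * Fs' n) = Fs n * x * (F n * F' n) * Fs' n"
      by (metis mult.assoc)
    then show ?thesis using Suc.IH[OF Suc.prems(1) \<open>m \<le> n\<close>] by (simp add: Sh_def)
  qed simp
qed simp

lemma S_eq: "x \<in> A n \<Longrightarrow> S x = Sh n x"
  unfolding S_def by (metis LeastI Least_le Sh_stable)

lemma S_A: "x \<in> A n \<Longrightarrow> S x \<in> A (Suc n)"
  using A_mono[of x n "Suc n"] by (simp add: S_eq[of x n] Sh_def A_mult Fs_A)

lemma S_mult: "x \<in> A n \<Longrightarrow> y \<in> A n \<Longrightarrow> S (x * y) = S x * S y"
proof -
  assume "x \<in> A n" "y \<in> A n"
  then show ?thesis
    by (simp add: S_eq[of _ n] A_mult Sh_def mult.assoc)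
qed

lemma S_add: "x \<in> A n \<Longrightarrow> y \<in> A n \<Longrightarrow> S (x + y) = S x + S y"
  by (simp add: S_eq[of _ n] A_add Sh_def algebra_simps)

lemma S_A0 [simp]: "x \<in> A 0 \<Longrightarrow> S x = x"
  by (simp add: S_eq[of x 0] Sh_def)

lemma S_sc [simp]: "S (sc c) = sc c"
  by simp

lemma S_1 [simp]: "S 1 = 1"
  by simp

text \<open>The two innermost conjugating factors \<open>F k\<close> and \<open>F (Suc k)\<close>
  raise the index by \<open>FFR\<close>; the remaining \<open>Fs k\<close> acts only in the first
  \<open>k + 1\<close> factors and commutes with \<open>R (Suc k)\<close>.\<close>

lemma S_R [simp]: "S (R k) = R (Suc k)"
proof -
  have 1: "F k * (F (Suc k) * (R k * z)) = R (Suc k) * (F k * (F (Suc k) * z))" for z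
    using FFR[of k] by (metis mult.assoc)
  have 2: "Fs k * (R (Suc k) * z) = R (Suc k) * (Fs k * z)" for z
    using R_comm[OF Fs_A(1)[of k], of "Suc k"] by (metis mult.assoc order_refl)
  show ?thesis by (simp add: S_eq[OF R_A] Sh_def mult.assoc 1 2)
qed

lemma S_R' [simp]: "S (R' k) = R' (Suc k)"
proof -
  have "S (R' k) * S (R k) = 1" using S_mult[OF R'_A R_A, of k] by simp
  then show ?thesis by (metis RR' S_R mult.assoc mult.left_neutral mult.right_neutral)
qed

lemma M_A [intro]: "M k \<in> A (Suc k)"
proof (induction k)
  case (Suc k)
  then have "M k \<in> A (Suc (Suc k))" by (rule A_mono) simp
  then show ?case by (simp add: M_Suc A_mult F_A F'_A)
qed (rule M0_A)

lemma M_mem [intro]: "k < n \<Longrightarrow> M k \<in> A n"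
  by (meson A_mono M_A Suc_leI)

text \<open>Stated for a general \<open>X\<close> because it serves both for \<open>F\<close>, by
  its braid relation, and for \<open>R\<close>, by compatibility. At \<open>i = j + 2\<close> the
  two conjugations that build \<open>M i\<close> from \<open>M j\<close> replace \<open>X j\<close>
  by \<open>X (Suc j)\<close>, which commutes with \<open>M j\<close>; each further conjugation
  commutes with \<open>X j\<close>.\<close>

lemma far_M:
  assumes X_A: "\<And>k. X k \<in> A (Suc (Suc k))"
    and X_comm: "\<And>m n x. x \<in> A n \<Longrightarrow> n \<le> m \<Longrightarrow> X m * x = x * X m"
    and XFF: "\<And>n. X n * F (Suc n) * F n = F (Suc n) * F n * X (Suc n)"
    and j: "Suc j < i"
  shows "X j * M i = M i * X j"
  using j
proof (induction i)
  case (Suc i)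
  show ?case
  proof (cases "i = Suc j")
    case False
    then have "X j * M i = M i * X j" using Suc by simp
    moreover have "F i * X j = X j * F i" "F' i * X j = X j * F' i"
      using Suc.prems False by (auto intro!: F_comm[OF X_A] F'_comm[OF X_A])
    ultimately show ?thesis unfolding M_Suc by (metis mult.assoc)
  next
    case True
    let ?f = "F (Suc j) * F j" and ?f' = "F' j * F' (Suc j)"
    have inv: "?f * ?f' = 1" "?f' * ?f = 1"
      by (metis FF' F'F mult.assoc mult.right_neutral)+
    have M: "M (Suc i) = ?f * M j * ?f'"
      unfolding True M_Suc by (simp only: mult.assoc)
    have 1: "X j * ?f = ?f * X (Suc j)" using XFF[of j] by (simp only: mult.assoc)
    have 2: "X (Suc j) * M j = M j * X (Suc j)" by (rule X_comm) auto
    have 3: "X (Suc j) * ?f' = ?f' * X j"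
      by (metis 1 inv mult.assoc mult.left_neutral mult.right_neutral)
    show ?thesis unfolding M by (metis 1 2 3 mult.assoc)
  qed
qed simp

lemma F_M: "Suc j < i \<Longrightarrow> F j * M i = M i * F j"
  by (rule far_M) (auto simp: F_A F_comm F_braid)

lemma R_M: "Suc j < i \<Longrightarrow> R j * M i = M i * R j"
  by (rule far_M) (auto simp: R_A R_comm RFF)

lemma S_M [simp]: "S (M k) = M (Suc k)"
proof -
  have 1: "Fs j * M (Suc k) = M (Suc k) * Fs j" if "j \<le> k" for j
    using that
  proof (induction j)
    case (Suc j)
    then show ?case using F_M[of j "Suc k"] commute_mult[of "Fs j" "M (Suc k)" "F j"] by simp
  qed simp
  have "S (M k) = Fs k * M (Suc k) * Fs' k"
    by (simp add: S_eq[OF M_A] Sh_def M_Suc mult.assoc)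
  then show ?thesis using 1[OF order_refl] by (simp add: mult.assoc)
qed

text \<open>In the shift of an element of \<open>A (Suc n)\<close> the innermost conjugation is by
  \<open>F n\<close>; \<open>E_F\<close> strips it and lowers the traced factor by one. The other
  conjugations do not touch the traced factor and pass outside.\<close>

lemma Er_S: "x \<in> A n \<Longrightarrow> m \<le> n \<Longrightarrow> Er (Suc m) (Suc n) (S x) = S (Er m n x)"
proof (induction n arbitrary: x)
  case (Suc n)
  show ?case
  proof (cases "m = Suc n")
    case False
    then have mn: "m \<le> n" using Suc by simp
    have "E (Suc n) (S x) = E (Suc n) (Fs n * (F n * x * F' n) * Fs' n)"
      using S_eq[OF Suc.prems(1)] by (simp add: Sh_def mult.assoc)
    also have "\<dots> = Sh n (E n x)"
      using Suc.prems by (simp add: E_left E_right Fs_A E_F Sh_def)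
    also have "\<dots> = S (E n x)" using S_eq[OF E_A[OF Suc.prems(1)]] by simp
    finally show ?thesis
      using mn Suc.IH[OF E_A[OF Suc.prems(1)] mn] by (simp add: Er_Suc)
  qed simp
qed simp

abbreviation Sk :: "nat \<Rightarrow> 'r \<Rightarrow> 'r" where "Sk k \<equiv> (S ^^ k)"

lemma Sk_A: "x \<in> A n \<Longrightarrow> Sk k x \<in> A (n + k)"
  by (induction k) (auto simp: S_A)

lemma Sk_A': "x \<in> A n \<Longrightarrow> Sk k x \<in> A (k + n)"
  using Sk_A[of x n k] by (simp add: add.commute)

lemma Sk_mult: "x \<in> A n \<Longrightarrow> y \<in> A n \<Longrightarrow> Sk k (x * y) = Sk k x * Sk k y"
  by (induction k) (auto simp: S_mult[OF Sk_A Sk_A])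

lemma Sk_add: "x \<in> A n \<Longrightarrow> y \<in> A n \<Longrightarrow> Sk k (x + y) = Sk k x + Sk k y"
  by (induction k) (auto simp: S_add[OF Sk_A Sk_A])

lemma Sk_A0 [simp]: "x \<in> A 0 \<Longrightarrow> Sk k x = x"
  by (induction k) auto

lemma Sk_1 [simp]: "Sk k 1 = 1"
  by simp

lemma Sk_R [simp]: "Sk k (R j) = R (j + k)"
  by (induction k) auto

lemma Sk_R' [simp]: "Sk k (R' j) = R' (j + k)"
  by (induction k) auto

lemma Sk_M [simp]: "Sk k (M j) = M (j + k)"
  by (induction k) auto

lemma Sk_S: "Sk k (S x) = S (Sk k x)"
  by (metis funpow_swap1)

lemma Er_Sk: "x \<in> A n \<Longrightarrow> m \<le> n \<Longrightarrow> Er (m + k) (n + k) (Sk k x) = Sk k (Er m n x)"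
  by (induction k) (auto simp: Er_S Sk_A)

section \<open>Strings of barred matrices and words that commute with them\<close>

primrec str :: "nat \<Rightarrow> 'r" where
  "str 0 = 1"
| "str (Suc n) = str n * M n"

lemma str_A [intro]: "str n \<in> A n"
  by (induction n) (auto intro!: A_mult intro: A_mono)

lemma str_mem [intro]: "n \<le> m \<Longrightarrow> str n \<in> A m"
  by (meson A_mono str_A)

lemma Sk_str_Suc: "Sk n (str (Suc m)) = Sk n (str m) * M (m + n)"
  using Sk_mult[OF str_mem M_mem, of m "Suc m" m n] by simp

lemma str_add: "str (n + m) = str n * Sk n (str m)"
proof (induction m)
  case (Suc m)
  then show ?case using Sk_str_Suc[of n m] by (simp add: mult.assoc add.commute)
qed simp

lemma str_Suc: "str (Suc n) = M 0 * S (str n)"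
  using str_add[of 1 n] by simp

lemma RMM: "R k * (M k * M (Suc k)) = M k * M (Suc k) * R k"
proof (induction k)
  case (Suc k)
  have mem: "R k \<in> A (Suc (Suc k))" "M k \<in> A (Suc (Suc k))" "M (Suc k) \<in> A (Suc (Suc k))"
    by (auto intro: A_mono R_A)
  have "S (R k * (M k * M (Suc k))) = S (M k * M (Suc k) * R k)" using Suc by simp
  then show ?case using mem by (simp add: S_mult[of _ "Suc (Suc k)"] A_mult)
qed (rule RMM_0)

lemma R_str: "Suc k < n \<Longrightarrow> R k * str n = str n * R k"
proof (induction n)
  case (Suc n)
  show ?case
  proof (cases "n = Suc k")
    case True
    have "R k * str k = str k * R k" by (rule R_comm) auto
    then show ?thesis using RMM[of k] True by simp (metis mult.assoc)
  next
    case False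
    then show ?thesis using Suc R_M[of k n] by simp (metis mult.assoc)
  qed
qed simp

text \<open>Pairs of a word in the \<open>R k\<close> and their inverses and the reversed word, and linear combinations
  of such pairs. Reversal need not be a well-defined map on operators.\<close>

inductive_set Wp :: "nat \<Rightarrow> ('r \<times> 'r) set" for n where
  one: "(1, 1) \<in> Wp n"
| add: "(x, y) \<in> Wp n \<Longrightarrow> (x', y') \<in> Wp n \<Longrightarrow> (x + x', y + y') \<in> Wp n"
| scale: "(x, y) \<in> Wp n \<Longrightarrow> (sc c * x, sc c * y) \<in> Wp n"
| gen: "(x, y) \<in> Wp n \<Longrightarrow> Suc k < n \<Longrightarrow> (R k * x, y * R k) \<in> Wp n"
| gen': "(x, y) \<in> Wp n \<Longrightarrow> Suc k < n \<Longrightarrow> (R' k * x, y * R' k) \<in> Wp n"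

lemma Wp_A: "(x, y) \<in> Wp n \<Longrightarrow> x \<in> A n \<and> y \<in> A n"
  by (induction rule: Wp.induct) (auto intro!: A_add A_mult)

lemma Wp_A1: "(x, y) \<in> Wp n \<Longrightarrow> x \<in> A n"
  using Wp_A by auto

lemma Wp_mult: "(x, y) \<in> Wp n \<Longrightarrow> (x', y') \<in> Wp n \<Longrightarrow> (x * x', y' * y) \<in> Wp n"
proof (induction rule: Wp.induct)
  case (scale x y c)
  then show ?case using Wp.scale[OF scale.IH[OF scale.prems], of c]
    by (simp add: sc_left mult.assoc)
next
  case (gen x y k)
  then show ?case using Wp.gen[OF gen.IH[OF gen.prems], of k] by (simp add: mult.assoc)
next
  case (gen' x y k)
  then show ?case using Wp.gen'[OF gen'.IH[OF gen'.prems], of k] by (simp add: mult.assoc)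
qed (auto simp: distrib_left distrib_right intro: Wp.intros)

lemma Wp_R [intro]: "Suc k < n \<Longrightarrow> (R k, R k) \<in> Wp n"
  and Wp_R' [intro]: "Suc k < n \<Longrightarrow> (R' k, R' k) \<in> Wp n"
  using Wp.gen[OF Wp.one] Wp.gen'[OF Wp.one] by auto

lemma Wp_swap: "(x, y) \<in> Wp n \<Longrightarrow> (y, x) \<in> Wp n"
proof (induction rule: Wp.induct)
  case (gen x y k)
  then show ?case using Wp_mult[OF gen.IH Wp_R] by simp
next
  case (gen' x y k)
  then show ?case using Wp_mult[OF gen'.IH Wp_R'] by simp
qed (auto intro: Wp.intros)

lemma Wp_mono: "(x, y) \<in> Wp n \<Longrightarrow> n \<le> m \<Longrightarrow> (x, y) \<in> Wp m"
  by (induction rule: Wp.induct) (auto intro: Wp.intros)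

lemma Wp_S: "(x, y) \<in> Wp n \<Longrightarrow> (S x, S y) \<in> Wp (Suc n)"
proof (induction rule: Wp.induct)
  case (add x y x' y')
  note mem = Wp_A[OF add.hyps(1)] Wp_A[OF add.hyps(2)]
  then show ?case using Wp.add[OF add.IH] by (simp add: S_add[of _ n])
next
  case (scale x y c)
  note mem = Wp_A[OF scale.hyps]
  then show ?case using Wp.scale[OF scale.IH] by (simp add: S_mult[of _ n])
next
  case (gen x y k)
  note mem = Wp_A[OF gen.hyps(1)] R_mem[OF gen.hyps(2)]
  then show ?case using Wp.gen[OF gen.IH, of "Suc k"] gen.hyps(2) by (simp add: S_mult[of _ n])
next
  case (gen' x y k)
  note mem = Wp_A[OF gen'.hyps(1)] R'_mem[OF gen'.hyps(2)]
  then show ?case using Wp.gen'[OF gen'.IH, of "Suc k"] gen'.hyps(2) by (simp add: S_mult[of _ n])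
qed (simp add: Wp.one)

lemma Wp_Sk: "(x, y) \<in> Wp n \<Longrightarrow> (Sk k x, Sk k y) \<in> Wp (k + n)"
  by (induction k) (auto intro: Wp_S)

lemma Wp_comm:
  assumes "(x, y) \<in> Wp n" and "\<And>k. Suc k < n \<Longrightarrow> R k * z = z * R k"
  shows "x * z = z * x"
  using assms(1)
proof (induction rule: Wp.induct)
  case (scale x y c)
  then show ?case by (simp add: sc_left mult.assoc)
next
  case (gen x y k)
  then show ?case using assms(2) by (metis mult.assoc)
next
  case (gen' x y k)
  then have "R' k * z = z * R' k" using assms(2) commute_inverse[of "R k" "R' k" z] by simp
  then show ?case using gen' by (metis mult.assoc)
qed (auto simp: algebra_simps)

lemma Wp_str: "(x, y) \<in> Wp n \<Longrightarrow> n \<le> m \<Longrightarrow> x * str m = str m * x"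
  by (erule Wp_comm) (auto intro: R_str)

lemma Wp_Sk_str: "(x, y) \<in> Wp n \<Longrightarrow> x * Sk n (str m) = Sk n (str m) * x"
proof (induction m)
  case (Suc m)
  have "x * M (m + n) = M (m + n) * x"
    by (rule Wp_comm[OF Suc.prems], rule R_M) simp
  then show ?case using Suc commute_mult[of "Sk n (str m)" x "M (m + n)"]
    unfolding Sk_str_Suc by metis
qed simp

lemma Wp_A0: "(x, y) \<in> Wp n \<Longrightarrow> c \<in> A 0 \<Longrightarrow> x * c = c * x"
  by (erule Wp_comm) (auto intro: R_comm)

lemma Wp_cyc:
  assumes "(a, a') \<in> Wp n" "z \<in> A (m + n)"
  shows "Er m (m + n) (Sk m a * z) = Er m (m + n) (z * Sk m a)"
  using assms
proof (induction arbitrary: z rule: Wp.induct)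
  case (add x y x' y')
  then show ?case
    by (simp add: Sk_add[OF Wp_A1[OF add.hyps(1)] Wp_A1[OF add.hyps(2)]]
        distrib_left distrib_right Er_add)
next
  case (scale x y c)
  have 1: "Sk m (sc c * x) = sc c * Sk m x"
    using Sk_mult[OF sc_A Wp_A1[OF scale.hyps], of m c] by simp
  then show ?case using scale unfolding 1 by (simp add: mult.assoc sc_left Er_left)
next
  case (gen x y k)
  have 1: "Sk m (R k * x) = R (k + m) * Sk m x"
    using Sk_mult[OF R_mem Wp_A1[OF gen.hyps(1)], of k m] gen by simp
  have z: "z * R (k + m) \<in> A (m + n)" using gen by (auto intro!: A_mult)
  have "Er m (m + n) (R (k + m) * (Sk m x * z)) = Er m (m + n) (Sk m x * z * R (k + m))"
    using gen by (intro Er_cyc_R A_mult Sk_A'[OF Wp_A1[OF gen.hyps(1)]]) auto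
  also have "\<dots> = Er m (m + n) (z * R (k + m) * Sk m x)"
    using gen.IH[OF z] by (simp add: mult.assoc)
  finally show ?case unfolding 1 by (simp add: mult.assoc)
next
  case (gen' x y k)
  have 1: "Sk m (R' k * x) = R' (k + m) * Sk m x"
    using Sk_mult[OF R'_mem Wp_A1[OF gen'.hyps(1)], of k m] gen' by simp
  have z: "z * R' (k + m) \<in> A (m + n)" using gen' by (auto intro!: A_mult)
  \<comment> \<open>Cyclicity is known for \<open>R\<close> only. This \<open>?v\<close> is chosen
    so that \<open>?v * R (k + m)\<close> has the inverse generator on the left and
    \<open>R (k + m) * ?v\<close> has it on the right.\<close>
  let ?v = "R' (k + m) * (Sk m x * z) * R' (k + m)"
  have v: "?v \<in> A (m + n)" using gen' by (intro A_mult Sk_A'[OF Wp_A1[OF gen'.hyps(1)]]) auto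
  have "R' (k + m) * (Sk m x * z) = ?v * R (k + m)" by (simp add: mult.assoc)
  then have "Er m (m + n) (R' (k + m) * (Sk m x * z)) = Er m (m + n) (R (k + m) * ?v)"
    using Er_cyc_R[OF _ _ v, of m "k + m"] gen' by simp
  also have "R (k + m) * ?v = Sk m x * z * R' (k + m)" by (simp flip: mult.assoc)
  also have "Er m (m + n) \<dots> = Er m (m + n) (z * R' (k + m) * Sk m x)"
    using gen'.IH[OF z] by (simp add: mult.assoc)
  finally show ?case unfolding 1 by (simp add: mult.assoc)
qed simp

text \<open>\<open>MB n x\<close> is the matrix \<open>M\<^sup>\<alpha>\<close>, as an operator on the first factor, for \<open>x\<close> the image of \<open>\<alpha>\<close>.\<close>

definition MB :: "nat \<Rightarrow> 'r \<Rightarrow> 'r" where "MB n x = Er (Suc 0) n (str n * x)"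
definition ch :: "nat \<Rightarrow> 'r \<Rightarrow> 'r" where "ch n x = Er 0 n (str n * x)"

lemma ch_MB: "1 \<le> n \<Longrightarrow> ch n x = E 0 (MB n x)"
  by (simp add: ch_def MB_def Er_first)

lemma MB_add: "MB n (x + y) = MB n x + MB n y"
  by (simp add: MB_def distrib_left Er_add)

lemma MB_sc: "MB n (sc c * x) = sc c * MB n x"
  by (simp add: MB_def sc_left Er_left)

lemma ch_sc: "ch n (sc c * x) = sc c * ch n x"
  by (simp add: ch_def sc_left Er_left)

lemma ch_A: "x \<in> A n \<Longrightarrow> ch n x \<in> A 0"
  unfolding ch_def by (intro Er_A A_mult) auto

text \<open>The first factor is not traced, so only operators that avoid it, such as
  \<open>S a\<close>, can be cycled. On the way \<open>S a\<close> has to pass the string of barred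
  matrices, which it does by the defining relations of the algebra.\<close>

lemma MB_cyc:
  assumes "(a, a') \<in> Wp n" "z \<in> A (Suc n)"
  shows "MB (Suc n) (S a * z) = MB (Suc n) (z * S a)"
proof -
  have "str (Suc n) * (S a * z) = S a * (str (Suc n) * z)"
    using Wp_str[OF Wp_S[OF assms(1)]] by (metis mult.assoc order_refl)
  moreover have "str (Suc n) * z \<in> A (1 + n)"
    using assms by (auto intro!: A_mult simp del: str.simps)
  ultimately show ?thesis
    using Wp_cyc[OF assms(1), of "str (Suc n) * z" 1] by (simp add: MB_def mult.assoc)
qed

lemma ch_cyc:
  assumes "(a, a') \<in> Wp n" "z \<in> A n"
  shows "ch n (a * z) = ch n (z * a)"
proof -
  have "str n * (a * z) = a * (str n * z)"
    using Wp_str[OF assms(1)] by (metis mult.assoc order_refl)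
  moreover have "str n * z \<in> A (0 + n)" using assms by (auto intro!: A_mult)
  ultimately show ?thesis
    using Wp_cyc[OF assms(1), of "str n * z" 0] by (simp add: ch_def mult.assoc)
qed

text \<open>\<open>Bop (R 0)\<close> will be left multiplication by \<open>M\<close> in the \<open>\<star>\<close>-product, and \<open>Bop (K 0)\<close> will be
  \<open>T\<^sub>M\<close>.\<close>

definition Bop :: "'r \<Rightarrow> 'r \<Rightarrow> 'r" where "Bop t N = M 0 * E (Suc 0) (S N * t)"

text \<open>The string is \<open>M 0 * S (str n)\<close> and the shift respects traces, so
  everything beyond the second factor can be traced before shifting; \<open>t\<close> acts in the
  first two factors and stays outside. The result depends on \<open>x\<close> only through its
  matrix.\<close>

lemma MB_Suc_t:
  assumes "x \<in> A n" "1 \<le> n" "t \<in> A (Suc (Suc 0))"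
  shows "MB (Suc n) (S x * t) = Bop t (MB n x)"
proof -
  have sx: "str n * x \<in> A n" using assms by (auto intro!: A_mult)
  have "MB (Suc n) (S x * t) = Er (Suc 0) (Suc n) (M 0 * (S (str n * x) * t))"
    using S_mult[of "str n" n x] assms by (simp add: MB_def str_Suc str_A mult.assoc del: str.simps)
  also have "\<dots> = M 0 * E (Suc 0) (Er (Suc (Suc 0)) (Suc n) (S (str n * x)) * t)"
    using assms M0_A A_mono[OF M0_A, of "Suc (Suc 0)"] Er_first[of "Suc 0" "Suc n"]
    by (simp add: Er_left Er_right E_left)
  also have "Er (Suc (Suc 0)) (Suc n) (S (str n * x)) = S (MB n x)"
    using Er_S[OF sx assms(2)] by (simp add: MB_def)
  finally show ?thesis by (simp add: Bop_def)
qed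

lemma MB_Suc_S:
  assumes "x \<in> A n"
  shows "MB (Suc n) (S x) = M 0 * ch n x"
proof -
  have sx: "str n * x \<in> A n" using assms by (auto intro!: A_mult)
  have "MB (Suc n) (S x) = Er (Suc 0) (Suc n) (M 0 * (S (str n * x)))"
    using S_mult[of "str n" n x] assms by (simp add: MB_def str_Suc str_A mult.assoc del: str.simps)
  then show ?thesis
    using Er_S[OF sx, of 0] M0_A by (simp add: Er_left ch_def Er_A[OF sx])
qed

lemma Bop_add: "N \<in> A (Suc 0) \<Longrightarrow> N' \<in> A (Suc 0) \<Longrightarrow> Bop t (N + N') = Bop t N + Bop t N'"
  by (simp add: Bop_def S_add[of N "Suc 0" N'] algebra_simps E_add)

lemma Bop_right:
  assumes "N \<in> A (Suc 0)" "c \<in> A 0" "t * c = c * t"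
  shows "Bop t (N * c) = Bop t N * c"
proof -
  have "c \<in> A (Suc 0)" using assms A_mono by blast
  moreover have "S N * (c * t) = S N * t * c" using assms(3) by (simp add: mult.assoc)
  ultimately show ?thesis using assms E_right[of c "Suc 0" "S N * t"]
    by (simp add: Bop_def S_mult[of N "Suc 0" c] mult.assoc)
qed

lemma Bop_A: "N \<in> A (Suc 0) \<Longrightarrow> t \<in> A (Suc (Suc 0)) \<Longrightarrow> Bop t N \<in> A (Suc 0)"
  unfolding Bop_def using S_A[of N "Suc 0"] M0_A by (auto intro!: A_mult E_A)

text \<open>In \<open>x * Sk n y * w\<close> the traces beyond factor \<open>n\<close> see only the
  shifted \<open>y\<close> and turn it into its matrix, placed in factor \<open>n\<close>; what
  remains is a function of that matrix. \<open>Lop'\<close> does the same for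
  \<open>u * Sk i x * y\<close> with the roles of the two factors exchanged. Thus a star product
  becomes linear in the matrix of one factor, with a representative chosen for the other
  only.\<close>

definition Lop :: "nat \<Rightarrow> 'r \<Rightarrow> 'r \<Rightarrow> 'r \<Rightarrow> 'r" where
  "Lop n x w N = Er (Suc 0) (Suc n) (str n * x * Sk n N * w)"

definition Lop' :: "nat \<Rightarrow> 'r \<Rightarrow> 'r \<Rightarrow> 'r \<Rightarrow> 'r" where
  "Lop' i y u N = Er (Suc 0) (Suc i) (u * str i * Sk i N * y)"

lemma MB_Lop:
  assumes x: "(x, x') \<in> Wp n" and y: "y \<in> A i" and w: "w \<in> A (Suc n)" and i: "1 \<le> i"
  shows "MB (n + i) (x * Sk n y * w) = Lop n x w (MB i y)"
proof -
  have sy: "str i * y \<in> A i" using y by (auto intro!: A_mult)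
  have c: "x * (Sk n (str i) * v) = Sk n (str i) * (x * v)" for v
    using Wp_Sk_str[OF x, of i] by (simp flip: mult.assoc)
  have "str (n + i) * (x * Sk n y * w) = str n * x * Sk n (str i * y) * w"
    using Sk_mult[OF str_A y, of n] by (simp add: str_add mult.assoc c)
  then have "MB (n + i) (x * Sk n y * w) = Er (Suc 0) (Suc n) (Er (Suc n) (n + i) (str n * x * Sk n (str i * y) * w))"
    using i Er_split[of "Suc 0" "Suc n" "n + i"] by (simp add: MB_def)
  also have "Er (Suc n) (n + i) (str n * x * Sk n (str i * y) * w)
      = str n * x * Er (Suc n) (n + i) (Sk n (str i * y)) * w"
    using w Wp_A1[OF x] by (simp add: Er_right Er_left A_mono[of _ n] A_mult str_A)
  also have "Er (Suc n) (n + i) (Sk n (str i * y)) = Sk n (MB i y)"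
    using Er_Sk[OF sy i, of n] by (simp add: MB_def add.commute)
  finally show ?thesis by (simp add: Lop_def)
qed

lemma MB_Lop':
  assumes x: "x \<in> A n" and y: "y \<in> A (Suc i)" and u: "(u, u') \<in> Wp (Suc i)" and n: "1 \<le> n"
  shows "MB (i + n) (u * Sk i x * y) = Lop' i y u (MB n x)"
proof -
  have sx: "str n * x \<in> A n" using x by (auto intro!: A_mult)
  have "str (i + n) * (u * Sk i x * y) = u * str (i + n) * Sk i x * y"
    using Wp_str[OF u, of "i + n"] n by (simp flip: mult.assoc)
  also have "\<dots> = u * str i * Sk i (str n * x) * y"
    using Sk_mult[OF str_A x, of i] by (simp add: str_add mult.assoc)
  finally have "MB (i + n) (u * Sk i x * y)
      = Er (Suc 0) (Suc i) (Er (Suc i) (i + n) (u * str i * Sk i (str n * x) * y))"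
    using n Er_split[of "Suc 0" "Suc i" "i + n"] by (simp add: MB_def)
  also have "Er (Suc i) (i + n) (u * str i * Sk i (str n * x) * y)
      = u * str i * Er (Suc i) (i + n) (Sk i (str n * x)) * y"
    using y Wp_A1[OF u] by (simp add: Er_right Er_left A_mono[OF str_A] A_mult)
  also have "Er (Suc i) (i + n) (Sk i (str n * x)) = Sk i (MB n x)"
    using Er_Sk[OF sx n, of i] by (simp add: MB_def add.commute)
  finally show ?thesis by (simp add: Lop'_def)
qed

lemma Lop_add: "N \<in> A (Suc 0) \<Longrightarrow> N' \<in> A (Suc 0) \<Longrightarrow> Lop n x w (N + N') = Lop n x w N + Lop n x w N'"
  by (simp add: Lop_def Sk_add[of N "Suc 0" N'] algebra_simps Er_add)

lemma Lop'_add: "N \<in> A (Suc 0) \<Longrightarrow> N' \<in> A (Suc 0) \<Longrightarrow> Lop' n x w (N + N') = Lop' n x w N + Lop' n x w N'"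
  by (simp add: Lop'_def Sk_add[of N "Suc 0" N'] algebra_simps Er_add)

lemma Lop_right:
  assumes "N \<in> A (Suc 0)" "c \<in> A 0" "w * c = c * w"
  shows "Lop n x w (N * c) = Lop n x w N * c"
proof -
  have c: "c \<in> A (Suc 0)" using assms A_mono by blast
  have "str n * x * (Sk n N * c) * w = str n * x * Sk n N * w * c"
    using assms(3) by (metis mult.assoc)
  then show ?thesis using assms c
    by (simp add: Lop_def Sk_mult[of N "Suc 0" c] Er_right[of c "Suc 0"])
qed

lemma Lop'_right:
  assumes "N \<in> A (Suc 0)" "c \<in> A 0" "w * c = c * w"
  shows "Lop' n w u (N * c) = Lop' n w u N * c"
proof -
  have c: "c \<in> A (Suc 0)" using assms A_mono by blast
  have "u * str n * (Sk n N * c) * w = u * str n * Sk n N * w * c"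
    using assms(3) by (metis mult.assoc)
  then show ?thesis using assms c
    by (simp add: Lop'_def Sk_mult[of N "Suc 0" c] Er_right[of c "Suc 0"])
qed

end

section \<open>The star product\<close>

context r_tower
begin

text \<open>\<open>ys n\<close> is \<open>R' 0 * R' 1 * ... * R' (n - 1)\<close> and
  \<open>zs i\<close> is the same product in descending order; \<open>vs\<close> and
  \<open>zs'\<close> are their inverses. Each carries a single strand across a block of
  others.\<close>

primrec ys :: "nat \<Rightarrow> 'r" where
  "ys 0 = 1"
| "ys (Suc n) = R' 0 * S (ys n)"

primrec vs :: "nat \<Rightarrow> 'r" where
  "vs 0 = 1"
| "vs (Suc n) = S (vs n) * R 0"

primrec zs :: "nat \<Rightarrow> 'r" where
  "zs 0 = 1"
| "zs (Suc i) = R' i * zs i"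

primrec zs' :: "nat \<Rightarrow> 'r" where
  "zs' 0 = 1"
| "zs' (Suc i) = zs' i * R i"

text \<open>The crossing of a block of \<open>n\<close> strands with a block of \<open>i\<close>
  strands, written with inverse generators, and its inverse \<open>ts'\<close>. Moving across
  \<open>ts n i\<close> turns \<open>x\<close> on the first block into \<open>Sk i x\<close>
  (\<open>ts_comm\<close>) and \<open>Sk n y\<close> into \<open>y\<close>
  (\<open>ts_Sk\<close>).\<close>

primrec ts :: "nat \<Rightarrow> nat \<Rightarrow> 'r" where
  "ts 0 i = 1"
| "ts (Suc n) i = zs i * S (ts n i)"

primrec ts' :: "nat \<Rightarrow> nat \<Rightarrow> 'r" where
  "ts' 0 i = 1"
| "ts' (Suc n) i = S (ts' n i) * zs' i"

definition Wset :: "nat \<Rightarrow> 'r set" where "Wset n = fst ` Wp n"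

lemma Wset_iff: "x \<in> Wset n \<longleftrightarrow> (\<exists>y. (x, y) \<in> Wp n)"
  by (force simp: Wset_def)

lemma Wset_mult: "x \<in> Wset n \<Longrightarrow> y \<in> Wset n \<Longrightarrow> x * y \<in> Wset n"
  unfolding Wset_iff using Wp_mult by blast

lemma Wset_S: "x \<in> Wset n \<Longrightarrow> S x \<in> Wset (Suc n)"
  unfolding Wset_iff using Wp_S by blast

lemma Wset_mono: "x \<in> Wset n \<Longrightarrow> n \<le> m \<Longrightarrow> x \<in> Wset m"
  unfolding Wset_iff using Wp_mono by blast

lemma Wset_A: "x \<in> Wset n \<Longrightarrow> x \<in> A n"
  unfolding Wset_iff using Wp_A by blast

lemma Wset_1 [simp]: "1 \<in> Wset n"
  unfolding Wset_iff using Wp.one by blast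

lemma Wset_R [intro]: "Suc k < n \<Longrightarrow> R k \<in> Wset n"
  and Wset_R' [intro]: "Suc k < n \<Longrightarrow> R' k \<in> Wset n"
  unfolding Wset_iff by blast+

lemma Wset_Sk: "x \<in> Wset n \<Longrightarrow> Sk k x \<in> Wset (k + n)"
  unfolding Wset_iff using Wp_Sk by blast

lemma Wset_A0: "x \<in> Wset n \<Longrightarrow> c \<in> A 0 \<Longrightarrow> x * c = c * x"
  unfolding Wset_iff using Wp_A0 by blast

lemma ys_W: "ys n \<in> Wset (Suc n)" and vs_W: "vs n \<in> Wset (Suc n)"
  by (induction n) (auto intro!: Wset_mult Wset_S)

lemma zs_W: "zs i \<in> Wset (Suc i)" and zs'_W: "zs' i \<in> Wset (Suc i)"
proof (induction i)
  case (Suc i)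
  {
    case 1
    then show ?case using Suc(1) Wset_mono[of _ "Suc i" "Suc (Suc i)"] by (auto intro!: Wset_mult)
  next
    case 2
    then show ?case using Suc(2) Wset_mono[of _ "Suc i" "Suc (Suc i)"] by (auto intro!: Wset_mult)
  }
qed simp_all

lemma ts_W: "ts n i \<in> Wset (n + i)" and ts'_W: "ts' n i \<in> Wset (n + i)"
proof -
  have "zs i \<in> Wset (Suc (n + i))" "zs' i \<in> Wset (Suc (n + i))" for n
    using Wset_mono[OF zs_W, of i "Suc (n + i)"] Wset_mono[OF zs'_W, of i "Suc (n + i)"] by auto
  then show "ts n i \<in> Wset (n + i)" "ts' n i \<in> Wset (n + i)"
    by (induction n) (auto intro!: Wset_mult Wset_S)
qed

lemma zs_inv: "zs i * zs' i = 1" "zs' i * zs i = 1"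
proof (induction i)
  case (Suc i)
  have cancel: "zs i * (zs' i * x) = x" for x using Suc by (simp flip: mult.assoc)
  {
    case 1
    show ?case by (simp add: mult.assoc cancel)
  next
    case 2
    show ?case using Suc by (simp add: mult.assoc)
  }
qed simp_all

lemma ts_inv: "ts n i * ts' n i = 1" "ts' n i * ts n i = 1"
proof (induction n)
  case (Suc n)
  have mem: "ts n i \<in> A (n + i)" "ts' n i \<in> A (n + i)"
    using ts_W ts'_W Wset_A by blast+
  have "S (ts n i) * S (ts' n i) = 1" "S (ts' n i) * S (ts n i) = 1"
    using Suc by (simp_all flip: S_mult[OF mem] S_mult[OF mem(2,1)])
  then have cancel: "S (ts n i) * (S (ts' n i) * x) = x" "S (ts' n i) * S (ts n i) = 1" for x
    by (simp_all flip: mult.assoc)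
  have cancel2: "zs' i * (zs i * x) = x" for x using zs_inv by (simp flip: mult.assoc)
  {
    case 1
    show ?case by (simp add: mult.assoc cancel zs_inv)
  next
    case 2
    show ?case by (simp add: mult.assoc cancel cancel2)
  }
qed simp_all

lemma ys_vs: "ys n * vs n = 1" "vs n * ys n = 1"
proof (induction n)
  case (Suc n)
  have mem: "ys n \<in> A (Suc n)" "vs n \<in> A (Suc n)"
    using ys_W vs_W Wset_A by blast+
  have "S (ys n) * S (vs n) = 1" "S (vs n) * S (ys n) = 1"
    using Suc by (simp_all flip: S_mult[OF mem] S_mult[OF mem(2,1)])
  then have cancel: "S (ys n) * (S (vs n) * x) = x" "S (vs n) * S (ys n) = 1" for x
    by (simp_all flip: mult.assoc)
  {
    case 1
    show ?case by (simp add: mult.assoc cancel)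
  next
    case 2
    show ?case by (simp add: mult.assoc cancel)
  }
qed simp_all

lemma left_solve:
  fixes s s' x y :: 'r
  assumes "s' * s = 1" "s * x = y" shows "x = s' * y"
proof -
  have "s' * y = s' * s * x" unfolding assms(2)[symmetric] by (simp only: mult.assoc)
  then show ?thesis unfolding assms(1) by simp
qed

lemma right_solve:
  fixes s s' x y :: 'r
  assumes "s * s' = 1" "x * s = y" shows "x = y * s'"
proof -
  have "y * s' = x * (s * s')" unfolding assms(2)[symmetric] by (simp only: mult.assoc)
  then show ?thesis unfolding assms(1) by simp
qed

lemma mult_left_form:
  fixes a b c d z :: 'r
  assumes "a * b = c * d" shows "a * (b * z) = c * (d * z)"
proof -
  have "a * (b * z) = a * b * z" by (simp only: mult.assoc)
  then show ?thesis unfolding assms by (simp only: mult.assoc)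
qed

lemma braid_left: "R k * (R (Suc k) * (R k * z)) = R (Suc k) * (R k * (R (Suc k) * z))"
  using arg_cong[OF R_braid[of k], of "\<lambda>v. v * z"] by (simp only: mult.assoc)

lemma R'R'R: "R' k * (R' (Suc k) * R k) = R (Suc k) * (R' k * R' (Suc k))"
proof -
  have "R (Suc k) * (R k * (R (Suc k) * (R' k * R' (Suc k)))) = R k"
    by (subst braid_left[symmetric]) simp
  from left_solve[OF R'R left_solve[OF R'R this]] show ?thesis by (rule HOL.sym)
qed

lemma R'R'R2: "R' (Suc k) * (R' k * R (Suc k)) = R k * (R' (Suc k) * R' k)"
proof -
  have "R k * (R (Suc k) * (R k * (R' (Suc k) * R' k))) = R (Suc k)"
    by (subst braid_left) simp
  from left_solve[OF R'R left_solve[OF R'R this]] show ?thesis by (rule HOL.sym)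
qed

lemma R_far: "Suc j < i \<Longrightarrow> R i * R j = R j * R i"
  and R'_far: "Suc j < i \<Longrightarrow> R' i * R j = R j * R' i"
  by (auto intro: R_comm[OF R_A] R'_comm[OF R_A])

text \<open>An intertwining relation checked on generators extends to inverses, products and linear
  combinations. All rules for moving a word through \<open>ys\<close>, \<open>zs\<close> and
  elements of other factors are instances.\<close>

lemma W_intertwine:
  assumes x: "x \<in> Wset n" and y: "\<And>k. Suc k < n \<Longrightarrow> y * R (k + a) = R (k + b) * y"
  shows "y * Sk a x = Sk b x * y"
proof -
  obtain x' where "(x, x') \<in> Wp n" using x by (auto simp: Wset_iff)
  then show ?thesis
  proof (induction rule: Wp.induct)
    case (add x x' z z')
    have "Sk c (x + z) = Sk c x + Sk c z" for c
      by (rule Sk_add[OF Wp_A1[OF add.hyps(1)] Wp_A1[OF add.hyps(2)]])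
    then show ?case using add.IH by (simp add: distrib_left distrib_right)
  next
    case (scale x x' c)
    have "Sk i (sc c * x) = sc c * Sk i x" for i
      using Sk_mult[OF sc_A Wp_A1[OF scale.hyps], of i c] by simp
    then show ?case using scale.IH by (simp add: sc_left mult.assoc)
  next
    case (gen x x' k)
    have 1: "Sk i (R k * x) = R (k + i) * Sk i x" for i
      using Sk_mult[OF R_mem[OF gen.hyps(2)] Wp_A1[OF gen.hyps(1)], of i] by simp
    have "y * Sk a (R k * x) = R (k + b) * (y * Sk a x)"
      unfolding 1 by (rule mult_left_form[OF y[OF gen.hyps(2)]])
    then show ?case unfolding 1 gen.IH by (simp add: mult.assoc)
  next
    case (gen' x x' k)
    have 1: "Sk i (R' k * x) = R' (k + i) * Sk i x" for i
      using Sk_mult[OF R'_mem[OF gen'.hyps(2)] Wp_A1[OF gen'.hyps(1)], of i] by simp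
    have "R (k + b) * (y * R' (k + a)) = y"
      unfolding mult_left_form[OF y[OF gen'.hyps(2)], symmetric] by simp
    then have "y * R' (k + a) = R' (k + b) * y" by (rule left_solve[OF R'R])
    then have "y * Sk a (R' k * x) = R' (k + b) * (y * Sk a x)"
      unfolding 1 by (rule mult_left_form)
    then show ?case unfolding 1 gen'.IH by (simp add: mult.assoc)
  qed simp
qed

lemma W_Sk_comm:
  assumes "x \<in> Wset n" "a \<in> A k"
  shows "Sk k x * a = a * Sk k x"
proof (rule W_intertwine[OF assms(1), symmetric])
  fix j show "a * R (j + k) = R (j + k) * a"
    by (rule R_comm[OF assms(2), symmetric]) simp
qed

lemma W_S2_R0: "x \<in> Wset n \<Longrightarrow> S (S x) * R 0 = R 0 * S (S x)"
  using W_Sk_comm[of x n "R 0" "Suc (Suc 0)"] R_A[of 0] by simp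

lemma ys_R: "Suc k < n \<Longrightarrow> ys n * R k = R (Suc k) * ys n"
proof (induction n arbitrary: k)
  case (Suc n)
  show ?case
  proof (cases k)
    case k: (Suc j)
    have "S (ys n * R j) = S (R (Suc j) * ys n)"
      using Suc.IH[of j] Suc.prems k by simp
    moreover have mem: "ys n \<in> A (Suc n)" "R j \<in> A (Suc n)" "R (Suc j) \<in> A (Suc n)"
      using Wset_A[OF ys_W] Suc.prems k by auto
    ultimately have 1: "S (ys n) * R k = R (Suc k) * S (ys n)"
      using k by (simp add: S_mult[of _ "Suc n"])
    have "R' 0 * R (Suc k) = R (Suc k) * R' 0"
      using R_comm[OF R'_A, of 0 "Suc k"] k by simp
    note 2 = mult_left_form[OF this]
    show ?thesis by (simp add: mult.assoc 1 2)
  next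
    case 0
    with Suc.prems obtain m where n: "n = Suc m" by (cases n) auto
    have mem: "ys m \<in> A (Suc m)" using ys_W Wset_A by blast
    have 1: "S (ys n) = R' (Suc 0) * S (S (ys m))"
      using S_mult[OF R'_mem S_A[OF mem], of 0] n by simp
    have 2: "R' 0 * (R' (Suc 0) * (R 0 * z)) = R (Suc 0) * (R' 0 * (R' (Suc 0) * z))" for z
      using arg_cong[OF R'R'R[of 0], of "\<lambda>v. v * z"] by (simp only: mult.assoc)
    show ?thesis using W_S2_R0[OF ys_W[of m]] 0 by (simp add: 1 2 mult.assoc)
  qed
qed simp

lemma ys_comm: "x \<in> Wset n \<Longrightarrow> ys n * x = S x * ys n"
  using W_intertwine[of x n "ys n" 0 1] by (simp add: ys_R)

lemma zs_R: "Suc k < i \<Longrightarrow> zs i * R (Suc k) = R k * zs i"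
proof (induction i)
  case (Suc i)
  show ?case
  proof (cases "Suc k = i")
    case True
    have 1: "R' (Suc k) * (R' k * (R (Suc k) * z)) = R k * (R' (Suc k) * (R' k * z))" for z
      using arg_cong[OF R'R'R2[of k], of "\<lambda>v. v * z"] by (simp only: mult.assoc)
    have 2: "zs k * R (Suc k) = R (Suc k) * zs k"
      using R_comm[OF Wset_A[OF zs_W[of k]], of "Suc k"] by simp
    show ?thesis using True[symmetric] by (simp add: mult.assoc 1 2)
  next
    case False
    then have "R' i * R k = R k * R' i" "zs i * R (Suc k) = R k * zs i"
      using Suc R'_far by auto
    then show ?thesis by (simp add: mult.assoc mult_left_form[of "R' i" "R k"])
  qed
qed simp

lemma zs_comm: "x \<in> Wset i \<Longrightarrow> zs i * S x = x * zs i"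
  using W_intertwine[of x i "zs i" 1 0] by (simp add: zs_R)

lemma zs_Suc: "zs (Suc i) = S (zs i) * R' 0"
proof (induction i)
  case (Suc i)
  have "S (zs (Suc i)) = R' (Suc i) * S (zs i)"
    using S_mult[OF R'_mem Wset_A[OF zs_W[of i]], of i]
      S_mult[OF R'_A A_mono[OF Wset_A[OF zs_W[of i]]], of i] by simp
  then show ?case using Suc by (simp add: mult.assoc)
qed simp

lemma zs'_Suc: "zs' (Suc i) = R 0 * S (zs' i)"
proof (induction i)
  case (Suc i)
  have "S (zs' (Suc i)) = S (zs' i) * R (Suc i)"
    using S_mult[OF A_mono[OF Wset_A[OF zs'_W[of i]]] R_A, of i] by simp
  then show ?case using Suc by (simp add: mult.assoc)
qed simp

lemma ts_Sk: "y \<in> Wset i \<Longrightarrow> ts n i * Sk n y = y * ts n i"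
proof (induction n)
  case (Suc n)
  have mem: "ts n i \<in> A (n + i)" "Sk n y \<in> A (n + i)" "y \<in> A (n + i)"
    using Wset_A[OF ts_W] Sk_A'[OF Wset_A[OF Suc.prems]] A_mono[OF Wset_A[OF Suc.prems], of "n + i"]
    by auto
  have "S (ts n i * Sk n y) = S (y * ts n i)" using Suc by simp
  then have "S (ts n i) * S (Sk n y) = S y * S (ts n i)"
    using mem by (simp add: S_mult[of _ "n + i"])
  then show ?case
    by (simp add: mult.assoc mult_left_form[OF zs_comm[OF Suc.prems]])
qed simp

text \<open>The definition of \<open>ts\<close> removes one strand from the first block; this
  removes one from the second, as the induction on \<open>i\<close> in \<open>ts_comm\<close>
  requires.\<close>

lemma ts_Suc_i: "ts n (Suc i) = Sk i (ys n) * ts n i"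
proof (induction n)
  case (Suc n)
  have mem: "ts n i \<in> A (Suc (n + i))" "Sk i (ys n) \<in> A (Suc (n + i))"
    using A_mono[OF Wset_A[OF ts_W[of n i]], of "Suc (n + i)"] Sk_A[OF Wset_A[OF ys_W[of n]], of i]
    by simp_all
  have "Sk (Suc i) (ys n) * zs i = zs i * Sk (Suc i) (ys n)"
    by (rule W_Sk_comm[OF ys_W Wset_A[OF zs_W]])
  then have 1: "zs i * S (Sk i (ys n)) = S (Sk i (ys n)) * zs i" by simp
  have 2: "Sk i (ys (Suc n)) = R' i * S (Sk i (ys n))"
    using Sk_mult[OF R'_mem S_A[OF Wset_A[OF ys_W[of n]]], of 0 i] by (simp add: Sk_S)
  show ?case using Suc unfolding 2
    by (simp add: S_mult[OF mem(2,1)] mult.assoc mult_left_form[OF 1])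
qed simp

lemma ts_0 [simp]: "ts n 0 = 1"
  by (induction n) auto

lemma ts_comm: "x \<in> Wset n \<Longrightarrow> ts n i * x = Sk i x * ts n i"
proof (induction i)
  case (Suc i)
  have mem: "ys n \<in> A (Suc n)" "x \<in> A (Suc n)" "S x \<in> A (Suc n)"
    using Wset_A[OF ys_W] Wset_A[OF Suc.prems] A_mono[of x n "Suc n"] S_A by auto
  have 1: "Sk i (ys n) * Sk i x = Sk i (S x) * Sk i (ys n)"
    using ys_comm[OF Suc.prems] mem by (simp flip: Sk_mult)
  show ?case unfolding ts_Suc_i
    by (simp add: mult.assoc Suc.IH[OF Suc.prems] mult_left_form[OF 1] Sk_S)
qed simp

lemma ts_Suc_i': "ts n (Suc i) = S (ts n i) * ys n"
proof (induction i)
  case (Suc i)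
  have mem: "ts n i \<in> A (Suc (n + i))" "Sk i (ys n) \<in> A (Suc (n + i))"
    using A_mono[OF Wset_A[OF ts_W[of n i]], of "Suc (n + i)"] Sk_A[OF Wset_A[OF ys_W[of n]], of i]
    by simp_all
  show ?case
    by (subst ts_Suc_i, subst Suc.IH)
      (simp add: ts_Suc_i S_mult[OF mem(2,1)] mult.assoc)
qed (simp add: ts_Suc_i)

text \<open>The last factor of \<open>\<alpha> \<star> \<beta>\<close> is \<open>w n\<close>, and \<open>u n\<close> is its reversal.\<close>

definition w :: "nat \<Rightarrow> 'r" where "w n = S (vs (n - 1)) * R 0 * S (ys (n - 1))"
definition u :: "nat \<Rightarrow> 'r" where "u n = S (zs (n - 1)) * zs' n"

lemma Wp_ys_zs: "(ys n, zs n) \<in> Wp (Suc n)"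
proof (induction n)
  case (Suc n)
  show ?case
    using Wp_mult[OF Wp_R'[of 0] Wp_S[OF Suc]] by (simp only: zs_Suc) simp
qed (simp add: Wp.one)

lemma Wp_vs_zs': "(vs n, zs' n) \<in> Wp (Suc n)"
proof (induction n)
  case (Suc n)
  show ?case
    using Wp_mult[OF Wp_S[OF Suc] Wp_R[of 0]] by (simp only: zs'_Suc) simp
qed (simp add: Wp.one)

lemma Wp_w_u:
  assumes "1 \<le> n"
  shows "(w n, u n) \<in> Wp (Suc n)"
proof -
  obtain m where n: "n = Suc m" using assms by (cases n) auto
  have "(S (vs m) * R 0 * S (ys m), S (zs m) * (R 0 * S (zs' m))) \<in> Wp (Suc (Suc m))"
    using Wp_mult[OF Wp_mult[OF Wp_S[OF Wp_vs_zs'] Wp_R] Wp_S[OF Wp_ys_zs], of 0 m] by simp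
  then show ?thesis by (simp only: n w_def u_def zs'_Suc) simp
qed

lemma w_W: "1 \<le> n \<Longrightarrow> w n \<in> Wset (Suc n)"
  unfolding Wset_iff using Wp_w_u by blast

text \<open>The operator \<open>ts n i\<close> moves \<open>n\<close> strands across \<open>i\<close> strands; cycling it around the trace turns a
  product that is linear in \<open>MB i y\<close> into one that is linear in \<open>MB n x\<close>.\<close>

lemma MB_star:
  assumes x: "x \<in> Wset n" and y: "y \<in> Wset i" and n: "1 \<le> n" and i: "1 \<le> i"
  shows "MB (n + i) (x * Sk n y * w n) = MB (n + i) (u i * Sk i x * y)"
proof -
  obtain m where m: "n = Suc m" using n by (cases n) auto
  obtain j where j: "i = Suc j" using i by (cases i) auto
  \<comment> \<open>\<open>ts n i\<close> itself involves the first strand, which is not traced; its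
    factor \<open>?s\<close> avoids that strand, so \<open>?s\<close> is what can be cycled.\<close>
  let ?s = "S (ts m i)" and ?s' = "S (ts' m i)"
  have ts_mem: "ts m i \<in> A (m + i)" "ts' m i \<in> A (m + i)"
    using ts_W ts'_W Wset_A by blast+
  have ss': "?s * ?s' = 1" "?s' * ?s = 1"
    using ts_inv[of m i] by (simp_all flip: S_mult[OF ts_mem] S_mult[OF ts_mem(2,1)])
  have "?s = S (S (ts m j)) * S (ys m)"
    using S_mult[OF _ A_mono[OF Wset_A[OF ys_W[of m]]], of "S (ts m j)" "Suc (m + j)"]
      S_A[OF Wset_A[OF ts_W], of m j] by (simp only: j ts_Suc_i')
  moreover have "S (ys m) * (S (vs m) * z) = z" for z
  proof -
    have "S (ys m) * S (vs m) = 1"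
      using ys_vs(1)[of m] Wset_A[OF ys_W[of m]] Wset_A[OF vs_W[of m]]
      by (simp flip: S_mult[of _ "Suc m"])
    then show ?thesis by (simp flip: mult.assoc)
  qed
  \<comment> \<open>\<open>w n\<close> is \<open>R 0\<close> conjugated by \<open>S (vs m)\<close>.
    Moving \<open>?s\<close> across undoes this conjugation, as \<open>?s\<close> ends in
    \<open>S (ys m)\<close> and its other factor commutes with \<open>R 0\<close>.\<close>
  ultimately have sw: "?s * w n = R 0 * ?s"
    by (simp add: w_def m mult.assoc mult_left_form[OF W_S2_R0[OF ts_W]])
  have s_eq: "?s = zs' i * ts n i"
    using zs_inv[of i] by (simp add: m flip: mult.assoc)
  have ts_eq: "ts n i = zs i * ?s" by (simp add: m)
  have zsR: "zs i * R 0 = S (zs j)" by (simp only: j zs_Suc) (simp add: mult.assoc)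
  define Y where "Y = zs' i * (Sk i x * (y * S (zs j)))"
  have "?s * (x * Sk n y * w n) = zs' i * (ts n i * x * Sk n y * w n)"
    by (simp add: s_eq mult.assoc del: ts.simps)
  also have "\<dots> = zs' i * (Sk i x * (ts n i * Sk n y) * w n)"
    by (simp only: ts_comm[OF x] mult.assoc)
  also have "\<dots> = zs' i * (Sk i x * (y * (ts n i * w n)))"
    by (simp only: ts_Sk[OF y] mult.assoc)
  also have "\<dots> = zs' i * (Sk i x * (y * (zs i * (?s * w n))))"
    by (simp only: ts_eq mult.assoc)
  also have "\<dots> = Y * ?s"
    by (simp add: sw Y_def zsR[symmetric] mult.assoc)
  finally have "x * Sk n y * w n = ?s' * (Y * ?s)"
    by (rule left_solve[OF ss'(2)])
  moreover have mem: "zs' i * (Sk i x * y) \<in> A (Suc (m + i))"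
  proof (intro A_mult)
    show "zs' i \<in> A (Suc (m + i))" by (rule A_mono[OF Wset_A[OF zs'_W]]) simp
    show "Sk i x \<in> A (Suc (m + i))" using Sk_A[OF Wset_A[OF x], of i] by (simp add: m)
    show "y \<in> A (Suc (m + i))" by (rule A_mono[OF Wset_A[OF y]]) simp
  qed
  moreover have "S (zs j) \<in> A (Suc (m + i))"
    by (rule A_mono[OF S_A[OF Wset_A[OF zs_W[of j]]]]) (simp add: j)
  then have "Y \<in> A (Suc (m + i))"
    using A_mult[OF mem] by (simp add: Y_def mult.assoc)
  then have "MB (Suc (m + i)) (?s' * (Y * ?s)) = MB (Suc (m + i)) (Y * ?s * ?s')"
    using ts'_W[of m i] S_A[OF ts_mem(1)] MB_cyc[of "ts' m i" _ "m + i" "Y * ?s"]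
    by (auto simp: Wset_iff A_mult)
  ultimately have "MB (n + i) (x * Sk n y * w n) = MB (n + i) (zs' i * (Sk i x * y) * S (zs j))"
    by (simp add: m mult.assoc ss' Y_def)
  also have "\<dots> = MB (n + i) (S (zs j) * (zs' i * (Sk i x * y)))"
  proof -
    have "zs j \<in> Wset (m + i)" using Wset_mono[OF zs_W[of j], of "m + i"] j by simp
    then obtain z' where "(zs j, z') \<in> Wp (m + i)" by (auto simp: Wset_iff)
    then show ?thesis using MB_cyc[of "zs j" z' "m + i"] mem by (simp add: m)
  qed
  finally show ?thesis by (simp add: u_def j mult.assoc)
qed

text \<open>By the braid relations \<open>w n\<close> is not only a conjugate of \<open>R 0\<close>
  but also \<open>ys m * R m * vs m\<close> with \<open>m = n - 1\<close>. There the outer factors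
  do not meet the traced factor and cancel once \<open>E_R\<close> has removed
  \<open>R m\<close>.\<close>

lemma E_w:
  assumes "1 \<le> n" shows "E n (w n) = 1"
proof -
  obtain m where n: "n = Suc m" using assms by (cases n) auto
  have vs: "vs (Suc m) = R m * vs m" for m
  proof (induction m)
    case (Suc m)
    have "S (R m * vs m) = R (Suc m) * S (vs m)"
      using S_mult[OF R_A A_mono[OF Wset_A[OF vs_W[of m]]], of m] by simp
    then show ?case using Suc by (simp add: mult.assoc)
  qed simp
  have "ys (Suc m) * ys m = S (ys m) * ys (Suc m)" by (rule ys_comm[OF ys_W])
  then have "S (ys m) = ys (Suc m) * ys m * vs (Suc m)"
    by (intro right_solve[OF ys_vs(1)]) (rule HOL.sym)
  then have "w n = vs (Suc m) * ys (Suc m) * (ys m * vs (Suc m))"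
    unfolding w_def n by (simp add: mult.assoc del: ys.simps)
  then have "w n = ys m * vs (Suc m)"
    by (simp only: ys_vs mult_1_left)
  then have "w n = ys m * R m * vs m"
    by (simp only: vs mult.assoc)
  then show ?thesis
    using Wset_A[OF ys_W[of m]] Wset_A[OF vs_W[of m]] ys_vs[of m]
    by (simp add: n E_left E_right E_R)
qed

lemma E_u:
  assumes "1 \<le> n" shows "E n (u n) = 1"
proof -
  obtain m where n: "n = Suc m" using assms by (cases n) auto
  have "zs (Suc m) * S (zs m) = zs m * zs (Suc m)" by (rule zs_comm[OF zs_W])
  then have "S (zs m) = zs' (Suc m) * (zs m * zs (Suc m))"
    by (rule left_solve[OF zs_inv(2)])
  then have "u n = zs' (Suc m) * (zs m * (zs (Suc m) * zs' (Suc m)))"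
    by (simp only: u_def n diff_Suc_1 mult.assoc)
  then have "u n = zs' m * R m * zs m" by (simp only: zs_inv) simp
  then show ?thesis
    using Wset_A[OF zs_W[of m]] Wset_A[OF zs'_W[of m]] zs_inv[of m]
    by (simp add: n E_left E_right E_R)
qed

text \<open>The function that computes products with a braid matrix takes the prescribed value at
  scalar matrices as well. This reconciles the rule for two braid matrices with the rules for scalar
  ones.\<close>

lemma Lop_A0:
  assumes "x \<in> Wset n" "1 \<le> n" "c \<in> A 0"
  shows "Lop n x (w n) c = MB n x * c"
proof -
  have c: "c \<in> A n" "c \<in> A (Suc 0)" using A_mono assms(3) by blast+
  have "E n (str n * x * c * w n) = str n * x * c"
    using c Wset_A[OF assms(1)] assms(2)
    by (simp add: E_left[of "str n * x * c"] A_mult str_A E_w)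
  then show ?thesis using assms c
    by (simp add: Lop_def Er_Suc MB_def Er_right[of c "Suc 0"])
qed

lemma Lop'_A0:
  assumes "y \<in> Wset i" "1 \<le> i" "c \<in> A 0"
  shows "Lop' i y (u i) c = MB i y * c"
proof -
  have c: "c \<in> A i" "c \<in> A (Suc 0)" using A_mono assms(3) by blast+
  have "E i (u i * (str i * c * y)) = str i * c * y"
    using c Wset_A[OF assms(1)] assms(2)
    by (simp add: E_right[of "str i * c * y"] A_mult str_A E_u)
  then have "E i (u i * str i * c * y) = str i * y * c"
    using Wset_A0[OF assms(1,3)] by (simp add: mult.assoc)
  then show ?thesis using assms c
    by (simp add: Lop'_def Er_Suc MB_def Er_right[of c "Suc 0"])
qed

lemma MB_star_Lop:
  assumes "x \<in> Wset n" "y \<in> Wset i" "1 \<le> n" "1 \<le> i"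
  shows "MB (n + i) (x * Sk n y * w n) = Lop n x (w n) (MB i y)"
proof -
  obtain x' where "(x, x') \<in> Wp n" using assms(1) by (auto simp: Wset_iff)
  then show ?thesis
    by (rule MB_Lop[OF _ Wset_A[OF assms(2)] Wset_A[OF w_W[OF assms(3)]] assms(4)])
qed

lemma MB_star_Lop':
  assumes "x \<in> Wset n" "y \<in> Wset i" "1 \<le> n" "1 \<le> i"
  shows "MB (n + i) (x * Sk n y * w n) = Lop' i y (u i) (MB n x)"
proof -
  have y: "y \<in> A (Suc i)" by (rule A_mono[OF Wset_A[OF assms(2)]]) simp
  have "MB (i + n) (u i * Sk i x * y) = Lop' i y (u i) (MB n x)"
    by (rule MB_Lop'[OF Wset_A[OF assms(1)] y Wp_swap[OF Wp_w_u[OF assms(4)]] assms(3)])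
  then show ?thesis using MB_star[OF assms] by (simp add: add.commute)
qed

section \<open>The characteristic subalgebra\<close>

inductive_set C :: "'r set" where
  sc: "sc c \<in> C"
| ch: "x \<in> Wset n \<Longrightarrow> 1 \<le> n \<Longrightarrow> ch n x \<in> C"
| add: "a \<in> C \<Longrightarrow> b \<in> C \<Longrightarrow> a + b \<in> C"

lemma Wset_sc: "x \<in> Wset n \<Longrightarrow> sc c * x \<in> Wset n"
  unfolding Wset_iff using Wp.scale by blast

lemma Wset_add: "x \<in> Wset n \<Longrightarrow> y \<in> Wset n \<Longrightarrow> x + y \<in> Wset n"
  unfolding Wset_iff using Wp.add by blast

lemma C_A: "a \<in> C \<Longrightarrow> a \<in> A 0"
  by (induction rule: C.induct) (auto intro: ch_A Wset_A A_add)

lemma C_sc: "a \<in> C \<Longrightarrow> sc c * a \<in> C"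
proof (induction rule: C.induct)
  case (sc c')
  then show ?case using C.sc[of "c * c'"] by (simp add: sc_mult)
next
  case (ch x n)
  then show ?case using C.ch[OF Wset_sc[OF ch(1), of c]] by (simp add: ch_sc)
qed (simp add: distrib_left C.add)

lemma ch_mult:
  assumes x: "x \<in> Wset n" and y: "y \<in> A m"
  shows "ch n x * ch m y = ch (n + m) (x * Sk n y)"
proof -
  obtain x' where x': "(x, x') \<in> Wp n" using x by (auto simp: Wset_iff)
  have sy: "str m * y \<in> A m" using y by (auto intro!: A_mult)
  have sx: "str n * x \<in> A n" using Wset_A[OF x] by (auto intro!: A_mult)
  have c: "x * (Sk n (str m) * v) = Sk n (str m) * (x * v)" for v
    using Wp_Sk_str[OF x', of m] by (simp flip: mult.assoc)
  have "str (n + m) * (x * Sk n y) = str n * x * Sk n (str m * y)"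
    using Sk_mult[OF str_A y, of n] by (simp add: str_add mult.assoc c)
  then have "ch (n + m) (x * Sk n y) = Er 0 n (str n * x * Er n (n + m) (Sk n (str m * y)))"
    using Er_split[of 0 n "n + m"] sx by (simp add: ch_def Er_left)
  also have "Er n (n + m) (Sk n (str m * y)) = ch m y"
    using Er_Sk[OF sy, of 0 n] ch_A[OF y] by (simp add: ch_def add.commute)
  finally show ?thesis using ch_A[OF y] by (simp add: Er_right ch_def)
qed

lemma MB_ch_mult:
  assumes x: "x \<in> Wset n" and y: "y \<in> A m" and n: "1 \<le> n"
  shows "MB n x * ch m y = MB (n + m) (x * Sk n y)"
proof -
  obtain x' where x': "(x, x') \<in> Wp n" using x by (auto simp: Wset_iff)
  have sy: "str m * y \<in> A m" using y by (auto intro!: A_mult)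
  have sx: "str n * x \<in> A n" using Wset_A[OF x] by (auto intro!: A_mult)
  have c: "x * (Sk n (str m) * v) = Sk n (str m) * (x * v)" for v
    using Wp_Sk_str[OF x', of m] by (simp flip: mult.assoc)
  have "str (n + m) * (x * Sk n y) = str n * x * Sk n (str m * y)"
    using Sk_mult[OF str_A y, of n] by (simp add: str_add mult.assoc c)
  then have "MB (n + m) (x * Sk n y) = Er (Suc 0) n (str n * x * Er n (n + m) (Sk n (str m * y)))"
    using Er_split[of "Suc 0" n "n + m"] sx n by (simp add: MB_def Er_left)
  also have "Er n (n + m) (Sk n (str m * y)) = ch m y"
    using Er_Sk[OF sy, of 0 n] ch_A[OF y] by (simp add: ch_def add.commute)
  finally show ?thesis using A_mono[OF ch_A[OF y]] by (simp add: Er_right MB_def)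
qed

text \<open>A product of characters is the character of the two words side by side. Conjugating by
  the block crossing \<open>ts n m\<close> exchanges the sides, up to the order of two commuting
  positions, and the full trace is cyclic.\<close>

lemma ch_commute:
  assumes x: "x \<in> Wset n" and y: "y \<in> Wset m"
  shows "ch n x * ch m y = ch m y * ch n x"
proof -
  let ?t = "ts n m" and ?t' = "ts' n m"
  have t: "?t * (x * Sk n y) = Sk m x * (y * ?t)"
    using ts_comm[OF x, of m] ts_Sk[OF y, of n] by (simp flip: mult.assoc) (simp add: mult.assoc)
  have mem: "Sk m x \<in> A (n + m)" "y \<in> A (n + m)" "?t \<in> A (n + m)" "?t' \<in> A (n + m)"
    using Sk_A[OF Wset_A[OF x]] A_mono[OF Wset_A[OF y]] Wset_A[OF ts_W] Wset_A[OF ts'_W] by auto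
  obtain z' where z': "(?t', z') \<in> Wp (n + m)" using ts'_W by (auto simp: Wset_iff)
  obtain y' where y': "(y, y') \<in> Wp (n + m)"
    using Wset_mono[OF y, of "n + m"] by (auto simp: Wset_iff)
  have "x * Sk n y = ?t' * (Sk m x * (y * ?t))"
    by (rule left_solve[OF ts_inv(2) t])
  then have "ch (n + m) (x * Sk n y) = ch (n + m) (Sk m x * (y * ?t) * ?t')"
    using ch_cyc[OF z', of "Sk m x * (y * ?t)"] mem by (simp add: A_mult)
  also have "\<dots> = ch (n + m) (y * Sk m x)"
    using ch_cyc[OF y' mem(1)] ts_inv[of n m] by (simp add: mult.assoc)
  finally show ?thesis
    using ch_mult[OF x Wset_A[OF y]] ch_mult[OF y Wset_A[OF x]] by (simp add: add.commute)
qed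

lemma C_mult: "a \<in> C \<Longrightarrow> b \<in> C \<Longrightarrow> a * b \<in> C"
proof (induction rule: C.induct)
  case (ch x n)
  from ch(3) show ?case
  proof (induction rule: C.induct)
    case (sc c)
    then show ?case using C_sc[OF C.ch[OF ch(1,2)], of c] by (simp add: sc_central)
  next
    case (ch y m)
    have "x * Sk n y \<in> Wset (n + m)"
      using Wset_mono[OF \<open>x \<in> Wset n\<close>] Wset_Sk[OF ch(1)] by (intro Wset_mult) auto
    then show ?case
      using C.ch[of _ "n + m"] ch by (simp add: ch_mult[OF \<open>x \<in> Wset n\<close> Wset_A])
  qed (simp add: distrib_left C.add)
qed (auto simp: distrib_right C.add C_sc)

lemma C_commute: "a \<in> C \<Longrightarrow> b \<in> C \<Longrightarrow> a * b = b * a"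
proof (induction rule: C.induct)
  case (ch x n)
  from ch(3) show ?case
    by (induction rule: C.induct) (auto simp: sc_central ch_commute[OF ch(1)] algebra_simps)
qed (auto simp: algebra_simps sc_central)

end

section \<open>BMW towers\<close>

text \<open>Here \<open>lam\<close> will be q - 1/q, \<open>d\<close> the trace of \<open>D\<close>,
  and \<open>g\<close> the element that \<open>M 0 * M (Suc 0)\<close> becomes when it acts on the
  rank one operator \<open>K 0\<close>. The skein relation makes \<open>K\<close> a combination of
  \<open>1\<close>, \<open>R\<close> and \<open>R'\<close>, so that \<open>K\<close> inherits the
  shift and commutation rules of \<open>R\<close>.\<close>

locale bmw_tower = r_tower sc A E R R' F F' M
  for sc :: "complex \<Rightarrow> 'r::ring_1" and A E R R' F F' M +
  fixes K :: "nat \<Rightarrow> 'r" and lam \<mu> d :: complex and g :: 'r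
  assumes lam_nz: "lam \<noteq> 0" and mu_nz: "\<mu> \<noteq> 0" and d_nz: "d \<noteq> 0"
    and skein: "R n - R' n = sc lam * (1 - K n)"
    and RK: "R n * K n = sc \<mu> * K n"
    and LK_R: "K (Suc n) * K n = R n * R (Suc n) * K n"
    and LK_R': "K (Suc n) * K n = R' n * R' (Suc n) * K n"
    and KLK: "K n * K (Suc n) * K n = K n"
    and E_K: "E (Suc n) (K n) = sc \<mu>"
    and E_1: "E n 1 = sc d"
    and g_A: "g \<in> A 0"
    and MMK: "M 0 * M (Suc 0) * K 0 = K 0 * g"
begin

lemma sc_inverse_cancel: "c \<noteq> 0 \<Longrightarrow> sc (inverse c) * (sc c * z) = z"
  by (simp flip: mult.assoc sc_mult)

lemma K_eq: "K n = 1 - sc (inverse lam) * (R n - R' n)"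
proof -
  have "sc (inverse lam) * (R n - R' n) = 1 - K n"
    unfolding skein using lam_nz by (simp flip: mult.assoc sc_mult)
  then show ?thesis by simp
qed

lemma R'_eq: "R' n = R n - sc lam * (1 - K n)"
  using skein[of n] by (simp add: algebra_simps)

lemma K_A: "K n \<in> A (Suc (Suc n))"
  unfolding K_eq[of n] by (intro A_diff A_mult sc_A A_1 R_A R'_A)

lemma K_intertwine:
  assumes "y * R i = R j * y" shows "y * K i = K j * y"
proof -
  have "y * R' i = R' j * (R j * (y * R' i))" by simp
  also have "R j * (y * R' i) = y" unfolding mult_left_form[OF assms, symmetric] by simp
  finally have "y * R' i = R' j * y" .
  then show ?thesis unfolding K_eq using assms
    by (simp add: left_diff_distrib right_diff_distrib sc_left mult.assoc)
qed

lemma KR: "K n * R n = sc \<mu> * K n"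
  using K_intertwine[of "R n" n n] RK[of n] by simp

lemma K_comm: "x \<in> A n \<Longrightarrow> n \<le> m \<Longrightarrow> K m * x = x * K m"
  using K_intertwine[of x m m] R_comm[of x n m] by simp

lemma S_diff: "x \<in> A n \<Longrightarrow> y \<in> A n \<Longrightarrow> S (x - y) = S x - S y"
  using S_add[of "x - y" n y] by (simp add: A_diff)

lemma S_K [simp]: "S (K n) = K (Suc n)"
proof -
  have mem: "R n - R' n \<in> A (Suc (Suc n))" by (intro A_diff R_A R'_A)
  then show ?thesis unfolding K_eq[of n] K_eq[of "Suc n"]
    by (simp add: S_diff[of _ "Suc (Suc n)"] S_mult[of _ "Suc (Suc n)"] R_A R'_A A_mult)
qed

lemma Wp_uminus: "(x, y) \<in> Wp n \<Longrightarrow> (- x, - y) \<in> Wp n"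
  using Wp.scale[of x y n "- 1"] by (simp add: sc_uminus)

lemma Wp_diff: "(x, y) \<in> Wp n \<Longrightarrow> (x', y') \<in> Wp n \<Longrightarrow> (x - x', y - y') \<in> Wp n"
  using Wp.add[of x y n "- x'" "- y'"] Wp_uminus by simp

lemma Wp_K [intro]: "Suc k < n \<Longrightarrow> (K k, K k) \<in> Wp n"
  unfolding K_eq by (intro Wp_diff Wp.one Wp.scale Wp_R Wp_R')

lemma Wset_K [intro]: "Suc k < n \<Longrightarrow> K k \<in> Wset n"
  unfolding Wset_iff by blast

text \<open>The remaining relations follow by conjugation with the half twist on three strands,
  which exchanges the indices \<open>n\<close> and \<open>n + 1\<close>.\<close>

lemma half_twist:
  fixes n
  defines "H \<equiv> R n * R (Suc n) * R n"
  shows "H * R n = R (Suc n) * H" "H * R (Suc n) = R n * H"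
    "H * K n = K (Suc n) * H" "H * K (Suc n) = K n * H"
proof -
  show 1: "H * R n = R (Suc n) * H" "H * R (Suc n) = R n * H"
    unfolding H_def by (simp_all only: mult.assoc braid_left R_braid[unfolded mult.assoc])
  show "H * K n = K (Suc n) * H" "H * K (Suc n) = K n * H"
    by (rule K_intertwine[OF 1(1)], rule K_intertwine[OF 1(2)])
qed

lemma half_twist_cancel: "x * (R n * R (Suc n) * R n) = y * (R n * R (Suc n) * R n) \<Longrightarrow> x = y"
proof -
  assume "x * (R n * R (Suc n) * R n) = y * (R n * R (Suc n) * R n)"
  then have "x * (R n * R (Suc n) * R n) * (R' n * R' (Suc n) * R' n)
      = y * (R n * R (Suc n) * R n) * (R' n * R' (Suc n) * R' n)" by simp
  then show ?thesis by (simp add: mult.assoc)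
qed

lemma RRK: "R n * R (Suc n) * K n = K (Suc n) * (R n * R (Suc n))"
  by (rule K_intertwine) (simp add: mult.assoc R_braid[unfolded mult.assoc])

lemma RRL: "R (Suc n) * R n * K (Suc n) = K n * (R (Suc n) * R n)"
  by (rule K_intertwine) (simp add: mult.assoc R_braid[unfolded mult.assoc])

lemma intertwine_mult:
  fixes h a a' b b' :: 'r
  assumes "h * a = a' * h" "h * b = b' * h"
  shows "h * (a * b) = a' * b' * h"
  using assms(2) by (simp only: mult_left_form[OF assms(1)] mult.assoc)

lemma KL_R: "K n * K (Suc n) = R (Suc n) * R n * K (Suc n)"
proof (rule half_twist_cancel)
  note h = half_twist[of n]
  show "K n * K (Suc n) * (R n * R (Suc n) * R n) = R (Suc n) * R n * K (Suc n) * (R n * R (Suc n) * R n)"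
    using intertwine_mult[OF h(4) h(3)]
      intertwine_mult[OF intertwine_mult[OF h(1) h(2)] h(3)]
    by (simp only: LK_R)
qed

lemma LKL: "K (Suc n) * K n * K (Suc n) = K (Suc n)"
proof (rule half_twist_cancel)
  note h = half_twist[of n]
  show "K (Suc n) * K n * K (Suc n) * (R n * R (Suc n) * R n) = K (Suc n) * (R n * R (Suc n) * R n)"
    using intertwine_mult[OF intertwine_mult[OF h(3) h(4)] h(3)] h(3)
    by (simp only: KLK)
qed

lemma RQK: "R n * (R (Suc n) * K n) = K (Suc n) * K n"
  using LK_R[of n] by (simp only: mult.assoc)

lemma LRQ: "K (Suc n) * (R n * R (Suc n)) = K (Suc n) * K n"
  using LK_R[of n] RRK[of n] by simp

lemma QRL: "R (Suc n) * (R n * K (Suc n)) = K n * K (Suc n)"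
  using KL_R[of n] by (simp only: mult.assoc)

lemma KQR: "K n * (R (Suc n) * R n) = K n * K (Suc n)"
  using KL_R[of n] RRL[of n] by simp

lemma QK: "R (Suc n) * K n = R' n * (K (Suc n) * K n)"
  by (rule left_solve[OF R'R RQK])

lemma RLK: "R n * (K (Suc n) * K n) = R' (Suc n) * K n"
  unfolding LK_R' by (simp add: mult.assoc)

lemma RL: "R n * K (Suc n) = R' (Suc n) * (K n * K (Suc n))"
  by (rule left_solve[OF R'R QRL])

lemma LR: "K (Suc n) * R n = K (Suc n) * (K n * R' (Suc n))"
proof -
  have "K (Suc n) * R n = K (Suc n) * K n * R' (Suc n)"
    by (rule right_solve[OF RR']) (simp only: LRQ[symmetric] mult.assoc)
  then show ?thesis by (simp only: mult.assoc)
qed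

text \<open>With an extra \<open>R (Suc n)\<close> the product is \<open>K (Suc n)\<close>, by
  \<open>LRQ\<close> and \<open>LKL\<close>; \<open>RK\<close> replaces the extra factor by \<mu>.
  This is where the inverse of \<mu> in \<open>ATA\<close> comes from.\<close>

lemma LRL: "K (Suc n) * (R n * K (Suc n)) = sc (inverse \<mu>) * K (Suc n)"
proof -
  have "K (Suc n) * (R n * (R (Suc n) * K (Suc n))) = K (Suc n)"
    using LKL[of n] mult_left_form[OF LRQ[of n], of "K (Suc n)"] by (simp add: mult.assoc)
  then have "sc \<mu> * (K (Suc n) * (R n * K (Suc n))) = K (Suc n)"
    by (simp add: RK sc_left)
  then show ?thesis by (rule left_solve[rotated]) (simp add: mu_nz flip: sc_mult)
qed

lemma KLR: "K n * (K (Suc n) * R n) = K n * R' (Suc n)"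
proof -
  have "K n * (K (Suc n) * R n) = K n * (K (Suc n) * (K n * R' (Suc n)))"
    by (simp only: LR)
  then show ?thesis using KLK[of n] by (simp add: mult.assoc[symmetric])
qed

lemma RLR: "R n * (K (Suc n) * R n) = R' (Suc n) * (K n * R' (Suc n))"
proof -
  have "R n * (K (Suc n) * R n) = R' (Suc n) * (K n * (K (Suc n) * R n))"
    using mult_left_form[OF RL[of n], of "R n"] by (simp only: mult.assoc)
  then show ?thesis by (simp only: KLR)
qed

lemma RR_K: "R n * R n = 1 + sc lam * R n - sc (lam * \<mu>) * K n"
proof -
  have "R n * R n = R n * (R' n + sc lam * (1 - K n))" by (simp flip: skein)
  also have "\<dots> = 1 + sc lam * (R n - R n * K n)"
    by (simp add: distrib_left right_diff_distrib sc_left sc_central[of "R n"])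
  finally show ?thesis by (simp add: RK right_diff_distrib sc_mult mult.assoc)
qed

text \<open>The spanning set of products \<open>a t b\<close>, again paired with the reversals.\<close>

inductive_set Sp :: "nat \<Rightarrow> ('r \<times> 'r) set" for n where
  base: "(a, a') \<in> Wp n \<Longrightarrow> (b, b') \<in> Wp n \<Longrightarrow> t \<in> {1, R 0, K 0} \<Longrightarrow>
    (S a * t * S b, S b' * t * S a') \<in> Sp n"
| add: "(x, y) \<in> Sp n \<Longrightarrow> (x', y') \<in> Sp n \<Longrightarrow> (x + x', y + y') \<in> Sp n"

lemma Sp_mult:
  assumes "(x, y) \<in> Sp n" "(a, a') \<in> Wp n" "(b, b') \<in> Wp n"
  shows "(S a * x * S b, S b' * y * S a') \<in> Sp n"
  using assms(1)
proof (induction rule: Sp.induct)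
  case (base c c' e e' t)
  note mem = Wp_A[OF assms(2)] Wp_A[OF assms(3)] Wp_A[OF base.hyps(1)] Wp_A[OF base.hyps(2)]
  have "(S (a * c) * t * S (e * b), S (b' * e') * t * S (c' * a')) \<in> Sp n"
    by (intro Sp.base Wp_mult assms base)
  then show ?case using mem by (simp add: S_mult[of _ n] mult.assoc)
qed (simp add: distrib_left distrib_right Sp.add)

lemma Sp_sc: "(x, y) \<in> Sp n \<Longrightarrow> (sc c * x, sc c * y) \<in> Sp n"
  using Sp_mult[OF _ Wp.scale[OF Wp.one, of c] Wp.one, of x y] by (simp add: sc_central)

lemma Sp_diff: "(x, y) \<in> Sp n \<Longrightarrow> (x', y') \<in> Sp n \<Longrightarrow> (x - x', y - y') \<in> Sp n"
  using Sp.add[of x y n "- x'" "- y'"] Sp_sc[of x' y' n "- 1"] by (simp add: sc_uminus)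

lemma Sp_t: "t \<in> {1, R 0, K 0} \<Longrightarrow> (t, t) \<in> Sp n"
  using Sp.base[OF Wp.one Wp.one, of t] by simp

lemma Sp_R_t:
  assumes "t \<in> {1, R 0, K 0}"
  shows "(R 0 * t, t * R 0) \<in> Sp n"
proof -
  have "(1 + sc lam * R 0 - sc (lam * \<mu>) * K 0, 1 + sc lam * R 0 - sc (lam * \<mu>) * K 0) \<in> Sp n"
    by (intro Sp_diff Sp.add Sp_sc Sp_t) auto
  moreover have "(R 0, R 0) \<in> Sp n" "(sc \<mu> * K 0, sc \<mu> * K 0) \<in> Sp n"
    by (rule Sp_t, simp, rule Sp_sc, rule Sp_t, simp)
  ultimately show ?thesis using assms by (auto simp: RK KR RR_K)
qed

text \<open>The only products that need the cubic BMW relations: in each of the nine cases two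
  occurrences of the first generator, with \<open>t'\<close> between them on the next strands, are
  rewritten with a single one. The bound \<open>2 \<le> n\<close> makes the new outer factors words
  on \<open>n\<close> strands.\<close>

lemma Sp_R_t_t:
  assumes t: "t \<in> {1, R 0, K 0}" and t': "t' \<in> {1, R 0, K 0}" and n: "2 \<le> n"
  shows "(R 0 * (S t' * t), t * S t' * R 0) \<in> Sp n"
proof -
  have W: "(R 0, R 0) \<in> Wp n" "(R' 0, R' 0) \<in> Wp n" "(K 0, K 0) \<in> Wp n" using n by auto
  have *: "(S a * x, x * S a) \<in> Sp n" "(x * S a, S a * x) \<in> Sp n" "(S a * x * S a, S a * x * S a) \<in> Sp n"
    if "(a, a) \<in> Wp n" "x \<in> {1, R 0, K 0}" for a x
    using Sp_mult[OF Sp_t[OF that(2)] that(1) Wp.one] Sp_mult[OF Sp_t[OF that(2)] Wp.one that(1)]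
      Sp_mult[OF Sp_t[OF that(2)] that(1) that(1)] by simp_all
  consider "t' = 1" | "t' = R 0" | "t' = K 0" using t' by blast
  then show ?thesis
  proof cases
    case 1
    then show ?thesis using Sp_R_t[OF t] by simp
  next
    case 2
    have e: "R 0 * (R (Suc 0) * R 0) = S (R 0) * R 0 * S (R 0)" "R 0 * R (Suc 0) * R 0 = S (R 0) * R 0 * S (R 0)"
      by (simp_all add: mult.assoc R_braid[unfolded mult.assoc])
    have e': "R 0 * (R (Suc 0) * K 0) = S (K 0) * K 0" "K 0 * R (Suc 0) * R 0 = K 0 * S (K 0)"
      by (simp_all add: mult.assoc RQK KQR)
    have "t = 1 \<or> t = R 0 \<or> t = K 0" using t by blast
    then show ?thesis
      by (elim disjE) (use e e' 2 *(2)[OF W(1), of "R 0"] *(3)[OF W(1), of "R 0"] *(1)[OF W(3), of "K 0"] in simp_all)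
  next
    case 3
    have e: "R 0 * (K (Suc 0) * R 0) = S (R' 0) * K 0 * S (R' 0)" "R 0 * K (Suc 0) * R 0 = S (R' 0) * K 0 * S (R' 0)"
      by (simp_all add: mult.assoc RLR)
    have e': "R 0 * (K (Suc 0) * K 0) = S (R' 0) * K 0" "K 0 * K (Suc 0) * R 0 = K 0 * S (R' 0)"
      by (simp_all add: mult.assoc RLK KLR)
    have "t = 1 \<or> t = R 0 \<or> t = K 0" using t by blast
    then show ?thesis
      by (elim disjE) (use e e' 3 *(2)[OF W(3), of "R 0"] *(3)[OF W(2), of "K 0"] *(1)[OF W(2), of "K 0"] in simp_all)
  qed
qed

lemma Wp_1: "(x, y) \<in> Wp n \<Longrightarrow> n \<le> 1 \<Longrightarrow> \<exists>c. x = sc c \<and> y = sc c"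
proof (induction rule: Wp.induct)
  case (add x y x' y')
  then show ?case by (metis sc_add)
next
  case (scale x y c)
  then show ?case by (metis sc_mult)
qed (auto intro: exI[of _ 1])

text \<open>The last assumption is the induction hypothesis of \<open>Wp_Sp\<close>. By it the left
  factor \<open>a\<close> may itself be taken as \<open>S c * t' * S e\<close>; then
  \<open>S (S c)\<close> moves left past \<open>R 0\<close>, \<open>S (S e)\<close> moves right past
  \<open>t\<close>, and only \<open>R 0 * (S t' * t)\<close> remains. For \<open>n = 1\<close> the
  factor \<open>a\<close> is a scalar.\<close>

lemma Sp_R_left:
  assumes "(x, y) \<in> Sp n" "1 \<le> n" "n = 1 \<or> Wp n \<subseteq> Sp (n - 1)"
  shows "(R 0 * x, y * R 0) \<in> Sp n"
  using assms(1)
proof (induction rule: Sp.induct)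
  case (base a a' b b' t)
  show ?case
  proof (cases "n = 1")
    case True
    then obtain c where "a = sc c" "a' = sc c" using Wp_1[OF base(1)] by auto
    moreover have "(sc c * (R 0 * t) * S b, S b' * (t * R 0) * sc c) \<in> Sp n"
      using Sp_mult[OF Sp_R_t[OF base(3)] Wp.scale[OF Wp.one, of c] base(2)] by simp
    ultimately show ?thesis by (simp add: mult.assoc sc_left sc_central)
  next
    case False
    then obtain m where n: "n = Suc m" "1 \<le> m" using assms(2) by (cases n) auto
    then have "(a, a') \<in> Sp m" using assms(3) base(1) False by auto
    then have "(R 0 * (S a * t), t * S a' * R 0) \<in> Sp n"
    proof (induction rule: Sp.induct)
      case (base c c' e e' t')
      have t'_A: "t' \<in> A n" using base(3) n by (auto intro: K_A[THEN A_mono])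
      have mem: "S c \<in> A n" "S c' \<in> A n" "S e \<in> A n" "S e' \<in> A n"
        using base Wp_A S_A n by blast+
      have S1: "S (S c * t' * S e) = S (S c) * S t' * S (S e)"
        "S (S e' * t' * S c') = S (S e') * S t' * S (S c')"
        using mem t'_A by (simp_all add: S_mult[of _ n] A_mult)
      have comm: "S (S z) * v = v * S (S z)" if "z \<in> {c, c', e, e'}" "v \<in> {R 0, t}" for z v
      proof -
        have "z \<in> Wset m" using that base(1,2) Wp_swap unfolding Wset_iff by blast
        moreover have "v \<in> A (Suc (Suc 0))" using that \<open>t \<in> {1, R 0, K 0}\<close> R_A K_A by auto
        ultimately show ?thesis using W_Sk_comm[of z m v "Suc (Suc 0)"] by simp
      qed
      have "(S c, S c') \<in> Wp n" "(S e, S e') \<in> Wp n"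
        using base Wp_S n by auto
      then have "(S (S c) * (R 0 * (S t' * t)) * S (S e), S (S e') * (t * S t' * R 0) * S (S c')) \<in> Sp n"
        by (intro Sp_mult Sp_R_t_t \<open>t \<in> {1, R 0, K 0}\<close> base(3)) (use n in auto)
      moreover have "S (S c) * (R 0 * (S t' * t)) * S (S e) = R 0 * (S (S c * t' * S e) * t)"
        unfolding S1 using comm[of e t] mult_left_form[OF comm[of c "R 0"]] by (simp add: mult.assoc)
      moreover have "S (S e') * (t * S t' * R 0) * S (S c') = t * S (S e' * t' * S c') * R 0"
        unfolding S1 using comm[of c' "R 0"] mult_left_form[OF comm[of e' t]] by (simp add: mult.assoc)
      ultimately show ?case by simp
    next
      case (add x y x' y')
      have "x \<in> A n \<and> y \<in> A n" if "(x, y) \<in> Sp m" for x y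
        using that
      proof (induction rule: Sp.induct)
        case (base a a' b b' s)
        then have "s \<in> A n" using n by (auto intro: K_A[THEN A_mono])
        moreover have "S a \<in> A n" "S a' \<in> A n" "S b \<in> A n" "S b' \<in> A n"
          using base Wp_A S_A n by blast+
        ultimately show ?case by (simp add: A_mult)
      qed (auto intro: A_add)
      then have "S (x + x') = S x + S x'" "S (y + y') = S y + S y'"
        using add.hyps by (auto intro: S_add[of _ n])
      then show ?case using Sp.add[OF add.IH] by (simp add: distrib_left distrib_right)
    qed
    from Sp_mult[OF this Wp.one base(2)] show ?thesis by (simp add: mult.assoc)
  qed
qed (simp add: distrib_left distrib_right Sp.add)

theorem Wp_Sp: "1 \<le> n \<Longrightarrow> Wp (Suc n) \<subseteq> Sp n"
proof (induction n)
  case (Suc n)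
  have IH: "Suc n = 1 \<or> Wp (Suc n) \<subseteq> Sp n" using Suc.IH by (cases n) auto
  have R0: "(R 0 * x, y * R 0) \<in> Sp (Suc n)" if "(x, y) \<in> Sp (Suc n)" for x y
    using Sp_R_left[OF that] IH by simp
  \<comment> \<open>Stability under \<open>R 0\<close> suffices: \<open>R 0 * R 0\<close> yields
    \<open>K 0\<close> up to the nonzero scalar \<open>lam * \<mu>\<close>, and the skein relation
    then yields \<open>R' 0\<close>.\<close>
  have "(sc (lam * \<mu>) * K 0 * x, y * (sc (lam * \<mu>) * K 0)) \<in> Sp (Suc n)" if xy: "(x, y) \<in> Sp (Suc n)" for x y
  proof -
    have "(x + sc lam * (R 0 * x) - R 0 * (R 0 * x), y + sc lam * (y * R 0) - y * R 0 * R 0) \<in> Sp (Suc n)"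
      by (intro Sp_diff Sp.add Sp_sc R0 xy)
    moreover have eq: "sc (lam * \<mu>) * K 0 = 1 + sc lam * R 0 - R 0 * R 0" using RR_K[of 0] by simp
    ultimately show ?thesis unfolding eq
      by (simp add: left_diff_distrib right_diff_distrib distrib_left distrib_right mult.assoc sc_left)
  qed
  note K0_sc = this
  have K0: "(K 0 * x, y * K 0) \<in> Sp (Suc n)" if xy: "(x, y) \<in> Sp (Suc n)" for x y
  proof -
    have "sc (inverse (lam * \<mu>)) * (sc (lam * \<mu>) * z) = z" for z
      by (rule sc_inverse_cancel) (simp add: lam_nz mu_nz)
    then show ?thesis
      using Sp_sc[OF K0_sc[OF xy], of "inverse (lam * \<mu>)"] by (simp only: sc_left[of y] mult.assoc)
  qed
  have R'0: "(R' 0 * x, y * R' 0) \<in> Sp (Suc n)" if xy: "(x, y) \<in> Sp (Suc n)" for x y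
  proof -
    have "(R 0 * x - sc lam * (x - K 0 * x), y * R 0 - sc lam * (y - y * K 0)) \<in> Sp (Suc n)"
      by (intro Sp_diff Sp_sc R0 K0 xy)
    moreover have "R' 0 * x = R 0 * x - sc lam * (x - K 0 * x)"
      "y * R' 0 = y * R 0 - sc lam * (y - y * K 0)"
      by (simp_all add: R'_eq[of 0] left_diff_distrib right_diff_distrib mult.assoc
          sc_left[of y] sc_central[of y])
    ultimately show ?thesis by simp
  qed
  show ?case
  proof (rule subrelI)
    fix x y assume "(x, y) \<in> Wp (Suc (Suc n))"
    then show "(x, y) \<in> Sp (Suc n)"
    proof (induction rule: Wp.induct)
      case (gen x y k)
      show ?case
      proof (cases k)
        case (Suc j)
        then show ?thesis using Sp_mult[OF gen.IH Wp_R Wp.one, of j] gen.hyps by simp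
      qed (simp add: R0 gen.IH)
    next
      case (gen' x y k)
      show ?case
      proof (cases k)
        case (Suc j)
        then show ?thesis using Sp_mult[OF gen'.IH Wp_R' Wp.one, of j] gen'.hyps by simp
      qed (simp add: R'0 gen'.IH)
    qed (auto intro: Sp_t Sp.add Sp_sc)
  qed
qed simp

section \<open>Invariance under reversal and commutativity\<close>

abbreviation Aop :: "'r \<Rightarrow> 'r" where "Aop \<equiv> Bop (R 0)"
abbreviation Top :: "'r \<Rightarrow> 'r" where "Top \<equiv> Bop (K 0)"

lemma t_A: "t \<in> {1, R 0, K 0} \<Longrightarrow> t \<in> A (Suc (Suc 0))"
  using R_A K_A by auto

lemma MB_Sp_base:
  assumes ab: "(a, a') \<in> Wp n" "(b, b') \<in> Wp n" and t: "t \<in> {1, R 0, K 0}" and n: "1 \<le> n"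
  shows "MB (Suc n) (S a * t * S b) =
    (if t = 1 then M 0 * E 0 (MB n (b * a)) else Bop t (MB n (b * a)))"
proof -
  have mem: "S a \<in> A (Suc n)" "b * a \<in> A n" using Wp_A[OF ab(1)] Wp_A[OF ab(2)] S_A A_mult by auto
  moreover have "t \<in> A (Suc n)" by (rule A_mono[OF t_A[OF t]]) (use n in simp)
  ultimately have "MB (Suc n) (S a * t * S b) = MB (Suc n) (S b * (S a * t))"
    using MB_cyc[OF ab(2), of "S a * t"] by (simp add: A_mult)
  also have "\<dots> = MB (Suc n) (S (b * a) * t)"
    using Wp_A[OF ab(1)] Wp_A[OF ab(2)] by (simp add: S_mult[of _ n] mult.assoc)
  finally show ?thesis
    using MB_Suc_t[OF mem(2) n t_A[OF t]] MB_Suc_S[OF mem(2)] n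
    by (cases "t = 1") (simp_all add: ch_MB)
qed

text \<open>The matrix of \<open>S a * t * S b\<close> depends on the matrix of \<open>b * a\<close>
  alone, and that of its reversal on the matrix of \<open>a' * b'\<close>. These two words are
  reversals of each other on one strand fewer.\<close>

lemma MB_reverse: "1 \<le> n \<Longrightarrow> (x, y) \<in> Wp n \<Longrightarrow> MB n x = MB n y"
proof (induction n arbitrary: x y)
  case (Suc n)
  show ?case
  proof (cases "n = 0")
    case True
    then show ?thesis using Wp_1[OF Suc.prems(2)] by auto
  next
    case False
    then have n: "1 \<le> n" by simp
    then have "(x, y) \<in> Sp n" using Wp_Sp Suc.prems by blast
    then show ?thesis
    proof (induction rule: Sp.induct)
      case (base a a' b b' t)
      have "MB n (b * a) = MB n (a' * b')"
        by (rule Suc.IH[OF n Wp_mult[OF base(2,1)]])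
      then show ?case
        using MB_Sp_base[OF base(1,2,3) n]
          MB_Sp_base[OF Wp_swap[OF base(2)] Wp_swap[OF base(1)] base(3) n]
        by simp
    qed (simp add: MB_add)
  qed
qed simp

text \<open>Reversing the whole product exchanges the factors but also reverses each of them. The
  two inner reversals are removed one at a time: \<open>Lop\<close> and \<open>Lop'\<close> exhibit
  the product as a function of the matrix of a single factor, and \<open>MB_reverse\<close> applies
  to that matrix.\<close>

theorem MB_star_commute:
  assumes x: "x \<in> Wset n" and y: "y \<in> Wset i" and n: "1 \<le> n" and i: "1 \<le> i"
  shows "MB (n + i) (x * Sk n y * w n) = MB (i + n) (y * Sk i x * w i)"
proof -
  obtain x' where x': "(x, x') \<in> Wp n" using x by (auto simp: Wset_iff)
  obtain y' where y': "(y, y') \<in> Wp i" using y by (auto simp: Wset_iff)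
  have W': "x' \<in> Wset n" "y' \<in> Wset i" using x' y' Wp_swap Wset_iff by blast+
  have "(x * Sk n y * w n, u n * (Sk n y' * x')) \<in> Wp (n + i)"
    using n i by (intro Wp_mult Wp_mono[OF x'] Wp_Sk[OF y'] Wp_mono[OF Wp_w_u]) auto
  then have "MB (n + i) (x * Sk n y * w n) = MB (n + i) (u n * Sk n y' * x')"
    using MB_reverse[of "n + i"] n by (simp add: mult.assoc)
  also have "\<dots> = MB (i + n) (y' * Sk i x' * w i)"
    using MB_star[OF W'(2,1) i n] by (simp add: add.commute)
  also have "\<dots> = Lop i y' (w i) (MB n x')" by (rule MB_star_Lop[OF W'(2,1) i n])
  also have "MB n x' = MB n x" by (rule MB_reverse[OF n x', symmetric])
  also have "Lop i y' (w i) (MB n x) = MB (i + n) (y' * Sk i x * w i)"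
    by (rule MB_star_Lop[OF W'(2) x i n, symmetric])
  also have "\<dots> = Lop' n x (u n) (MB i y')" by (rule MB_star_Lop'[OF W'(2) x i n])
  also have "MB i y' = MB i y" by (rule MB_reverse[OF i y', symmetric])
  also have "Lop' n x (u n) (MB i y) = MB (i + n) (y * Sk i x * w i)"
    by (rule MB_star_Lop'[OF y x i n, symmetric])
  finally show ?thesis .
qed

lemma Bop_W:
  assumes "x \<in> Wset n" "1 \<le> n" "t \<in> {R 0, K 0}"
  shows "Bop t (MB n x) = MB (Suc n) (S x * t)" "S x * t \<in> Wset (Suc n)"
  using assms MB_Suc_t[OF Wset_A[OF assms(1)], of t] t_A[of t]
  by (auto intro!: Wset_mult Wset_S)

lemma ops3:
  assumes x: "x \<in> Wset n" and n: "1 \<le> n" and t: "t1 \<in> {R 0, K 0}" "t2 \<in> {R 0, K 0}" "t3 \<in> {R 0, K 0}"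
  shows "Bop t3 (Bop t2 (Bop t1 (MB n x))) =
    MB (n + 3) (Sk 3 x * (S (S t1) * (S t2 * t3)))"
proof -
  have mem: "x \<in> A (n + 2)" "S x \<in> A (n + 2)" "S (S x) \<in> A (n + 2)"
    "t1 \<in> A (n + 2)" "S t1 \<in> A (n + 2)" "t2 \<in> A (n + 2)"
    using x n t Wset_A[OF x] S_A[OF Wset_A[OF x]] S_A[OF S_A[OF Wset_A[OF x]]]
    by (auto intro!: R_A K_A elim: A_mono intro: A_mono[OF R_A] A_mono[OF K_A])
  have "Bop t3 (Bop t2 (Bop t1 (MB n x))) = MB (Suc (Suc (Suc n))) (S (S (S x * t1) * t2) * t3)"
    using Bop_W[OF x n t(1)] Bop_W[OF Bop_W(2)[OF x n t(1)] _ t(2)]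
      Bop_W[OF Bop_W(2)[OF Bop_W(2)[OF x n t(1)] _ t(2)] _ t(3)] by simp
  then show ?thesis using mem
    by (simp add: S_mult[of _ "n + 2"] A_mult mult.assoc numeral_3_eq_3)
qed

text \<open>\<open>S r\<close> lives in the second and third factors: it avoids the first, so it can
  be cycled, and it commutes with \<open>Sk 3 x\<close>, which avoids all three.\<close>

lemma MB3_cyc:
  assumes x: "x \<in> Wset n" and r: "(r, r') \<in> Wp (Suc (Suc n))" "r \<in> A 2" and z: "z \<in> A (n + 3)"
  shows "MB (n + 3) (Sk 3 x * (z * S r)) = MB (n + 3) (Sk 3 x * (S r * z))"
proof -
  have Sr: "S r \<in> A 3" using S_A[OF r(2)] by (simp add: numeral_3_eq_3 numeral_2_eq_2)
  have x3: "Sk 3 x \<in> A (n + 3)" by (rule Sk_A[OF Wset_A[OF x]])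
  have "MB (n + 3) (S r * (Sk 3 x * z)) = MB (n + 3) (Sk 3 x * z * S r)"
    using MB_cyc[OF r(1), of "Sk 3 x * z"] A_mult[OF x3 z] by (simp add: numeral_3_eq_3)
  then show ?thesis
    using mult_left_form[OF W_Sk_comm[OF x Sr], of z] by (simp add: mult.assoc)
qed

lemma RKK_A: "S (S t1) \<in> A (n + 3) \<and> S t2 \<in> A (n + 3) \<and> t3 \<in> A (n + 3)"
  if "1 \<le> n" "t1 \<in> {1, R 0, K 0}" "t2 \<in> {1, R 0, K 0}" "t3 \<in> {1, R 0, K 0}"
  using that A_mono[OF S_A[OF S_A[OF t_A]], of t1 "n + 3"] A_mono[OF S_A[OF t_A], of t2 "n + 3"]
    A_mono[OF t_A, of t3 "n + 3"] by auto

text \<open>The innermost operation has the highest index, so the sides belong to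
  \<open>R 2 * K 1 * K 0\<close> and \<open>K 2 * K 1 * R 0\<close>. The first equals
  \<open>R 2 * K 1 * R 0 * R 1\<close>; cycling \<open>R 1\<close> to the front gives the second,
  since \<open>R 1 * R 2 * K 1\<close> is \<open>K 2 * K 1\<close>.\<close>

lemma TTA:
  assumes x: "x \<in> Wset n" and n: "1 \<le> n"
  shows "Top (Top (Aop (MB n x))) = Aop (Top (Top (MB n x)))"
proof -
  let ?R2 = "R (Suc (Suc 0))" and ?K1 = "K (Suc 0)"
  have eq: "?R2 * (?K1 * K 0) = ?R2 * (?K1 * R 0) * S (R 0)"
    by (simp add: LRQ mult.assoc)
  have eq': "R (Suc 0) * (?R2 * (?K1 * R 0)) = K (Suc (Suc 0)) * (?K1 * R 0)"
    using arg_cong[OF RQK[of "Suc 0"], of "\<lambda>v. v * R 0"] by (simp only: mult.assoc)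
  have z: "?R2 * (?K1 * R 0) \<in> A (n + 3)"
    using RKK_A[OF n, of "R 0" "K 0" "R 0"] by (simp add: A_mult)
  have "(R 0, R 0) \<in> Wp (Suc (Suc n))" by auto
  from MB3_cyc[OF x this _ z] show ?thesis
    using R_A[of 0] by (simp add: ops3[OF x n] eq eq' numeral_2_eq_2)
qed

text \<open>\<open>R 2 * K 1 * R 0\<close> is \<open>R' 1 * K 2 * K 1 * R 0\<close>, and cycling
  gives \<open>K 2 * K 1 * R 0 * R' 1\<close>. Expanding \<open>R' 1\<close> by the skein relation
  produces the three terms, the last through \<open>LRL\<close>; that term is
  \<open>K 2 * K 1\<close>, which avoids the first strand and therefore gives \<open>M 0\<close>
  times a character.\<close>

lemma ATA:
  assumes x: "x \<in> Wset n" and n: "1 \<le> n"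
  defines "N \<equiv> MB n x"
  shows "Aop (Top (Aop N)) =
    Top (Top (Top N)) - sc lam * Aop (Top (Top N)) + sc (lam * inverse \<mu>) * (M 0 * E 0 (Top (Top N)))"
proof -
  let ?K2 = "K (Suc (Suc 0))" and ?K1 = "K (Suc 0)"
  have eq: "R (Suc (Suc 0)) * (?K1 * R 0) = S (R' 0) * (?K2 * (?K1 * R 0))"
    using mult_left_form[OF QK[of "Suc 0"], of "R 0"] by (simp add: mult.assoc)
  have "?K2 * (?K1 * R 0) * S (R' 0)
      = ?K2 * (?K1 * (R 0 * R (Suc 0))) - sc lam * (?K2 * (?K1 * R 0)) + sc lam * (?K2 * (?K1 * (R 0 * ?K1)))"
    by (simp add: R'_eq[of "Suc 0"] distrib_left right_diff_distrib mult.assoc sc_left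
        sc_central[of "R 0"])
  then have eq': "?K2 * (?K1 * R 0) * S (R' 0)
      = ?K2 * (?K1 * K 0) - sc lam * (?K2 * (?K1 * R 0)) + sc (lam * inverse \<mu>) * (?K2 * ?K1)"
    by (simp add: LRQ LRL sc_left[of ?K2] sc_mult mult.assoc)
  have z: "?K2 * (?K1 * R 0) \<in> A (n + 3)"
    using RKK_A[OF n, of "K 0" "K 0" "R 0"] by (simp add: A_mult)
  have "(R' 0, R' 0) \<in> Wp (Suc (Suc n))" by auto
  from MB3_cyc[OF x this _ z]
  have "Aop (Top (Aop N)) = MB (n + 3) (Sk 3 x * (?K2 * (?K1 * R 0) * S (R' 0)))"
    using R'_A[of 0] by (simp add: N_def ops3[OF x n] eq numeral_2_eq_2)
  also have "Sk 3 x * (?K2 * (?K1 * R 0) * S (R' 0)) =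
      Sk 3 x * (?K2 * (?K1 * K 0)) + sc (- lam) * (Sk 3 x * (?K2 * (?K1 * R 0)))
        + sc (lam * inverse \<mu>) * (Sk 3 x * (?K2 * ?K1))"
    unfolding eq' by (simp add: distrib_left right_diff_distrib sc_left[of "Sk 3 x"] sc_uminus)
  finally have "Aop (Top (Aop N)) = Top (Top (Top N)) + sc (- lam) * Aop (Top (Top N))
      + sc (lam * inverse \<mu>) * MB (n + 3) (Sk 3 x * (?K2 * ?K1))"
    by (simp add: MB_add MB_sc N_def ops3[OF x n])
  moreover have "MB (n + 3) (Sk 3 x * (?K2 * ?K1)) = M 0 * E 0 (Top (Top N))"
  proof -
    have W1: "S x * K 0 \<in> Wset (Suc n)" and W2: "S (S x * K 0) * K 0 \<in> Wset (Suc (Suc n))"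
      using Bop_W(2)[OF x n, of "K 0"] Bop_W(2)[OF Bop_W(2)[OF x n, of "K 0"], of "K 0"] by auto
    have "Top (Top N) = MB (Suc (Suc n)) (S (S x * K 0) * K 0)"
      unfolding N_def using Bop_W(1)[OF x n, of "K 0"] Bop_W(1)[OF W1, of "K 0"] by simp
    then have "M 0 * E 0 (Top (Top N)) = MB (Suc (Suc (Suc n))) (S (S (S x * K 0) * K 0))"
      using MB_Suc_S[OF Wset_A[OF W2]] by (simp add: ch_MB)
    moreover have "x \<in> A (n + 2)" "S x \<in> A (n + 2)" "S (S x) \<in> A (n + 2)" "K 0 \<in> A (n + 2)" "?K1 \<in> A (n + 2)"
      using n A_mono[OF Wset_A[OF x], of "n + 2"] A_mono[OF S_A[OF Wset_A[OF x]], of "n + 2"]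
        A_mono[OF S_A[OF S_A[OF Wset_A[OF x]]], of "n + 2"] A_mono[OF K_A, of _ "n + 2"] by auto
    ultimately show ?thesis
      by (simp add: S_mult[of _ "n + 2"] A_mult mult.assoc numeral_3_eq_3)
  qed
  ultimately show ?thesis by (simp add: sc_uminus)
qed

section \<open>Star powers of \<open>M\<close> and the normal form\<close>

definition pw :: "nat \<Rightarrow> 'r" where "pw n = (Aop ^^ n) 1"

lemma Bop_right': "N \<in> A (Suc 0) \<Longrightarrow> c \<in> A 0 \<Longrightarrow> Aop (N * c) = Aop N * c"
  "N \<in> A (Suc 0) \<Longrightarrow> c \<in> A 0 \<Longrightarrow> Top (N * c) = Top N * c"
  by (simp_all add: Bop_right R_comm K_comm)

lemma pw_0 [simp]: "pw 0 = 1" and pw_Suc: "pw (Suc n) = Aop (pw n)"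
  by (simp_all add: pw_def)

lemma pw_1: "pw (Suc 0) = M 0"
  by (simp add: pw_Suc Bop_def E_R)

lemma M0_MB: "M 0 = MB 1 1"
  by (simp add: MB_def)

lemma pw_W: "1 \<le> n \<Longrightarrow> \<exists>x \<in> Wset n. pw n = MB n x"
proof (induction n)
  case (Suc n)
  show ?case
  proof (cases "n = 0")
    case True
    then show ?thesis using pw_1 M0_MB by (auto intro: bexI[of _ 1])
  next
    case False
    then obtain x where "x \<in> Wset n" "pw n = MB n x" using Suc by auto
    then show ?thesis using Bop_W[of x n "R 0"] False by (auto simp: pw_Suc)
  qed
qed simp

lemma pw_A: "pw n \<in> A (Suc 0)"
  by (induction n) (auto simp: pw_Suc intro: Bop_A R_A)

lemma T_1: "Top 1 = M 0 * sc \<mu>"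
  by (simp add: Bop_def E_K)

text \<open>The factor by which two applications of \<open>Top\<close> multiply \<open>M 0\<close>:
  \<open>T_M\<close> contributes \<mu> g and \<open>T_1\<close> another \<mu>.\<close>

definition \<gamma> :: 'r where "\<gamma> = sc \<mu> * (sc \<mu> * g)"

lemma \<gamma>_A: "\<gamma> \<in> A 0"
  by (simp add: \<gamma>_def A_mult g_A)

lemma T_M: "Top (M 0) = sc \<mu> * g"
proof -
  have "Top (M 0) = E (Suc 0) (M 0 * M (Suc 0) * K 0)"
    using E_left[OF M0_A] by (simp add: Bop_def mult.assoc)
  then show ?thesis
    unfolding MMK using E_right[of g "Suc 0"] A_mono[OF g_A, of "Suc 0"] by (simp add: E_K)
qed

text \<open>\<open>TTA\<close> moves two applications of \<open>Top\<close> past each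
  \<open>Aop\<close>, down to \<open>M 0\<close>, where \<open>T_M\<close> and \<open>T_1\<close>
  evaluate them.\<close>

lemma TT_pw: "1 \<le> n \<Longrightarrow> Top (Top (pw n)) = pw n * \<gamma>"
proof (induction n)
  case (Suc n)
  show ?case
  proof (cases "n = 0")
    case True
    have "Top (Top (M 0)) = Top (1 * (sc \<mu> * g))" by (simp add: T_M)
    also have "\<dots> = M 0 * \<gamma>"
      by (subst Bop_right') (auto simp: T_1 \<gamma>_def A_mult g_A mult.assoc)
    finally show ?thesis using True pw_1 by simp
  next
    case False
    then obtain x where x: "x \<in> Wset n" "pw n = MB n x" using pw_W[of n] by auto
    have "Top (Top (pw (Suc n))) = Aop (pw n * \<gamma>)"
      using TTA[OF x(1)] False Suc.IH by (simp add: pw_Suc x(2))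
    then show ?thesis by (simp add: Bop_right' pw_A \<gamma>_A pw_Suc)
  qed
qed simp

text \<open>Tracing \<open>MMK\<close> over both factors gives \<open>ch 2 (K 0)\<close> as \<mu> d
  g, and both scalars can be divided out.\<close>

lemma g_C: "g \<in> C"
proof -
  have "ch 2 (K 0) = E 0 (E (Suc 0) (M 0 * M (Suc 0) * K 0))"
    by (simp add: ch_def Er_def numeral_2_eq_2)
  also have "\<dots> = E 0 (sc \<mu> * 1) * g"
    unfolding MMK using E_right[of g "Suc 0"] E_right[OF g_A] A_mono[OF g_A, of "Suc 0"]
    by (simp add: E_K)
  also have "\<dots> = sc (\<mu> * d) * g"
    by (subst E_left) (simp_all add: E_1 sc_mult)
  finally have "sc (inverse (\<mu> * d)) * ch 2 (K 0) = g"
    using sc_inverse_cancel[of "\<mu> * d" g] mu_nz d_nz by simp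
  moreover have "ch 2 (K 0) \<in> C" by (intro C.ch) auto
  ultimately show ?thesis using C_sc by metis
qed

lemma \<gamma>_C: "\<gamma> \<in> C"
  by (simp add: \<gamma>_def C_sc g_C)

lemma E0_pw_C: "1 \<le> n \<Longrightarrow> E 0 (pw n) \<in> C"
  using pw_W[of n] C.ch by (auto simp flip: ch_MB)

text \<open>The normal form claimed by the theorem. The second rule starts at exponent 2 because
  \<open>Top (pw 0)\<close> and \<open>Top (pw 1)\<close> are right multiples of \<open>pw 1\<close>
  and \<open>pw 0\<close>.\<close>

inductive_set U :: "'r set" where
  pw: "c \<in> C \<Longrightarrow> pw n * c \<in> U"
| T: "c \<in> C \<Longrightarrow> Top (pw (n + 2)) * c \<in> U"
| add: "x \<in> U \<Longrightarrow> y \<in> U \<Longrightarrow> x + y \<in> U"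

lemma U_A: "x \<in> U \<Longrightarrow> x \<in> A (Suc 0)"
proof (induction rule: U.induct)
  case (pw c n)
  then show ?case using A_mono[OF C_A, of c "Suc 0"] by (simp add: A_mult pw_A)
next
  case (T c n)
  then show ?case using A_mono[OF C_A, of c "Suc 0"] by (simp add: A_mult pw_A Bop_A K_A)
qed (auto intro: A_add)

lemma U_C: "x \<in> U \<Longrightarrow> c \<in> C \<Longrightarrow> x * c \<in> U"
  by (induction rule: U.induct) (auto simp: mult.assoc distrib_right intro!: U.intros C_mult simp del: add_2_eq_Suc')

lemma T_pw_U: "c \<in> C \<Longrightarrow> Top (pw n) * c \<in> U"
proof -
  assume c: "c \<in> C"
  consider "n = 0" | "n = 1" | m where "n = m + 2"
    by (metis One_nat_def add_2_eq_Suc' not0_implies_Suc)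
  then show ?thesis
  proof cases
    case 1
    then show ?thesis using U.pw[of "sc \<mu> * c" "Suc 0"] C_sc[OF c] by (simp add: T_1 pw_1 mult.assoc)
  next
    case 2
    then show ?thesis using U.pw[of "sc \<mu> * g * c" 0] C_sc[OF C_mult[OF g_C c]]
      by (simp add: T_M pw_1 mult.assoc)
  qed (use U.T c in auto)
qed

lemma U_Aop: "x \<in> U \<Longrightarrow> Aop x \<in> U"
proof (induction rule: U.induct)
  case (pw c n)
  then show ?case using U.pw[of c "Suc n"] by (simp add: Bop_right' pw_A C_A pw_Suc)
next
  case (T c n)
  obtain x where x: "x \<in> Wset (Suc n)" "pw (Suc n) = MB (Suc n) x" using pw_W[of "Suc n"] by auto
  \<comment> \<open>With exponent at least 2 there is an \<open>Aop\<close> under the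
    \<open>Top\<close>, so \<open>ATA\<close> applies with this \<open>?N\<close>;
    \<open>TT_pw\<close> then turns each pair of \<open>Top\<close> in the result into the factor
    \<gamma>.\<close>
  let ?N = "pw (Suc n)"
  have TT: "Top (Top ?N) = ?N * \<gamma>" by (rule TT_pw) simp
  have "Aop (Top (pw (n + 2)) * c) = Aop (Top (Aop ?N)) * c"
    using T by (simp add: Bop_right' Bop_A K_A R_A pw_A C_A pw_Suc)
  also have "Aop (Top (Aop ?N)) = Top ?N * \<gamma> + pw (Suc (Suc n)) * (sc (- lam) * \<gamma>)
      + M 0 * (sc (lam * inverse \<mu>) * (E 0 ?N * \<gamma>))"
    using ATA[OF x(1)] E_right[OF \<gamma>_A, of ?N]
    by (simp add: x(2)[symmetric] TT Bop_right' pw_A \<gamma>_A pw_Suc[of "Suc n", symmetric]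
        sc_uminus sc_left[of "M 0"] sc_left[of "pw _"])
  also have "\<dots> * c = Top ?N * (\<gamma> * c) + pw (Suc (Suc n)) * (sc (- lam) * (\<gamma> * c))
      + pw (Suc 0) * (sc (lam * inverse \<mu>) * (E 0 ?N * (\<gamma> * c)))"
    by (simp add: distrib_right mult.assoc pw_1)
  finally show ?case
    using T by (auto intro!: U.add U.pw T_pw_U C_sc C_mult \<gamma>_C E0_pw_C)
qed (simp add: Bop_add[OF U_A U_A] U.add)

lemma U_Top: "x \<in> U \<Longrightarrow> Top x \<in> U"
proof (induction rule: U.induct)
  case (pw c n)
  then show ?case using T_pw_U[of c n] by (simp add: Bop_right' pw_A C_A)
next
  case (T c n)
  have "Top (Top (pw (n + 2)) * c) = pw (n + 2) * (\<gamma> * c)"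
    using T TT_pw[of "n + 2"] by (simp add: Bop_right' Bop_A K_A pw_A C_A mult.assoc)
  then show ?case using T by (auto intro!: U.pw C_mult \<gamma>_C)
qed (simp add: Bop_add[OF U_A U_A] U.add)

theorem MB_U: "1 \<le> n \<Longrightarrow> x \<in> Wset n \<Longrightarrow> MB n x \<in> U"
proof (induction n arbitrary: x)
  case (Suc n)
  show ?case
  proof (cases "n = 0")
    case True
    then obtain c where "x = sc c" using Wp_1 Suc.prems(2) unfolding Wset_iff by fastforce
    then show ?thesis using True U.pw[OF C.sc, of "Suc 0" c] by (simp add: MB_def pw_1)
  next
    case False
    then have n: "1 \<le> n" by simp
    then obtain y where "(x, y) \<in> Sp n" using Wp_Sp Suc.prems(2) unfolding Wset_iff by blast
    then show ?thesis
    proof (induction rule: Sp.induct)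
      case (base a a' b b' t)
      have W: "b * a \<in> Wset n" using Wp_mult[OF base(2,1)] Wset_iff by blast
      have IH: "MB n (b * a) \<in> U" by (rule Suc.IH[OF n W])
      have "M 0 * E 0 (MB n (b * a)) \<in> U"
        using U.pw[of "E 0 (MB n (b * a))" "Suc 0"] C.ch[OF W n] n by (simp add: pw_1 ch_MB)
      then show ?case
        using MB_Sp_base[OF base(1,2,3) n] U_Aop[OF IH] U_Top[OF IH] base(3) by auto
    qed (simp add: MB_add U.add)
  qed
qed simp

end

section \<open>Matrix units and partial traces\<close>

lemma sum_delta_mult:
  fixes f :: "'k::finite \<Rightarrow> 'b::semiring_0"
  shows "(\<Sum>i\<in>UNIV. if i = k then f i else 0) = f k" "(\<Sum>i\<in>UNIV. if k = i then f i else 0) = f k"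
  by simp_all

lemma sum_delta2:
  fixes f :: "'k::finite \<Rightarrow> 'l::finite \<Rightarrow> 'b::comm_monoid_add"
  shows "(\<Sum>p\<in>UNIV. \<Sum>q\<in>UNIV. if a = p \<and> b = q then f p q else 0) = f a b"
proof -
  have "(\<Sum>q\<in>UNIV. if a = p \<and> b = q then f p q else 0) = (if a = p then f a b else 0)" for p
    by (cases "a = p") simp_all
  then show ?thesis by simp
qed

text \<open>An axiomatic substitute for all tensor powers at once: \<open>e m i j\<close> is a
  matrix unit in factor \<open>m\<close>, and \<open>sca\<close> embeds the coefficient algebra.
  Coefficients commute with the matrix units but not with each other; only complex scalars are
  central.\<close>

locale matrix_units =
  fixes sca :: "'a::ring_1 \<Rightarrow> 'r::ring_1" and emb :: "complex \<Rightarrow> 'a"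
    and e :: "nat \<Rightarrow> 'n::finite \<Rightarrow> 'n \<Rightarrow> 'r"
  assumes sca_1 [simp]: "sca 1 = 1" and sca_add: "sca (a + b) = sca a + sca b"
    and sca_mult: "sca (a * b) = sca a * sca b" and sca_inj: "sca a = 0 \<Longrightarrow> a = 0"
    and sca_e: "e m i j * sca a = sca a * e m i j"
    and e_mult: "e m i j * e m k l = (if j = k then e m i l else 0)"
    and e_sum: "(\<Sum>i\<in>UNIV. e m i i) = 1"
    and e_comm: "m \<noteq> n \<Longrightarrow> e m i j * e n k l = e n k l * e m i j"
    and emb: "complex_algebra emb"
    and sca_emb_central: "x * sca (emb c) = sca (emb c) * x"
begin

abbreviation sc :: "complex \<Rightarrow> 'r" where "sc c \<equiv> sca (emb c)"

lemma emb_simps [simp]: "emb 1 = 1" "emb (x + y) = emb x + emb y" "emb (x * y) = emb x * emb y"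
  using emb unfolding complex_algebra_def by blast+

lemma emb_0 [simp]: "emb 0 = 0"
  using emb_simps(2)[of 0 0] by simp

lemma sca_0 [simp]: "sca 0 = 0"
  using sca_add[of 0 0] by simp

lemma emb_uminus [simp]: "emb (- x) = - emb x"
  using emb_simps(2)[of x "- x"] by (simp add: eq_neg_iff_add_eq_0 add.commute)

lemma sca_uminus [simp]: "sca (- x) = - sca x"
  using sca_add[of x "- x"] by (simp add: eq_neg_iff_add_eq_0 add.commute)

lemma sca_sum: "sca (\<Sum>x\<in>X. f x) = (\<Sum>x\<in>X. sca (f x))"
  by (induction X rule: infinite_finite_induct) (auto simp: sca_add)

lemma emb_sum: "emb (\<Sum>x\<in>X. f x) = (\<Sum>x\<in>X. emb (f x))"
  by (induction X rule: infinite_finite_induct) auto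

lemma sc_1 [simp]: "sc 1 = 1" and sc_0 [simp]: "sc 0 = 0"
  by simp_all

lemma sc_add: "sc (c + d) = sc c + sc d" and sc_mult: "sc (c * d) = sc c * sc d"
  by (simp_all add: sca_add sca_mult)

lemma sc_sum: "sc (\<Sum>x\<in>X. f x) = (\<Sum>x\<in>X. sc (f x))"
  by (simp add: sca_sum emb_sum)

lemma sca_eq: "sca a = sca b \<Longrightarrow> a = b"
  using sca_inj[of "a - b"] sca_add[of a "- b"] by simp

lemma sc_inj: "sc c = 0 \<Longrightarrow> c = 0"
proof (rule ccontr)
  assume "sc c = 0" "c \<noteq> 0"
  then have "sc (inverse c) * sc c = 0" "sc (inverse c) * sc c = sc (inverse c * c)"
    by (simp_all only: sc_mult mult_zero_right)
  with \<open>c \<noteq> 0\<close> show False by simp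
qed

lemma sc_eq: "sc c = sc d \<Longrightarrow> c = d"
  using sc_inj[of "c - d"] sc_add[of c "- d"] by simp

lemma sc_left: "x * (sc c * y) = sc c * (x * y)"
  by (simp only: mult.assoc[symmetric] sca_emb_central)

lemma sc_cancel: "c \<noteq> 0 \<Longrightarrow> sc (inverse c) * (sc c * x) = x"
proof -
  assume "c \<noteq> 0"
  then have "inverse c * c = 1" by simp
  then have "sc (inverse c) * sc c = 1" by (simp only: sc_mult[symmetric] sc_1)
  then show ?thesis by (simp only: mult.assoc[symmetric] mult_1_left)
qed

text \<open>Acting in the first \<open>n\<close> factors only is expressed as commuting with all
  matrix units in the later factors. This makes closure under sums, products and partial traces
  immediate.\<close>

definition A :: "nat \<Rightarrow> 'r set" where
  "A n = {x. \<forall>m\<ge>n. \<forall>i j. e m i j * x = x * e m i j}"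

lemma A_comm: "x \<in> A n \<Longrightarrow> n \<le> m \<Longrightarrow> e m i j * x = x * e m i j"
  by (simp add: A_def)

lemma A_comm_left: "x \<in> A n \<Longrightarrow> n \<le> m \<Longrightarrow> e m i j * (x * y) = x * (e m i j * y)"
  by (simp only: mult.assoc[symmetric] A_comm)

lemma sca_A [simp]: "sca a \<in> A n"
  by (simp add: A_def sca_e)

lemma A_add: "x \<in> A n \<Longrightarrow> y \<in> A n \<Longrightarrow> x + y \<in> A n"
  by (simp add: A_def distrib_left distrib_right)

lemma A_mult:
  assumes "x \<in> A n" "y \<in> A n" shows "x * y \<in> A n"
  unfolding A_def
proof (intro CollectI allI impI)
  fix m i j assume "n \<le> m"
  then show "e m i j * (x * y) = x * y * e m i j"
    using A_comm_left[OF assms(1)] A_comm[OF assms(2)] by (simp only: mult.assoc)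
qed

lemma A_0 [simp]: "0 \<in> A n" and A_1 [simp]: "1 \<in> A n"
  by (simp_all add: A_def)

lemma A_sum: "(\<And>x. x \<in> X \<Longrightarrow> f x \<in> A n) \<Longrightarrow> (\<Sum>x\<in>X. f x) \<in> A n"
  by (induction X rule: infinite_finite_induct) (auto intro: A_add)

lemma A_mono: "x \<in> A m \<Longrightarrow> m \<le> n \<Longrightarrow> x \<in> A n"
  by (simp add: A_def)

lemma e_A: "m < n \<Longrightarrow> e m i j \<in> A n"
  by (simp add: A_def e_comm)

lemma e_mult_left: "e m i j * (e m k l * x) = (if j = k then e m i l * x else 0)"
  by (simp add: mult.assoc[symmetric] e_mult)

text \<open>The coefficient of \<open>e n i j\<close> when \<open>x\<close> is expanded over the
  matrix units of factor \<open>n\<close> (\<open>cp_expand\<close>). Summing over \<open>k\<close>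
  makes it commute with those units (\<open>cp_commute\<close>).\<close>

definition cp :: "nat \<Rightarrow> 'n \<Rightarrow> 'n \<Rightarrow> 'r \<Rightarrow> 'r" where
  "cp n i j x = (\<Sum>k\<in>UNIV. e n k i * (x * e n j k))"

lemma cp_add: "cp n i j (x + y) = cp n i j x + cp n i j y"
  by (simp add: cp_def distrib_left distrib_right sum.distrib)

lemma cp_0 [simp]: "cp n i j 0 = 0"
  by (simp add: cp_def)

lemma cp_sum: "cp n i j (\<Sum>x\<in>X. f x) = (\<Sum>x\<in>X. cp n i j (f x))"
  by (induction X rule: infinite_finite_induct) (auto simp: cp_add)

lemma cp_left:
  assumes "\<And>k l. e n k l * a = a * e n k l"
  shows "cp n i j (a * x) = a * cp n i j x"
proof -
  have "e n k l * (a * z) = a * (e n k l * z)" for k l z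
    by (simp only: mult.assoc[symmetric] assms)
  then show ?thesis by (simp only: cp_def sum_distrib_left mult.assoc)
qed

lemma cp_right:
  assumes "\<And>k l. e n k l * a = a * e n k l"
  shows "cp n i j (x * a) = cp n i j x * a"
  by (simp only: cp_def sum_distrib_right mult.assoc assms)

lemma cp_e: "cp n i j (e n k l) = (if i = k \<and> j = l then 1 else 0)"
proof -
  have "e n p i * (e n k l * e n j p) = (if i = k \<and> j = l then e n p p else 0)" for p
    by (auto simp: e_mult)
  then show ?thesis by (cases "i = k \<and> j = l") (auto simp: cp_def e_sum)
qed

lemma cp_1: "cp n i j 1 = (if i = j then 1 else 0)"
  by (simp add: cp_def e_mult e_sum)

lemma cp_expand: "x = (\<Sum>i\<in>UNIV. \<Sum>j\<in>UNIV. e n i j * cp n i j x)"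
proof -
  have "(\<Sum>j\<in>UNIV. e n i j * cp n i j x) = e n i i * x" for i
  proof -
    have "e n i j * cp n i j x = e n i i * (x * e n j j)" for j
      by (simp add: cp_def sum_distrib_left e_mult_left if_distrib[of "\<lambda>v. v * _"]
          sum_delta_mult cong: if_cong)
    then show ?thesis by (simp add: sum_distrib_left[symmetric] e_sum)
  qed
  then show ?thesis by (simp add: sum_distrib_right[symmetric] e_sum)
qed

lemma cp_commute: "e n k l * cp n i j x = cp n i j x * e n k l"
proof -
  have "e n k l * cp n i j x = e n k i * (x * e n j l)"
    by (simp add: cp_def sum_distrib_left e_mult_left if_distrib[of "\<lambda>v. v * _"] sum_delta_mult cong: if_cong)
  moreover have "cp n i j x * e n k l = e n k i * (x * e n j l)"
    by (simp add: cp_def sum_distrib_right mult.assoc e_mult if_distrib[of "\<lambda>v. _ * v"]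
        sum_delta_mult cong: if_cong)
  ultimately show ?thesis by simp
qed

lemma cp_A: assumes "x \<in> A (Suc n)" shows "cp n i j x \<in> A n"
  unfolding A_def
proof (intro CollectI allI impI)
  fix m k l assume "n \<le> m"
  show "e m k l * cp n i j x = cp n i j x * e m k l"
  proof (cases "m = n")
    case False
    then have "e m k l \<in> {y. \<forall>i j. e n i j * y = y * e n i j}" "Suc n \<le> m" using e_comm[of n m] \<open>n \<le> m\<close> by auto
    then show ?thesis
      using cp_left[of n "e m k l" i j x] cp_right[of n "e m k l" i j x] A_comm[OF assms] by simp
  qed (simp add: cp_commute)
qed

definition T :: "nat \<Rightarrow> 'r \<Rightarrow> 'r" where "T n x = (\<Sum>i\<in>UNIV. cp n i i x)"

lemma T_add: "T n (x + y) = T n x + T n y"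
  by (simp add: T_def cp_add sum.distrib)

lemma T_left: "a \<in> A n \<Longrightarrow> T n (a * x) = a * T n x"
  by (simp add: T_def cp_left A_comm sum_distrib_left)

lemma T_right: "a \<in> A n \<Longrightarrow> T n (x * a) = T n x * a"
  by (simp add: T_def cp_right A_comm sum_distrib_right)

lemma T_A: "x \<in> A (Suc n) \<Longrightarrow> T n x \<in> A n"
  unfolding T_def by (intro A_sum cp_A)

section \<open>Matrices placed in one or two factors\<close>

definition mh :: "('k::finite \<Rightarrow> 'k \<Rightarrow> 'r) \<Rightarrow> 'a ^ 'k ^ 'k \<Rightarrow> 'r" where
  "mh u X = (\<Sum>p\<in>UNIV. \<Sum>q\<in>UNIV. sca (X $ p $ q) * u p q)"

lemma mh_add: "mh u (X + Y) = mh u X + mh u Y"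
  by (simp add: mh_def sca_add distrib_right sum.distrib)

lemma mh_mult:
  assumes u: "\<And>p q r s. u p q * u r s = (if q = r then u p s else 0)"
    and c: "\<And>p q a. u p q * sca a = sca a * u p q"
  shows "mh u X * mh u Y = mh u (X ** Y)"
proof -
  have eq: "sca (X $ p $ q) * u p q * (sca (Y $ r $ s) * u r s) =
      (if q = r then sca (X $ p $ q * Y $ r $ s) * u p s else 0)" for p q r s
  proof -
    have "sca (X $ p $ q) * u p q * (sca (Y $ r $ s) * u r s)
        = sca (X $ p $ q) * (u p q * sca (Y $ r $ s)) * u r s" by (simp only: mult.assoc)
    also have "\<dots> = sca (X $ p $ q) * sca (Y $ r $ s) * (u p q * u r s)"
      by (simp only: c mult.assoc)
    finally show ?thesis by (simp add: u sca_mult)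
  qed
  have 1: "mh u X * z = (\<Sum>p\<in>UNIV. \<Sum>q\<in>UNIV. sca (X $ p $ q) * u p q * z)" for z
    by (simp only: mh_def sum_distrib_right)
  have 2: "z * mh u Y = (\<Sum>r\<in>UNIV. \<Sum>s\<in>UNIV. z * (sca (Y $ r $ s) * u r s))" for z
    by (simp only: mh_def sum_distrib_left)
  have "mh u X * mh u Y = (\<Sum>p\<in>UNIV. \<Sum>q\<in>UNIV. \<Sum>r\<in>UNIV. \<Sum>s\<in>UNIV.
      if q = r then sca (X $ p $ q * Y $ r $ s) * u p s else 0)"
    by (subst 1) (simp only: 2 eq)
  also have "\<dots> = (\<Sum>p\<in>UNIV. \<Sum>s\<in>UNIV. \<Sum>q\<in>UNIV. sca (X $ p $ q * Y $ q $ s) * u p s)"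
  proof (rule sum.cong[OF HOL.refl])
    fix p
    have "(\<Sum>q\<in>UNIV. \<Sum>r\<in>UNIV. \<Sum>s\<in>UNIV. if q = r then sca (X $ p $ q * Y $ r $ s) * u p s else 0)
      = (\<Sum>q\<in>UNIV. \<Sum>s\<in>UNIV. \<Sum>r\<in>UNIV. if q = r then sca (X $ p $ q * Y $ r $ s) * u p s else 0)"
      by (intro sum.cong HOL.refl sum.swap)
    also have "\<dots> = (\<Sum>q\<in>UNIV. \<Sum>s\<in>UNIV. sca (X $ p $ q * Y $ q $ s) * u p s)" by simp
    also have "\<dots> = (\<Sum>s\<in>UNIV. \<Sum>q\<in>UNIV. sca (X $ p $ q * Y $ q $ s) * u p s)" by (rule sum.swap)
    finally show "(\<Sum>q\<in>UNIV. \<Sum>r\<in>UNIV. \<Sum>s\<in>UNIV. if q = r then sca (X $ p $ q * Y $ r $ s) * u p s else 0)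
      = (\<Sum>s\<in>UNIV. \<Sum>q\<in>UNIV. sca (X $ p $ q * Y $ q $ s) * u p s)" .
  qed
  also have "\<dots> = mh u (X ** Y)"
    by (simp add: mh_def matrix_matrix_mult_def sca_sum sum_distrib_right)
  finally show ?thesis .
qed

lemma mh_mat:
  assumes "(\<Sum>p\<in>UNIV. u p p) = 1" shows "mh u (mat c) = sca c"
proof -
  have "sca (mat c $ p $ q) * u p q = (if p = q then sca c * u p q else 0)" for p q
    by (simp add: mat_def)
  then have "mh u (mat c) = (\<Sum>p\<in>UNIV. sca c * u p p)" by (simp add: mh_def)
  then show ?thesis by (simp add: sum_distrib_left[symmetric] assms)
qed

definition em :: "complex ^ 'k ^ 'k \<Rightarrow> 'a ^ 'k ^ 'k" where "em X = (\<chi> i j. emb (X $ i $ j))"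

lemma em_add: "em (X + Y) = em X + em Y" and em_mult: "em (X ** Y) = em X ** em Y"
  and em_mat: "em (mat c) = mat (emb c)" and em_uminus: "em (- X) = - em X"
  by (simp_all add: em_def vec_eq_iff matrix_matrix_mult_def emb_sum mat_def)

definition one :: "nat \<Rightarrow> ('n, 'a) mat1 \<Rightarrow> 'r" where "one m X = mh (e m) X"

definition ee :: "nat \<Rightarrow> 'n \<times> 'n \<Rightarrow> 'n \<times> 'n \<Rightarrow> 'r" where
  "ee m p q = e m (fst p) (fst q) * e (Suc m) (snd p) (snd q)"

definition two :: "nat \<Rightarrow> ('n, complex) mat2 \<Rightarrow> 'r" where "two m X = mh (ee m) (em X)"

lemma sum_UNIV_prod: "(\<Sum>p\<in>UNIV. f p) = (\<Sum>i\<in>UNIV. \<Sum>j\<in>UNIV. f (i, j))"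
  for f :: "'b::finite \<times> 'c::finite \<Rightarrow> 'd::comm_monoid_add"
  by (simp add: UNIV_Times_UNIV[symmetric] sum.cartesian_product' del: UNIV_Times_UNIV)

lemma ee_mult: "ee m p q * ee m r s = (if q = r then ee m p s else 0)"
proof -
  have "ee m p q * ee m r s = (e m (fst p) (fst q) * e m (fst r) (fst s))
      * (e (Suc m) (snd p) (snd q) * e (Suc m) (snd r) (snd s))"
    using e_comm[of "Suc m" m "snd p" "snd q" "fst r" "fst s"]
    by (simp add: ee_def mult.assoc) (simp add: mult.assoc[symmetric])
  then show ?thesis by (simp add: e_mult ee_def prod_eq_iff)
qed

lemma ee_sum: "(\<Sum>p\<in>UNIV. ee m p p) = 1"
  by (simp add: sum_UNIV_prod ee_def sum_distrib_left[symmetric] e_sum)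

lemma ee_sca: "ee m p q * sca a = sca a * ee m p q"
  by (simp add: ee_def mult.assoc sca_e) (simp add: mult.assoc[symmetric] sca_e)

lemma ee_A: "Suc m < n \<Longrightarrow> ee m p q \<in> A n"
  by (simp add: ee_def A_mult e_A)

lemma one_mult: "one m X * one m Y = one m (X ** Y)"
  unfolding one_def by (rule mh_mult[OF e_mult sca_e])

lemma one_add: "one m (X + Y) = one m X + one m Y"
  by (simp add: one_def mh_add)

lemma one_mat [simp]: "one m (mat c) = sca c"
  by (simp add: one_def mh_mat e_sum)

lemma two_mult: "two m X * two m Y = two m (X ** Y)"
  unfolding two_def em_mult by (rule mh_mult[OF ee_mult ee_sca])

lemma two_add: "two m (X + Y) = two m X + two m Y"
  by (simp add: two_def mh_add em_add)

lemma two_mat [simp]: "two m (mat c) = sc c"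
  by (simp add: two_def mh_mat ee_sum em_mat)

lemma mh_uminus: "mh u (- X) = - mh u X"
  by (simp add: mh_def sum_negf)

lemma two_diff: "two m (X - Y) = two m X - two m Y"
  using two_add[of m X "- Y"] by (simp add: two_def em_uminus mh_uminus)

lemma one_diff: "one m (X - Y) = one m X - one m Y"
  using one_add[of m X "- Y"] by (simp add: one_def mh_uminus)

lemma one_A: "m < n \<Longrightarrow> one m X \<in> A n"
  unfolding one_def mh_def by (intro A_sum A_mult sca_A e_A)

lemma two_A: "Suc m < n \<Longrightarrow> two m X \<in> A n"
  unfolding two_def mh_def by (intro A_sum A_mult sca_A ee_A)

lemma cp_one: "cp m i j (one m X) = sca (X $ i $ j)"
proof -
  have "cp m i j (one m X) = (\<Sum>p\<in>UNIV. \<Sum>q\<in>UNIV. sca (X $ p $ q) * cp m i j (e m p q))"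
    by (simp add: one_def mh_def cp_sum cp_left sca_e)
  also have "\<dots> = (\<Sum>p\<in>UNIV. \<Sum>q\<in>UNIV. if i = p \<and> j = q then sca (X $ p $ q) else 0)"
    by (auto simp: cp_e intro!: sum.cong)
  finally show ?thesis by (simp add: sum_delta2)
qed

lemma one_inj: "one m X = one m Y \<Longrightarrow> X = Y"
  by (metis (no_types) cp_one sca_eq vec_eq_iff)

lemma em_inj: "em X = em Y \<Longrightarrow> X = Y"
  unfolding em_def vec_eq_iff by simp (metis sc_eq)

lemma cp_ee: "cp m i j (cp (Suc m) k l (ee m p q)) = (if p = (i, k) \<and> q = (j, l) then 1 else 0)"
  by (auto simp: ee_def cp_left e_comm cp_e)

lemma cp_two: "cp m i j (cp (Suc m) k l (two m X)) = sc (X $ (i, k) $ (j, l))"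
proof -
  have "cp m i j (cp (Suc m) k l (two m X))
      = (\<Sum>p\<in>UNIV. \<Sum>q\<in>UNIV. sc (X $ p $ q) * cp m i j (cp (Suc m) k l (ee m p q)))"
    by (simp add: two_def mh_def cp_sum cp_left sca_e em_def)
  also have "\<dots> = (\<Sum>p\<in>UNIV. \<Sum>q\<in>UNIV. if (i, k) = p \<and> (j, l) = q then sc (X $ p $ q) else 0)"
    by (auto simp: cp_ee intro!: sum.cong)
  finally show ?thesis by (simp only: sum_delta2)
qed

lemma two_inj: "two m X = two m Y \<Longrightarrow> X = Y"
proof -
  assume eq: "two m X = two m Y"
  have "X $ p $ q = Y $ p $ q" for p q
    using cp_two[of m "fst p" "fst q" "snd p" "snd q" X] cp_two[of m "fst p" "fst q" "snd p" "snd q" Y]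
    unfolding eq by (simp add: sc_eq)
  then show ?thesis by (simp add: vec_eq_iff)
qed

lemma A_comm_one:
  assumes "x \<in> A n" "n \<le> m" shows "one m (em X) * x = x * one m (em X)"
  unfolding one_def mh_def sum_distrib_left sum_distrib_right
  by (auto simp: em_def mult.assoc A_comm[OF assms] sc_left[of x] intro!: sum.cong)

lemma A_comm_two:
  assumes "x \<in> A n" "n \<le> m" shows "two m X * x = x * two m X"
  unfolding two_def mh_def sum_distrib_left sum_distrib_right
  using assms(2)
  by (auto simp: em_def ee_def mult.assoc A_comm[OF assms(1)] A_comm_left[OF assms(1)] sc_left[of x]
      intro!: sum.cong)

end

locale skew_matrices = matrix_units sca emb e
  for sca :: "'a::ring_1 \<Rightarrow> 'r::ring_1" and emb and e :: "nat \<Rightarrow> 'n::finite \<Rightarrow> 'n \<Rightarrow> 'r" +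
  fixes R R' \<Psi> :: "('n, complex) mat2"
  assumes skew: "\<And>b x h g. (\<Sum>c\<in>UNIV. \<Sum>f\<in>UNIV. R $ (b, c) $ (x, f) * \<Psi> $ (f, g) $ (c, h)) =
      (if b = h \<and> x = g then 1 else 0)"
    and R_inv: "R ** R' = mat 1" "R' ** R = mat 1"
    and R_braid: "two n R * two (Suc n) R * two n R = two (Suc n) R * two n R * two (Suc n) R"
begin

text \<open>With the indices regrouped, skew invertibility says that two square complex matrices
  multiply to the identity in one order; hence they do so in the other.\<close>

lemma skew_left: "(\<Sum>h\<in>UNIV. \<Sum>g\<in>UNIV. \<Psi> $ (f, g) $ (c, h) * R $ (h, c') $ (g, f')) =
  (if c = c' \<and> f = f' then 1 else 0)"
proof -
  define X :: "complex ^ ('n \<times> 'n) ^ ('n \<times> 'n)" where "X = (\<chi> p q. R $ (fst p, fst q) $ (snd p, snd q))"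
  define Y :: "complex ^ ('n \<times> 'n) ^ ('n \<times> 'n)" where "Y = (\<chi> p q. \<Psi> $ (snd p, snd q) $ (fst p, fst q))"
  have "X ** Y = mat 1"
    using skew by (auto simp: vec_eq_iff matrix_matrix_mult_def mat_def X_def Y_def sum_UNIV_prod prod_eq_iff)
  then have "Y ** X = mat 1" by (simp add: matrix_left_right_inverse)
  then have "(Y ** X) $ (c, f) $ (c', f') = (if c = c' \<and> f = f' then 1 else 0)"
    by (simp add: mat_def)
  then show ?thesis
    by (simp add: matrix_matrix_mult_def X_def Y_def sum_UNIV_prod)
qed

section \<open>The \<open>R\<close>-trace: invariance under conjugation and cyclicity\<close>

definition D :: "('n, complex) mat1" where "D = (\<chi> i j. \<Sum>a\<in>UNIV. \<Psi> $ (i, a) $ (j, a))"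

definition E :: "nat \<Rightarrow> 'r \<Rightarrow> 'r" where "E n x = T n (one n (em D) * x)"

lemma E_add: "E n (x + y) = E n x + E n y"
  by (simp add: E_def distrib_left T_add)

lemma E_0 [simp]: "E n 0 = 0"
  using E_add[of n 0 0] by simp

lemma E_sum: "E n (\<Sum>x\<in>X. f x) = (\<Sum>x\<in>X. E n (f x))"
  by (induction X rule: infinite_finite_induct) (auto simp: E_add)

lemma E_left: "a \<in> A n \<Longrightarrow> E n (a * x) = a * E n x"
  using T_left[of a n "one n (em D) * x"] A_comm_one[of a n n D]
  by (simp add: E_def mult.assoc[symmetric])

lemma E_right: "a \<in> A n \<Longrightarrow> E n (x * a) = E n x * a"
  using T_right[of a n "one n (em D) * x"] by (simp add: E_def mult.assoc)

lemma E_A: "x \<in> A (Suc n) \<Longrightarrow> E n x \<in> A n"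
  unfolding E_def by (intro T_A A_mult one_A) auto

lemma E_sca: "E n (sca a * x) = sca a * E n x"
  by (simp add: E_left)

lemma E_e: "E n (e n i j) = sc (D $ j $ i)"
proof -
  have "one n (em D) * e n i j = (\<Sum>p\<in>UNIV. \<Sum>q\<in>UNIV. if i = q then sc (D $ p $ q) * e n p j else 0)"
    unfolding one_def mh_def sum_distrib_right
    by (intro sum.cong[OF HOL.refl]) (simp add: em_def mult.assoc e_mult)
  also have "\<dots> = (\<Sum>p\<in>UNIV. sc (D $ p $ i) * e n p j)" by simp
  finally have "E n (e n i j) = (\<Sum>k\<in>UNIV. \<Sum>p\<in>UNIV. cp n k k (sc (D $ p $ i) * e n p j))"
    by (simp add: E_def T_def cp_sum)
  also have "\<dots> = (\<Sum>k\<in>UNIV. \<Sum>p\<in>UNIV. if j = k \<and> k = p then sc (D $ p $ i) else 0)"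
    by (auto simp: cp_left sca_e cp_e intro!: sum.cong)
  also have "\<dots> = (\<Sum>k\<in>UNIV. \<Sum>p\<in>UNIV. if j = k \<and> j = p then sc (D $ p $ i) else 0)"
    by (auto intro!: sum.cong)
  finally show ?thesis by (simp only: sum_delta2)
qed

lemma E_1: "E n 1 = sc (\<Sum>i\<in>UNIV. D $ i $ i)"
  by (simp add: e_sum[of n, symmetric] E_sum E_e sc_sum)

definition trD :: "('n, complex) mat2 \<Rightarrow> ('n, complex) mat1" where
  "trD X = (\<chi> i k. \<Sum>j\<in>UNIV. \<Sum>l\<in>UNIV. X $ (i, j) $ (k, l) * D $ l $ j)"

lemma E_two: "E (Suc n) (two n X) = one n (em (trD X))"
proof -
  have "E (Suc n) (two n X) = (\<Sum>i\<in>UNIV. \<Sum>j\<in>UNIV. \<Sum>k\<in>UNIV. \<Sum>l\<in>UNIV.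
      sc (X $ (i, j) $ (k, l)) * (e n i k * sc (D $ l $ j)))"
    by (simp add: two_def mh_def sum_UNIV_prod E_sum E_sca em_def ee_def E_left e_A E_e)
  also have "\<dots> = (\<Sum>i\<in>UNIV. \<Sum>j\<in>UNIV. \<Sum>k\<in>UNIV. \<Sum>l\<in>UNIV.
      sc (X $ (i, j) $ (k, l) * D $ l $ j) * e n i k)"
    by (intro sum.cong[OF HOL.refl]) (simp only: sca_emb_central[of "e _ _ _"] sc_mult mult.assoc)
  also have "\<dots> = (\<Sum>i\<in>UNIV. \<Sum>k\<in>UNIV. \<Sum>j\<in>UNIV. \<Sum>l\<in>UNIV.
      sc (X $ (i, j) $ (k, l) * D $ l $ j) * e n i k)"
    by (rule sum.cong[OF HOL.refl], rule sum.swap)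
  also have "\<dots> = one n (em (trD X))"
    by (simp only: one_def mh_def em_def trD_def vec_lambda_beta sc_sum sum_distrib_right)
  finally show ?thesis .
qed

lemma trD_R: "trD R = mat 1"
proof -
  have "(\<Sum>j\<in>UNIV. \<Sum>l\<in>UNIV. R $ (i, j) $ (k, l) * D $ l $ j) = (if i = k then 1 else 0)" for i k
  proof -
    have "(\<Sum>j\<in>UNIV. \<Sum>l\<in>UNIV. R $ (i, j) $ (k, l) * D $ l $ j)
        = (\<Sum>j\<in>UNIV. \<Sum>l\<in>UNIV. \<Sum>a\<in>UNIV. R $ (i, j) $ (k, l) * \<Psi> $ (l, a) $ (j, a))"
      by (simp add: D_def sum_distrib_left)
    also have "\<dots> = (\<Sum>j\<in>UNIV. \<Sum>a\<in>UNIV. \<Sum>l\<in>UNIV. R $ (i, j) $ (k, l) * \<Psi> $ (l, a) $ (j, a))"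
      by (rule sum.cong[OF HOL.refl], rule sum.swap)
    also have "\<dots> = (\<Sum>a\<in>UNIV. \<Sum>j\<in>UNIV. \<Sum>l\<in>UNIV. R $ (i, j) $ (k, l) * \<Psi> $ (l, a) $ (j, a))"
      by (rule sum.swap)
    also have "\<dots> = (\<Sum>a\<in>UNIV. if i = a \<and> k = a then 1 else 0)" by (simp only: skew)
    also have "\<dots> = (\<Sum>a\<in>UNIV. if i = a then if k = a then 1 else 0 else 0)"
      by (intro sum.cong HOL.refl) simp
    finally show ?thesis by auto
  qed
  then show ?thesis by (simp add: trD_def vec_eq_iff mat_def)
qed

lemma E_R: "E (Suc n) (two n R) = 1"
  by (simp add: E_two trD_R em_mat)

abbreviation "Rn n \<equiv> two n R"
abbreviation "Rn' n \<equiv> two n R'"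

lemma Rn_inv [simp]: "Rn n * Rn' n = 1" "Rn' n * Rn n = 1"
  by (simp_all add: two_mult R_inv)

text \<open>Slices of \<open>R\<close> in its first factor. By skew invertibility they span all matrices, and for
  each of them the \<open>R\<close>-trace is known.\<close>

definition slice :: "nat \<Rightarrow> 'n \<Rightarrow> 'n \<Rightarrow> 'r" where
  "slice n h g = (\<Sum>c\<in>UNIV. \<Sum>f\<in>UNIV. sc (R $ (h, c) $ (g, f)) * e n c f)"

lemma Rn_slice: "Rn n = (\<Sum>h\<in>UNIV. \<Sum>g\<in>UNIV. e n h g * slice (Suc n) h g)"
proof -
  have "Rn n = (\<Sum>h\<in>UNIV. \<Sum>c\<in>UNIV. \<Sum>g\<in>UNIV. \<Sum>f\<in>UNIV. e n h g * (sc (R $ (h, c) $ (g, f)) * e (Suc n) c f))"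
    by (simp add: two_def mh_def sum_UNIV_prod em_def ee_def sc_left[of "e _ _ _"])
  also have "\<dots> = (\<Sum>h\<in>UNIV. \<Sum>g\<in>UNIV. \<Sum>c\<in>UNIV. \<Sum>f\<in>UNIV. e n h g * (sc (R $ (h, c) $ (g, f)) * e (Suc n) c f))"
    by (rule sum.cong[OF HOL.refl], rule sum.swap)
  finally show ?thesis by (simp only: slice_def sum_distrib_left)
qed

lemma slice_span: "e n c f = (\<Sum>h\<in>UNIV. \<Sum>g\<in>UNIV. sc (\<Psi> $ (f, g) $ (c, h)) * slice n h g)"
proof -
  have "(\<Sum>h\<in>UNIV. \<Sum>g\<in>UNIV. sc (\<Psi> $ (f, g) $ (c, h)) * slice n h g)
      = (\<Sum>h\<in>UNIV. \<Sum>g\<in>UNIV. \<Sum>c'\<in>UNIV. \<Sum>f'\<in>UNIV. sc (\<Psi> $ (f, g) $ (c, h) * R $ (h, c') $ (g, f')) * e n c' f')"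
    by (simp only: slice_def sum_distrib_left sc_mult mult.assoc)
  also have "\<dots> = (\<Sum>h\<in>UNIV. \<Sum>c'\<in>UNIV. \<Sum>g\<in>UNIV. \<Sum>f'\<in>UNIV. sc (\<Psi> $ (f, g) $ (c, h) * R $ (h, c') $ (g, f')) * e n c' f')"
    by (rule sum.cong[OF HOL.refl], rule sum.swap)
  also have "\<dots> = (\<Sum>h\<in>UNIV. \<Sum>c'\<in>UNIV. \<Sum>f'\<in>UNIV. \<Sum>g\<in>UNIV. sc (\<Psi> $ (f, g) $ (c, h) * R $ (h, c') $ (g, f')) * e n c' f')"
    by (rule sum.cong[OF HOL.refl], rule sum.cong[OF HOL.refl], rule sum.swap)
  also have "\<dots> = (\<Sum>c'\<in>UNIV. \<Sum>h\<in>UNIV. \<Sum>f'\<in>UNIV. \<Sum>g\<in>UNIV. sc (\<Psi> $ (f, g) $ (c, h) * R $ (h, c') $ (g, f')) * e n c' f')"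
    by (rule sum.swap)
  also have "\<dots> = (\<Sum>c'\<in>UNIV. \<Sum>f'\<in>UNIV. \<Sum>h\<in>UNIV. \<Sum>g\<in>UNIV. sc (\<Psi> $ (f, g) $ (c, h) * R $ (h, c') $ (g, f')) * e n c' f')"
    by (rule sum.cong[OF HOL.refl], rule sum.swap)
  also have "\<dots> = (\<Sum>c'\<in>UNIV. \<Sum>f'\<in>UNIV. sc (if c = c' \<and> f = f' then 1 else 0) * e n c' f')"
    by (simp only: sum_distrib_right[symmetric] sc_sum[symmetric] skew_left)
  also have "\<dots> = (\<Sum>c'\<in>UNIV. \<Sum>f'\<in>UNIV. if c = c' \<and> f = f' then e n c' f' else 0)"
    by (auto intro!: sum.cong)
  finally show ?thesis by (simp only: sum_delta2)
qed

definition ext :: "('n, complex) mat1 \<Rightarrow> ('n, complex) mat2" where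
  "ext Y = (\<chi> p q. if snd p = snd q then Y $ fst p $ fst q else 0)"

lemma two_ext: "two n (ext Y) = one n (em Y)"
proof -
  have "two n (ext Y) = (\<Sum>i\<in>UNIV. \<Sum>j\<in>UNIV. \<Sum>k\<in>UNIV. \<Sum>l\<in>UNIV.
      if j = l then sc (Y $ i $ k) * (e n i k * e (Suc n) j l) else 0)"
    unfolding two_def mh_def sum_UNIV_prod
    by (intro sum.cong[OF HOL.refl]) (simp add: em_def ee_def ext_def)
  also have "\<dots> = (\<Sum>i\<in>UNIV. \<Sum>j\<in>UNIV. \<Sum>k\<in>UNIV. sc (Y $ i $ k) * (e n i k * e (Suc n) j j))" by simp
  also have "\<dots> = (\<Sum>i\<in>UNIV. \<Sum>k\<in>UNIV. \<Sum>j\<in>UNIV. sc (Y $ i $ k) * (e n i k * e (Suc n) j j))"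
    by (rule sum.cong[OF HOL.refl], rule sum.swap)
  also have "\<dots> = one n (em Y)"
    by (simp add: one_def mh_def em_def sum_distrib_left[symmetric] e_sum)
  finally show ?thesis .
qed

text \<open>By \<open>GGR\<close>, conjugating \<open>R\<close> by the next copy of \<open>G\<close>
  equals conjugating the next copy of \<open>R\<close> by \<open>G'\<close>, whose trace is 1.
  Expanding \<open>R\<close> into slices then gives the trace of every conjugated slice, and the
  slices span all matrices by \<open>slice_span\<close>. Used with \<open>G\<close> equal to
  \<open>F\<close>, to \<open>R\<close> and to the inverse of \<open>R\<close>.\<close>

lemma E_conj:
  assumes inv: "G ** G' = mat 1" "G' ** G = mat 1"
    and GGR: "\<And>n. two (Suc n) R * two n G * two (Suc n) G = two n G * two (Suc n) G * two n R"
    and x: "x \<in> A (Suc n)"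
  shows "E (Suc n) (two n G * x * two n G') = E n x"
proof -
  have gg: "two n G * two n G' = 1" "two n G' * two n G = 1" for n
    by (simp_all add: two_mult inv)
  have conj: "two (Suc n) G * two n R * two (Suc n) G' = two n G' * two (Suc n) R * two n G" for n
  proof -
    have "two n G' * (two n G * two (Suc n) G * two n R) * two (Suc n) G'
        = two n G' * (two (Suc n) R * two n G * two (Suc n) G) * two (Suc n) G'"
      by (simp only: GGR)
    moreover have "two n G' * (two n G * z) = z" for z by (simp only: mult.assoc[symmetric] gg mult_1_left)
    ultimately show ?thesis by (simp add: mult.assoc gg)
  qed
  define \<theta> where "\<theta> n h g = E (Suc n) (two n G * slice n h g * two n G')" for n h g
  \<comment> \<open>Only positions \<open>Suc n\<close> are reached here, because the copy of
    \<open>R\<close> that is expanded also needs the factor to the left.\<close>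
  have \<theta>: "\<theta> (Suc n) h g = (if h = g then 1 else 0)" for n h g
  proof -
    have comm: "e n i j * two (Suc n) X = two (Suc n) X * e n i j" for i j X
      by (rule A_comm_two[symmetric]) (auto intro: e_A)
    have comm_s: "e n i j * slice (Suc n) h g = slice (Suc n) h g * e n i j" for i j h g
      unfolding slice_def sum_distrib_left sum_distrib_right
      by (auto simp: mult.assoc e_comm[of n "Suc n"] sc_left[of "e _ _ _"] intro!: sum.cong)
    have l: "two (Suc n) G * (e n i j * z) = e n i j * (two (Suc n) G * z)" for i j z
      by (simp only: mult.assoc[symmetric] comm)
    have "two (Suc n) G * two n R * two (Suc n) G'
        = (\<Sum>h\<in>UNIV. \<Sum>g\<in>UNIV. e n h g * (two (Suc n) G * slice (Suc n) h g * two (Suc n) G'))"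
      by (simp add: Rn_slice sum_distrib_left sum_distrib_right mult.assoc l)
    then have "E (Suc (Suc n)) (two (Suc n) G * two n R * two (Suc n) G')
        = (\<Sum>h\<in>UNIV. \<Sum>g\<in>UNIV. e n h g * \<theta> (Suc n) h g)"
      by (simp add: E_sum E_left e_A \<theta>_def)
    moreover have "E (Suc (Suc n)) (two (Suc n) G * two n R * two (Suc n) G') = 1"
      unfolding conj by (simp add: E_left E_right two_A E_R gg)
    ultimately have "cp n h g (\<Sum>h\<in>UNIV. \<Sum>g\<in>UNIV. e n h g * \<theta> (Suc n) h g) = cp n h g 1" by simp
    moreover have comm_\<theta>: "e n i j * \<theta> (Suc n) h g = \<theta> (Suc n) h g * e n i j" for i j h g
    proof -
      have "e n i j \<in> A (Suc (Suc n))" by (rule e_A) simp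
      then have "e n i j * \<theta> (Suc n) h g = E (Suc (Suc n)) (e n i j * (two (Suc n) G * slice (Suc n) h g * two (Suc n) G'))"
        "\<theta> (Suc n) h g * e n i j = E (Suc (Suc n)) (two (Suc n) G * slice (Suc n) h g * two (Suc n) G' * e n i j)"
        by (simp_all only: \<theta>_def E_left E_right)
      moreover have "e n i j * (two (Suc n) X * z) = two (Suc n) X * (e n i j * z)"
        "e n i j * (slice (Suc n) h g * z) = slice (Suc n) h g * (e n i j * z)" for X z
        by (simp_all only: mult.assoc[symmetric] comm comm_s)
      ultimately show ?thesis by (simp only: mult.assoc comm)
    qed
    moreover have "cp n h g (e n p q * \<theta> (Suc n) p q) = cp n h g (e n p q) * \<theta> (Suc n) p q" for p q
      by (rule cp_right) (rule comm_\<theta>)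
    ultimately have "(\<Sum>p\<in>UNIV. \<Sum>q\<in>UNIV. cp n h g (e n p q) * \<theta> (Suc n) p q) = (if h = g then 1 else 0)"
      by (simp only: cp_sum cp_1)
    moreover have "(\<Sum>p\<in>UNIV. \<Sum>q\<in>UNIV. cp n h g (e n p q) * \<theta> (Suc n) p q)
        = (\<Sum>p\<in>UNIV. \<Sum>q\<in>UNIV. if h = p \<and> g = q then \<theta> (Suc n) p q else 0)"
      by (auto simp: cp_e intro!: sum.cong)
    ultimately show ?thesis by (simp only: sum_delta2)
  qed
  have e1: "E (Suc (Suc n)) (two (Suc n) G * e (Suc n) c f * two (Suc n) G') = sc (D $ f $ c)" for n c f
  proof -
    have "E (Suc (Suc n)) (two (Suc n) G * e (Suc n) c f * two (Suc n) G')
        = (\<Sum>h\<in>UNIV. \<Sum>g\<in>UNIV. sc (\<Psi> $ (f, g) $ (c, h)) * \<theta> (Suc n) h g)"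
      by (subst slice_span)
        (simp add: sum_distrib_left sum_distrib_right mult.assoc sc_left[of "two _ _"] E_sum E_sca \<theta>_def)
    also have "\<dots> = (\<Sum>h\<in>UNIV. \<Sum>g\<in>UNIV. if h = g then sc (\<Psi> $ (f, g) $ (c, h)) else 0)"
      by (intro sum.cong[OF HOL.refl]) (simp add: \<theta>)
    finally show ?thesis by (simp add: D_def sc_sum)
  qed
  \<comment> \<open>The traced conjugate is a complex matrix that is the same at every position, so
    its value at \<open>Suc n\<close> carries over to \<open>n\<close>, including position
    0.\<close>
  have e0: "E (Suc n) (two n G * e n c f * two n G') = sc (D $ f $ c)" for n c f
  proof -
    define Y :: "('n, complex) mat1" where "Y = (\<chi> i j. if c = i \<and> f = j then 1 else 0)"
    have Y: "one n (em Y) = e n c f" for n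
    proof -
      have "one n (em Y) = (\<Sum>i\<in>UNIV. \<Sum>j\<in>UNIV. if c = i \<and> f = j then e n i j else 0)"
        by (auto simp: one_def mh_def em_def Y_def intro!: sum.cong)
      then show ?thesis by (simp only: sum_delta2)
    qed
    have E: "E (Suc n) (two n G * e n c f * two n G') = one n (em (trD (G ** ext Y ** G')))" for n
      by (simp add: Y[symmetric] two_ext[symmetric] two_mult E_two)
    have "one (Suc n) (em (trD (G ** ext Y ** G'))) = one (Suc n) (em (mat (D $ f $ c)))"
      using e1[of n c f] by (simp add: E em_mat)
    then have "trD (G ** ext Y ** G') = mat (D $ f $ c)"
      by (intro em_inj one_inj)
    then show ?thesis by (simp add: E em_mat)
  qed
  have l: "two n G * (cp n i j x * z) = cp n i j x * (two n G * z)" for i j z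
    using A_comm_two[OF cp_A[OF x], of n G i j] by (simp only: mult.assoc[symmetric] order_refl)
  have exp: "x = (\<Sum>i\<in>UNIV. \<Sum>j\<in>UNIV. cp n i j x * e n i j)"
    using cp_expand[of x n] by (simp only: cp_commute)
  have "E (Suc n) (two n G * x * two n G')
      = E (Suc n) (\<Sum>i\<in>UNIV. \<Sum>j\<in>UNIV. cp n i j x * (two n G * e n i j * two n G'))"
    by (subst exp) (simp only: sum_distrib_left sum_distrib_right mult.assoc l)
  also have "\<dots> = (\<Sum>i\<in>UNIV. \<Sum>j\<in>UNIV. cp n i j x * sc (D $ j $ i))"
    by (simp add: E_sum E_left[OF A_mono[OF cp_A[OF x]]] e0)
  also have "\<dots> = E n (\<Sum>i\<in>UNIV. \<Sum>j\<in>UNIV. cp n i j x * e n i j)"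
    by (simp add: E_sum E_left[OF cp_A[OF x]] E_e)
  finally show ?thesis using exp by simp
qed

lemma E_conj_R: "x \<in> A (Suc n) \<Longrightarrow> E (Suc n) (Rn n * x * Rn' n) = E n x"
  by (rule E_conj[OF R_inv]) (auto simp: R_braid)

lemma E_conj_R': "x \<in> A (Suc n) \<Longrightarrow> E (Suc n) (Rn' n * x * Rn n) = E n x"
proof (rule E_conj[OF R_inv(2,1)])
  fix n
  have l: "Rn' n * (Rn n * z) = z" "Rn n * (Rn' n * z) = z" for n z
    by (simp_all only: mult.assoc[symmetric] Rn_inv mult_1_left)
  have "Rn' n * Rn' (Suc n) * (Rn n * Rn (Suc n) * Rn n) * (Rn' n * Rn' (Suc n))
      = Rn' n * Rn' (Suc n) * (Rn (Suc n) * Rn n * Rn (Suc n)) * (Rn' n * Rn' (Suc n))"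
    by (simp only: R_braid)
  then show "Rn (Suc n) * Rn' n * Rn' (Suc n) = Rn' n * Rn' (Suc n) * Rn n"
    by (simp add: mult.assoc l)
qed

text \<open>On products \<open>e n a h * Rn n * e n g b\<close> the conjugation invariance evaluates
  both sides, and by \<open>slice_span\<close> these products span all operators in the two factors.
  The version for \<open>R\<close> follows by inserting \<open>Rn n * x * Rn n\<close>.\<close>

lemma E_cyc':
  assumes x: "x \<in> A (Suc (Suc n))"
  shows "E n (E (Suc n) (Rn' n * x)) = E n (E (Suc n) (x * Rn' n))"
proof -
  have eA: "e n i j \<in> A (Suc n)" for i j by (rule e_A) simp
  have s: "E n (E (Suc n) (Rn' n * (e n a h * Rn n * e n g b))) = E n (E (Suc n) (e n a h * Rn n * e n g b * Rn' n))"
    for a h g b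
  proof -
    have "E (Suc n) (Rn' n * (e n a h * Rn n * e n g b)) = sc (D $ h $ a) * e n g b"
      using E_right[OF eA, where x = "Rn' n * e n a h * Rn n"] E_conj_R'[OF eA] by (simp add: mult.assoc E_e)
    moreover have "E (Suc n) (e n a h * Rn n * e n g b * Rn' n) = e n a h * sc (D $ b $ g)"
      using E_left[OF eA, where x = "Rn n * e n g b * Rn' n"] E_conj_R[OF eA] by (simp add: mult.assoc E_e)
    ultimately show ?thesis
      by (simp add: E_left E_right E_e)
  qed
  have sl: "e n a h * Rn n * e n g b = e n a b * slice (Suc n) h g" for a h g b
  proof -
    have comm_s: "slice (Suc n) h g * e n i j = e n i j * slice (Suc n) h g" for i j h g
      unfolding slice_def sum_distrib_left sum_distrib_right
      by (auto simp: mult.assoc e_comm[of n "Suc n"] sc_left[of "e _ _ _"] intro!: sum.cong)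
    have "e n a h * Rn n * e n g b = (\<Sum>p\<in>UNIV. \<Sum>q\<in>UNIV. e n a h * (e n p q * (e n g b * slice (Suc n) p q)))"
      by (simp add: Rn_slice sum_distrib_left sum_distrib_right mult.assoc comm_s)
    also have "\<dots> = (\<Sum>p\<in>UNIV. \<Sum>q\<in>UNIV. if h = p \<and> g = q then e n a b * slice (Suc n) p q else 0)"
      by (auto simp: e_mult_left intro!: sum.cong)
    finally show ?thesis by (simp only: sum_delta2)
  qed
  have ss: "E n (E (Suc n) (Rn' n * (e n a b * slice (Suc n) h g)))
      = E n (E (Suc n) (e n a b * slice (Suc n) h g * Rn' n))" for a b h g
    by (simp only: sl[symmetric] s)
  have ee: "E n (E (Suc n) (Rn' n * (e n a b * e (Suc n) c f))) = E n (E (Suc n) (e n a b * e (Suc n) c f * Rn' n))"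
    for a b c f
    unfolding slice_span[of "Suc n" c f]
    by (simp add: sum_distrib_left sum_distrib_right mult.assoc sc_left[of "e _ _ _"] sc_left[of "two _ _"]
        E_sum E_sca ss[unfolded mult.assoc])
  have exp: "x = (\<Sum>i\<in>UNIV. \<Sum>j\<in>UNIV. \<Sum>k\<in>UNIV. \<Sum>l\<in>UNIV. cp n k l (cp (Suc n) i j x) * (e n k l * e (Suc n) i j))"
  proof -
    have "x = (\<Sum>i\<in>UNIV. \<Sum>j\<in>UNIV. cp (Suc n) i j x * e (Suc n) i j)"
      using cp_expand[of x "Suc n"] by (simp only: cp_commute)
    also have "\<dots> = (\<Sum>i\<in>UNIV. \<Sum>j\<in>UNIV. (\<Sum>k\<in>UNIV. \<Sum>l\<in>UNIV. cp n k l (cp (Suc n) i j x) * e n k l) * e (Suc n) i j)"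
      using cp_expand[of _ n] by (simp only: cp_commute)
    finally show ?thesis by (simp only: sum_distrib_right mult.assoc)
  qed
  have mem: "cp n k l (cp (Suc n) i j x) \<in> A n" for i j k l
    by (intro cp_A x)
  have l: "Rn' n * (cp n k l (cp (Suc n) i j x) * z) = cp n k l (cp (Suc n) i j x) * (Rn' n * z)" for i j k l z
    using A_comm_two[OF mem, of n] by (simp only: mult.assoc[symmetric] order_refl)
  show ?thesis
    by (subst (1 2) exp)
      (simp add: sum_distrib_left sum_distrib_right mult.assoc l E_sum E_left[OF mem]
        E_left[OF A_mono[OF mem]] ee[unfolded mult.assoc])
qed

lemma E_cyc:
  assumes x: "x \<in> A (Suc (Suc n))"
  shows "E n (E (Suc n) (Rn n * x)) = E n (E (Suc n) (x * Rn n))"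
proof -
  have l: "Rn' n * (Rn n * z) = z" for z
    by (simp only: mult.assoc[symmetric] Rn_inv mult_1_left)
  have "Rn n * x * Rn n \<in> A (Suc (Suc n))" by (intro A_mult x two_A) auto
  from E_cyc'[OF this] show ?thesis by (simp add: mult.assoc l)
qed

end

section \<open>The tower of a quantum matrix algebra\<close>

locale qma_tower = skew_matrices sca emb e R R' \<Psi>
  for sca :: "'a::ring_1 \<Rightarrow> 'r::ring_1" and emb and e :: "nat \<Rightarrow> 'n::finite \<Rightarrow> 'n \<Rightarrow> 'r" and R R' \<Psi> +
  fixes F F' :: "('n, complex) mat2" and M :: "('n, 'a) mat1"
  assumes F_inv: "F ** F' = mat 1" "F' ** F = mat 1"
    and F_braid: "two n F * two (Suc n) F * two n F = two (Suc n) F * two n F * two (Suc n) F"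
    and RFF: "two n R * two (Suc n) F * two n F = two (Suc n) F * two n F * two (Suc n) R"
    and FFR: "two (Suc n) R * two n F * two (Suc n) F = two n F * two (Suc n) F * two n R"
    and RMM: "two 0 R * (one 0 M * (two 0 F * one 0 M * two 0 F')) = one 0 M * (two 0 F * one 0 M * two 0 F') * two 0 R"
begin

primrec Mn :: "nat \<Rightarrow> 'r" where
  "Mn 0 = one 0 M"
| "Mn (Suc n) = two n F * Mn n * two n F'"

sublocale tw: r_tower "\<lambda>c. sca (emb c)" A E "\<lambda>n. two n R" "\<lambda>n. two n R'" "\<lambda>n. two n F" "\<lambda>n. two n F'" Mn
proof
  show "A n \<subseteq> A (Suc n)" for n using A_mono[of _ n "Suc n"] by auto
  show "two n F * two n F' = 1" "two n F' * two n F = 1" for n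
    by (simp_all add: two_mult F_inv)
  show "E (Suc n) (two n F * x * two n F') = E n x" if "x \<in> A (Suc n)" for x n
    by (rule E_conj[OF F_inv FFR that])
  show "two n R \<in> A (Suc (Suc n))" "two n R' \<in> A (Suc (Suc n))"
    "two n F \<in> A (Suc (Suc n))" "two n F' \<in> A (Suc (Suc n))" for n
    by (rule two_A, simp)+
  show "two 0 R * (Mn 0 * Mn (Suc 0)) = Mn 0 * Mn (Suc 0) * two 0 R"
    using RMM by (simp only: Mn.simps)
  show "Mn 0 \<in> A (Suc 0)" by (simp add: one_A)
qed (fact sc_1 sc_add sc_mult sca_emb_central sca_A A_add A_mult E_add E_left E_right E_A
    A_comm_two Rn_inv R_braid F_braid RFF FFR Mn.simps E_R E_cyc)+

end

locale bmw_matrices = qma_tower sca emb e R R' \<Psi> F F' M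
  for sca :: "'a::ring_1 \<Rightarrow> 'r::ring_1" and emb and e :: "nat \<Rightarrow> 'n::finite \<Rightarrow> 'n \<Rightarrow> 'r" and R R' \<Psi> F F' M +
  fixes K :: "('n, complex) mat2" and lam mu :: complex and uu vv :: "'n \<times> 'n \<Rightarrow> complex"
  assumes lam_nz: "lam \<noteq> 0" and mu_nz: "mu \<noteq> 0" and skew_nz: "1 - mu\<^sup>2 + lam * mu \<noteq> 0"
    and skein: "two n R - two n R' = sc lam * (1 - two n K)"
    and RK: "two n R * two n K = sc mu * two n K"
    and LK_R: "two (Suc n) K * two n K = two n R * two (Suc n) R * two n K"
    and LK_R': "two (Suc n) K * two n K = two n R' * two (Suc n) R' * two n K"
    and KLK: "two n K * two (Suc n) K * two n K = two n K"
    and K_nz: "K \<noteq> 0"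
    and K_rank: "K $ p $ r = uu p * vv r"
begin

lemma em_diff: "em (X - Y) = em X - em Y"
  using em_add[of X "- Y"] by (simp add: em_uminus)

text \<open>Let Y be \<open>Z\<close> minus the scalar. In factor 2 it commutes with
  \<open>two 0 K\<close>, while the assumption says that it kills \<open>two 1 K\<close>; inserting
  \<open>KLK\<close> shows that its product with \<open>two 0 K\<close> vanishes. The two act in
  different factors and \<open>K\<close> is nonzero, so Y is zero.\<close>

lemma scalar_of_K:
  assumes "\<And>n. one (Suc n) (em Z) * two n K = sc z * two n K"
  shows "Z = mat z"
proof -
  let ?Y = "\<lambda>n. one n (em Z) - sc z"
  have Y: "?Y (Suc n) * two n K = 0" for n
    using assms[of n] by (simp add: left_diff_distrib)
  have Y_comm: "x * ?Y n = ?Y n * x" if "x \<in> A n" for x n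
    using A_comm_one[OF that, of n] sca_emb_central[of x z] by (simp add: left_diff_distrib right_diff_distrib)
  have K_A: "two 0 K \<in> A 2" by (rule two_A) simp
  have "two 0 K * ?Y 2 = ?Y 2 * two 0 K" by (rule Y_comm[OF K_A])
  also have "\<dots> = ?Y 2 * (two 0 K * two 1 K * two 0 K)" using KLK[of 0] by simp
  also have "\<dots> = ?Y 2 * two 0 K * two 1 K * two 0 K" by (simp only: mult.assoc)
  also have "?Y 2 * two 0 K = two 0 K * ?Y 2" by (rule Y_comm[OF K_A, symmetric])
  also have "two 0 K * ?Y 2 * two 1 K * two 0 K = two 0 K * (?Y 2 * two 1 K) * two 0 K"
    by (simp only: mult.assoc)
  also have "\<dots> = 0" using Y[of 1] by (simp add: numeral_2_eq_2)
  finally have "two 0 K * one 2 (em (Z - mat z)) = 0"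
    by (simp only: em_diff one_diff em_mat one_mat)
  then have "cp 2 i j (two 0 K * one 2 (em (Z - mat z))) = 0" for i j by simp
  then have K0: "two 0 K * sc ((Z - mat z) $ i $ j) = 0" for i j
    using cp_left[of 2 "two 0 K" i j "one 2 (em (Z - mat z))"] A_comm[OF K_A]
    by (simp add: cp_one em_def)
  have "(Z - mat z) $ i $ j = 0" for i j
  proof (rule ccontr)
    let ?c = "(Z - mat z) $ i $ j"
    assume c: "?c \<noteq> 0"
    have "sc (inverse ?c) * (sc ?c * two 0 K) = 0"
      using K0[of i j] by (simp only: sca_emb_central mult_zero_right)
    then have "two 0 K = two 0 0" unfolding sc_cancel[OF c] by (simp add: two_def mh_def em_def)
    then show False using two_inj K_nz by blast
  qed
  then have "Z - mat z = 0" by (simp add: vec_eq_iff)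
  then show ?thesis by simp
qed

text \<open>Tracing \<open>LK_R\<close> over its last factor replaces the second \<open>R\<close> by
  1 and leaves \<open>R * K\<close> on the right, which is \<mu> times \<open>K\<close>. So the
  traced \<open>K\<close> acts on \<open>K\<close> as a scalar.\<close>

lemma trD_K: "trD K = mat mu"
proof (rule scalar_of_K)
  fix n
  have mem: "two n K \<in> A (Suc (Suc n))" "two n R \<in> A (Suc (Suc n))" by (auto intro: two_A)
  have "E (Suc (Suc n)) (two (Suc n) K * two n K) = two n R * E (Suc (Suc n)) (two (Suc n) R) * two n K"
    unfolding LK_R using mem by (simp add: E_left E_right)
  then show "one (Suc n) (em (trD K)) * two n K = sc mu * two n K"
    using mem by (simp add: E_right RK E_two trD_R em_mat)
qed

lemma E_K: "E (Suc n) (two n K) = sc mu"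
  by (simp add: E_two trD_K em_mat)

lemma trD_R': "trD R' = mat (mu * mu)"
proof (rule scalar_of_K)
  fix n
  have mem: "two n K \<in> A (Suc (Suc n))" "two n R' \<in> A (Suc (Suc n))" by (auto intro: two_A)
  have "E (Suc (Suc n)) (two (Suc n) K * two n K) = two n R' * E (Suc (Suc n)) (two (Suc n) R') * two n K"
    unfolding LK_R' using mem by (simp add: E_left E_right)
  then have "sc mu * two n K = two n R' * (one (Suc n) (em (trD R')) * two n K)"
    using mem by (simp add: E_right E_two trD_K em_mat mult.assoc)
  then have "two n R * (sc mu * two n K) = one (Suc n) (em (trD R')) * two n K"
    by (simp add: two_mult R_inv mult.assoc[symmetric])
  moreover have "two n R * (sc mu * two n K) = sc (mu * mu) * two n K"
    by (simp only: sc_left[of "two n R"] RK sc_mult mult.assoc)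
  ultimately show "one (Suc n) (em (trD R')) * two n K = sc (mu * mu) * two n K" by simp
qed

lemma E_R': "E (Suc n) (two n R') = sc (mu * mu)"
  by (simp only: E_two trD_R' em_mat one_mat)

definition dd :: complex where "dd = (\<Sum>i\<in>UNIV. D $ i $ i)"

text \<open>The trace of the skein relation reads \<open>1 - mu * mu = lam * (dd - mu)\<close>, so
  \<open>lam * dd\<close> is the expression in \<open>skew_nz\<close>.\<close>

lemma dd_nz: "dd \<noteq> 0"
proof -
  have "E (Suc 0) (two 0 R) - E (Suc 0) (two 0 R') = E (Suc 0) (sc lam * (1 - two 0 K))"
    by (simp only: tw.E_diff[symmetric] skein)
  also have "\<dots> = sc lam * (E (Suc 0) 1 - E (Suc 0) (two 0 K))"
    by (simp only: E_sca tw.E_diff)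
  finally have "1 - sc (mu * mu) = sc lam * (sc dd - sc mu)"
    by (simp only: E_R E_R' E_K E_1 dd_def)
  then have "sc (1 - mu * mu) = sc (lam * (dd - mu))"
    by (simp only: tw.sc_diff sc_mult sc_1)
  then have "1 - mu * mu = lam * (dd - mu)" by (rule sc_eq)
  then show ?thesis using skew_nz by (auto simp: power2_eq_square)
qed

text \<open>The product of the two copies of \<open>M\<close> commutes with \<open>R\<close>, hence
  with \<open>K\<close>. An operator that commutes with a rank one operator acts on it as a scalar;
  here the entries lie in a noncommutative algebra, so the scalar is an element \<open>g\<close> of
  \<open>A 0\<close>.\<close>

lemma MMK: "\<exists>g\<in>A 0. Mn 0 * Mn (Suc 0) * two 0 K = two 0 K * g"
proof -
  define X where "X = Mn 0 * Mn (Suc 0)"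
  have X_A: "X \<in> A (Suc (Suc 0))" unfolding X_def by (intro A_mult tw.M_mem) auto
  have XR: "two 0 R * X = X * two 0 R" unfolding X_def using tw.RMM_0 by simp
  then have XR': "two 0 R' * X = X * two 0 R'"
    by (rule tw.commute_inverse[OF tw.RR' tw.R'R])
  have "sc lam * (1 - two 0 K) * X = X * (sc lam * (1 - two 0 K))"
    unfolding skein[symmetric] using XR XR' by (simp add: left_diff_distrib right_diff_distrib)
  then have "sc lam * ((1 - two 0 K) * X) = sc lam * (X * (1 - two 0 K))"
    by (simp only: mult.assoc sc_left[of X])
  then have "sc (inverse lam) * (sc lam * ((1 - two 0 K) * X)) = sc (inverse lam) * (sc lam * (X * (1 - two 0 K)))"
    by simp
  then have KX: "two 0 K * X = X * two 0 K"
    unfolding sc_cancel[OF lam_nz] by (simp add: left_diff_distrib right_diff_distrib)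
  have "\<exists>p. uu p \<noteq> 0"
    using K_nz K_rank by (auto simp: vec_eq_iff)
  then obtain p0 where p0: "uu p0 \<noteq> 0" by auto
  define co where "co p r = cp 0 (fst p) (fst r) (cp (Suc 0) (snd p) (snd r) X)" for p r
  have co_A: "co p r \<in> A 0" for p r unfolding co_def by (intro cp_A X_A)
  have X_co: "cp 0 (fst p) (fst r) (cp (Suc 0) (snd p) (snd r) (\<Sum>a\<in>UNIV. \<Sum>b\<in>UNIV. co' a b * ee 0 a b)) = co' p r"
    if "\<And>a b. co' a b \<in> A 0" for co' p r
  proof -
    have "e m i j * co' a b = co' a b * e m i j" for m i j a b
      using A_comm[OF that] by simp
    then have "cp 0 (fst p) (fst r) (cp (Suc 0) (snd p) (snd r) (\<Sum>a\<in>UNIV. \<Sum>b\<in>UNIV. co' a b * ee 0 a b))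
      = (\<Sum>a\<in>UNIV. \<Sum>b\<in>UNIV. co' a b * cp 0 (fst p) (fst r) (cp (Suc 0) (snd p) (snd r) (ee 0 a b)))"
      by (simp add: cp_sum cp_left)
    also have "\<dots> = (\<Sum>a\<in>UNIV. \<Sum>b\<in>UNIV. if p = a \<and> r = b then co' a b else 0)"
      by (intro sum.cong[OF HOL.refl]) (auto simp: cp_ee)
    finally show ?thesis by (simp only: sum_delta2)
  qed
  have X_eq: "X = (\<Sum>p\<in>UNIV. \<Sum>r\<in>UNIV. co p r * ee 0 p r)"
  proof -
    have "X = (\<Sum>k\<in>UNIV. \<Sum>l\<in>UNIV. \<Sum>i\<in>UNIV. \<Sum>j\<in>UNIV. co (i, k) (j, l) * (e 0 i j * e (Suc 0) k l))"
    proof -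
      have "X = (\<Sum>k\<in>UNIV. \<Sum>l\<in>UNIV. cp (Suc 0) k l X * e (Suc 0) k l)"
        using cp_expand[of X "Suc 0"] by (simp only: cp_commute)
      also have "\<dots> = (\<Sum>k\<in>UNIV. \<Sum>l\<in>UNIV. (\<Sum>i\<in>UNIV. \<Sum>j\<in>UNIV. co (i, k) (j, l) * e 0 i j) * e (Suc 0) k l)"
        using cp_expand[of _ 0] by (simp only: cp_commute co_def fst_conv snd_conv)
      finally show ?thesis by (simp only: sum_distrib_right mult.assoc)
    qed
    also have "\<dots> = (\<Sum>k\<in>UNIV. \<Sum>i\<in>UNIV. \<Sum>l\<in>UNIV. \<Sum>j\<in>UNIV. co (i, k) (j, l) * (e 0 i j * e (Suc 0) k l))"
      by (rule sum.cong[OF HOL.refl], rule sum.swap)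
    also have "\<dots> = (\<Sum>k\<in>UNIV. \<Sum>i\<in>UNIV. \<Sum>j\<in>UNIV. \<Sum>l\<in>UNIV. co (i, k) (j, l) * (e 0 i j * e (Suc 0) k l))"
      by (rule sum.cong[OF HOL.refl], rule sum.cong[OF HOL.refl], rule sum.swap)
    also have "\<dots> = (\<Sum>i\<in>UNIV. \<Sum>k\<in>UNIV. \<Sum>j\<in>UNIV. \<Sum>l\<in>UNIV. co (i, k) (j, l) * (e 0 i j * e (Suc 0) k l))"
      by (rule sum.swap)
    finally show ?thesis by (simp only: sum_UNIV_prod ee_def fst_conv snd_conv)
  qed
  \<comment> \<open>\<open>K\<close> is a column \<open>uu\<close> times a row \<open>vv\<close>;
    \<rho> is the row \<open>vv\<close> times \<open>X\<close>, and \<sigma> is \<open>X\<close>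
    times the column \<open>uu\<close>. Commutation then says
    \<open>uu p * \<rho> r = \<sigma> p * vv r\<close> for all entries.\<close>
  define \<rho> where "\<rho> r = (\<Sum>s\<in>UNIV. sc (vv s) * co s r)" for r
  define \<sigma> where "\<sigma> p = (\<Sum>s\<in>UNIV. co p s * sc (uu s))" for p
  have \<rho>\<sigma>_A: "\<rho> r \<in> A 0" "\<sigma> r \<in> A 0" for r
    unfolding \<rho>_def \<sigma>_def by (auto intro!: A_sum A_mult co_A)
  have K_eq: "two 0 K = (\<Sum>p\<in>UNIV. \<Sum>r\<in>UNIV. sc (uu p * vv r) * ee 0 p r)"
    by (simp add: two_def mh_def em_def K_rank)
  have ee_co: "ee 0 p r * co a b = co a b * ee 0 p r" for p r a b
    using A_comm[OF co_A] A_comm_left[OF co_A] by (simp add: ee_def mult.assoc)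
  have prod: "(\<Sum>p\<in>UNIV. \<Sum>r\<in>UNIV. f p r * ee 0 p r) * (\<Sum>p\<in>UNIV. \<Sum>r\<in>UNIV. h p r * ee 0 p r)
      = (\<Sum>p\<in>UNIV. \<Sum>r\<in>UNIV. (\<Sum>s\<in>UNIV. f p s * h s r) * ee 0 p r)"
    if h: "\<And>p r a b. ee 0 p r * h a b = h a b * ee 0 p r" for f h
  proof -
    have 1: "(\<Sum>p\<in>UNIV. \<Sum>r\<in>UNIV. f p r * ee 0 p r) * z = (\<Sum>p\<in>UNIV. \<Sum>s\<in>UNIV. f p s * ee 0 p s * z)" for z
      by (simp only: sum_distrib_right)
    have 2: "f p s * ee 0 p s * (\<Sum>t\<in>UNIV. \<Sum>r\<in>UNIV. h t r * ee 0 t r) = (\<Sum>r\<in>UNIV. f p s * h s r * ee 0 p r)" for p s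
    proof -
      have "f p s * ee 0 p s * (h t r * ee 0 t r) = (if s = t then f p s * h t r * ee 0 p r else 0)" for t r
      proof -
        have "ee 0 p s * (h t r * ee 0 t r) = h t r * (ee 0 p s * ee 0 t r)"
          by (simp only: mult.assoc[symmetric] h)
        then show ?thesis by (simp add: ee_mult mult.assoc)
      qed
      then have "f p s * ee 0 p s * (\<Sum>t\<in>UNIV. \<Sum>r\<in>UNIV. h t r * ee 0 t r)
          = (\<Sum>t\<in>UNIV. \<Sum>r\<in>UNIV. if s = t then f p s * h t r * ee 0 p r else 0)"
        by (simp only: sum_distrib_left)
      also have "\<dots> = (\<Sum>t\<in>UNIV. if s = t then (\<Sum>r\<in>UNIV. f p s * h t r * ee 0 p r) else 0)"
        by (intro sum.cong[OF HOL.refl]) simp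
      finally show ?thesis by simp
    qed
    have "(\<Sum>p\<in>UNIV. \<Sum>r\<in>UNIV. f p r * ee 0 p r) * (\<Sum>p\<in>UNIV. \<Sum>r\<in>UNIV. h p r * ee 0 p r)
        = (\<Sum>p\<in>UNIV. \<Sum>s\<in>UNIV. \<Sum>r\<in>UNIV. f p s * h s r * ee 0 p r)"
      by (subst 1) (simp only: 2)
    also have "\<dots> = (\<Sum>p\<in>UNIV. \<Sum>r\<in>UNIV. \<Sum>s\<in>UNIV. f p s * h s r * ee 0 p r)"
      by (rule sum.cong[OF HOL.refl], rule sum.swap)
    finally show ?thesis by (simp only: sum_distrib_right)
  qed
  have KX_eq: "two 0 K * X = (\<Sum>p\<in>UNIV. \<Sum>r\<in>UNIV. (sc (uu p) * \<rho> r) * ee 0 p r)"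
    unfolding K_eq
    by (subst X_eq, subst prod, rule ee_co) (simp only: \<rho>_def sum_distrib_left sc_mult mult.assoc)
  have XK_eq: "X * two 0 K = (\<Sum>p\<in>UNIV. \<Sum>r\<in>UNIV. (\<sigma> p * sc (vv r)) * ee 0 p r)"
    unfolding K_eq
    by (subst X_eq, subst prod, rule ee_sca) (simp only: \<sigma>_def sum_distrib_right sc_mult mult.assoc)
  have eq: "sc (uu p) * \<rho> r = \<sigma> p * sc (vv r)" for p r
  proof -
    have "sc (uu p) * \<rho> r = cp 0 (fst p) (fst r) (cp (Suc 0) (snd p) (snd r) (two 0 K * X))"
      unfolding KX_eq by (rule X_co[symmetric]) (intro A_mult sca_A \<rho>\<sigma>_A)
    also have "\<dots> = \<sigma> p * sc (vv r)"
      unfolding KX XK_eq by (rule X_co) (intro A_mult sca_A \<rho>\<sigma>_A)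
    finally show ?thesis .
  qed
  \<comment> \<open>The factor that relates \<sigma> to \<open>uu\<close>, read off at an index
    where \<open>uu\<close> does not vanish.\<close>
  define g where "g = sc (inverse (uu p0)) * \<sigma> p0"
  have "\<rho> r = sc (vv r) * g" for r
  proof -
    have "\<rho> r = sc (inverse (uu p0)) * (sc (uu p0) * \<rho> r)" by (simp only: sc_cancel[OF p0])
    also have "\<dots> = sc (inverse (uu p0)) * \<sigma> p0 * sc (vv r)" by (simp only: eq mult.assoc)
    finally show ?thesis by (simp only: g_def sca_emb_central[of "sc (inverse (uu p0)) * \<sigma> p0"])
  qed
  then have KX_g: "two 0 K * X = (\<Sum>p\<in>UNIV. \<Sum>r\<in>UNIV. (sc (uu p) * (sc (vv r) * g)) * ee 0 p r)"
    unfolding KX_eq by simp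
  have g_A: "g \<in> A 0" unfolding g_def by (intro A_mult sca_A \<rho>\<sigma>_A)
  have "g * ee 0 p r = ee 0 p r * g" for p r
    using A_comm[OF g_A] A_comm_left[OF g_A] by (simp add: ee_def mult.assoc)
  then have "two 0 K * g = (\<Sum>p\<in>UNIV. \<Sum>r\<in>UNIV. (sc (uu p) * (sc (vv r) * g)) * ee 0 p r)"
    unfolding K_eq by (simp only: sum_distrib_right sc_mult mult.assoc)
  then have "X * two 0 K = two 0 K * g" using KX KX_g by simp
  then show ?thesis using g_A unfolding X_def by blast
qed

definition gg :: 'r where "gg = (SOME g. g \<in> A 0 \<and> Mn 0 * Mn (Suc 0) * two 0 K = two 0 K * g)"

sublocale bt: bmw_tower "\<lambda>c. sca (emb c)" A E "\<lambda>n. two n R" "\<lambda>n. two n R'" "\<lambda>n. two n F" "\<lambda>n. two n F'" Mn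
  "\<lambda>n. two n K" lam mu dd gg
proof
  let ?P = "\<lambda>g. g \<in> A 0 \<and> Mn 0 * Mn (Suc 0) * two 0 K = two 0 K * g"
  obtain g where "?P g" using MMK by blast
  then have "?P gg" unfolding gg_def by (rule someI[of ?P])
  then show "gg \<in> A 0" "Mn 0 * Mn (Suc 0) * two 0 K = two 0 K * gg" by blast+
qed (rule lam_nz mu_nz dd_nz skein RK LK_R LK_R' KLK E_K E_1[folded dd_def])+

end

section \<open>Operators on tensor powers\<close>

definition words :: "nat \<Rightarrow> 'n::finite list set" where "words n = {a. length a = n}"

lemma finite_words [simp]: "finite (words n)"
  using finite_lists_length_eq[OF finite_class.finite_UNIV, of n] by (simp add: words_def)

lemma words_0 [simp]: "words 0 = {[]}"
  by (auto simp: words_def)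

lemma in_words: "a \<in> words n \<longleftrightarrow> length a = n"
  by (simp add: words_def)

lemma sum_words_Suc: "(\<Sum>a\<in>words (Suc n). f a) = (\<Sum>x\<in>UNIV. \<Sum>a\<in>words n. f (x # a))"
proof -
  have 1: "words (Suc n) = (\<lambda>(x, a). x # a) ` (UNIV \<times> words n)"
    by (auto simp: words_def length_Suc_conv image_iff)
  have 2: "inj_on (\<lambda>(x, a). x # a) (UNIV \<times> words n)" by (auto simp: inj_on_def)
  have "(\<Sum>a\<in>words (Suc n). f a) = (\<Sum>(x, a)\<in>UNIV \<times> words n. f (x # a))"
    unfolding 1 sum.reindex[OF 2] by (simp add: case_prod_unfold)
  then show ?thesis by (simp add: sum.cartesian_product)
qed

lemma sum_words_snoc: "(\<Sum>a\<in>words (Suc n). f a) = (\<Sum>a\<in>words n. \<Sum>x\<in>UNIV. f (a @ [x]))"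
proof -
  have 1: "words (Suc n) = (\<lambda>(a, x). a @ [x]) ` (words n \<times> UNIV)"
    by (auto simp: words_def length_Suc_conv_rev image_iff)
  have 2: "inj_on (\<lambda>(a, x). a @ [x]) (words n \<times> UNIV)" by (auto simp: inj_on_def)
  have "(\<Sum>a\<in>words (Suc n). f a) = (\<Sum>(a, x)\<in>words n \<times> UNIV. f (a @ [x]))"
    unfolding 1 sum.reindex[OF 2] by (simp add: case_prod_unfold)
  then show ?thesis by (simp add: sum.cartesian_product)
qed

context matrix_units
begin

fun ep :: "nat \<Rightarrow> 'n list \<Rightarrow> 'n list \<Rightarrow> 'r" where
  "ep m (x # a) (y # b) = e m x y * ep (Suc m) a b"
| "ep m _ _ = 1"

lemma ep_e_comm: "m < k \<Longrightarrow> e m x y * ep k a b = ep k a b * e m x y"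
proof (induction k a b rule: ep.induct)
  case (1 k u a v b)
  then have "e m x y * (e k u v * z) = e k u v * (e m x y * z)" for z
    by (simp add: e_comm[of m k] flip: mult.assoc)
  then show ?case using 1 by (simp add: mult.assoc)
qed simp_all

lemma ep_sca: "ep m a b * sca c = sca c * ep m a b"
proof (induction m a b rule: ep.induct)
  case (1 m x a y b)
  have "e m x y * (sca c * z) = sca c * (e m x y * z)" for z
    by (simp add: sca_e flip: mult.assoc)
  then show ?case using 1 by (simp add: mult.assoc)
qed simp_all

lemma ep_mult:
  "length a = n \<Longrightarrow> length b = n \<Longrightarrow> length c = n \<Longrightarrow> length d = n \<Longrightarrow>
    ep m a b * ep m c d = (if b = c then ep m a d else 0)"
proof (induction n arbitrary: m a b c d)
  case (Suc n)
  obtain x a' y b' z c' w d' where eq: "a = x # a'" "b = y # b'" "c = z # c'" "d = w # d'"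
    using Suc.prems by (meson length_Suc_conv)
  have c: "ep (Suc m) a' b' * e m z w = e m z w * ep (Suc m) a' b'"
    by (rule ep_e_comm[symmetric]) simp
  have "ep m a b * ep m c d = e m x y * (ep (Suc m) a' b' * e m z w) * ep (Suc m) c' d'"
    by (simp add: eq mult.assoc)
  also have "\<dots> = e m x y * e m z w * (ep (Suc m) a' b' * ep (Suc m) c' d')"
    by (simp only: c mult.assoc)
  finally show ?case using Suc.prems Suc.IH[of a' b' c' d' "Suc m"] by (auto simp: eq e_mult)
qed simp

lemma ep_sum: "(\<Sum>a\<in>words n. ep m a a) = 1"
proof (induction n arbitrary: m)
  case (Suc n)
  then show ?case by (simp add: sum_words_Suc sum_distrib_left[symmetric] e_sum)
qed simp

lemma ep_snoc:
  "length a = length b \<Longrightarrow> ep m (a @ [x]) (b @ [y]) = ep m a b * e (m + length a) x y"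
  by (induction a b arbitrary: m rule: list_induct2) (simp_all add: mult.assoc)

text \<open>The bridge from operators given by entries to the ring: it is multiplicative and places
  an operator on \<open>n\<close> factors at \<open>m\<close>, ..., \<open>m + n - 1\<close>. The
  offset lets a relation stated on three factors hold at every position
  (\<open>three_identity\<close>).\<close>

definition op :: "nat \<Rightarrow> nat \<Rightarrow> ('n, 'a) tensor_op \<Rightarrow> 'r" where
  "op m n X = (\<Sum>a\<in>words n. \<Sum>b\<in>words n. sca (X a b) * ep m a b)"

lemma op_cong: "(\<And>a b. length a = n \<Longrightarrow> length b = n \<Longrightarrow> X a b = Y a b) \<Longrightarrow> op m n X = op m n Y"
  unfolding op_def by (intro sum.cong[OF HOL.refl]) (simp add: in_words)

lemma op_mult: "op m n (tmult n X Y) = op m n X * op m n Y"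
proof -
  have 1: "op m n X * z = (\<Sum>a\<in>words n. \<Sum>b\<in>words n. sca (X a b) * ep m a b * z)" for z
    by (simp only: op_def sum_distrib_right)
  have 2: "sca (X a b) * ep m a b * op m n Y = (\<Sum>d\<in>words n. sca (X a b * Y b d) * ep m a d)"
    if ab: "a \<in> words n" "b \<in> words n" for a b
  proof -
    have eq: "sca (X a b) * ep m a b * (sca (Y c d) * ep m c d) =
        (if c = b then sca (X a b * Y b d) * ep m a d else 0)" if cd: "c \<in> words n" "d \<in> words n" for c d
    proof -
      have "sca (X a b) * ep m a b * (sca (Y c d) * ep m c d)
          = sca (X a b) * (ep m a b * sca (Y c d)) * ep m c d" by (simp only: mult.assoc)
      also have "\<dots> = sca (X a b * Y c d) * (ep m a b * ep m c d)"
        by (simp only: ep_sca sca_mult mult.assoc)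
      finally show ?thesis using ep_mult[of a n b c d m] ab cd by (auto simp: in_words)
    qed
    have "sca (X a b) * ep m a b * op m n Y
        = (\<Sum>c\<in>words n. \<Sum>d\<in>words n. sca (X a b) * ep m a b * (sca (Y c d) * ep m c d))"
      by (simp only: op_def sum_distrib_left)
    also have "\<dots> = (\<Sum>c\<in>words n. \<Sum>d\<in>words n. if c = b then sca (X a b * Y b d) * ep m a d else 0)"
      by (intro sum.cong[OF HOL.refl] eq)
    also have "\<dots> = (\<Sum>c\<in>words n. if c = b then \<Sum>d\<in>words n. sca (X a b * Y b d) * ep m a d else 0)"
      by (intro sum.cong[OF HOL.refl]) simp
    finally show ?thesis using ab by simp
  qed
  have "op m n X * op m n Y = (\<Sum>a\<in>words n. \<Sum>b\<in>words n. \<Sum>d\<in>words n. sca (X a b * Y b d) * ep m a d)"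
    by (subst 1) (intro sum.cong[OF HOL.refl] 2)
  also have "\<dots> = (\<Sum>a\<in>words n. \<Sum>d\<in>words n. \<Sum>b\<in>words n. sca (X a b * Y b d) * ep m a d)"
    by (rule sum.cong[OF HOL.refl], rule sum.swap)
  also have "\<dots> = op m n (tmult n X Y)"
    by (simp only: op_def tmult_def words_def sca_sum sum_distrib_right)
  finally show ?thesis ..
qed

lemma op_tid: "op m n (tid n) = 1"
proof -
  have "(\<Sum>b\<in>words n. sca (tid n a b) * ep m a b) = ep m a a" if "a \<in> words n" for a
  proof -
    have "(\<Sum>b\<in>words n. sca (tid n a b) * ep m a b) = (\<Sum>b\<in>words n. if b = a then ep m a a else 0)"
      using that by (intro sum.cong[OF HOL.refl]) (auto simp: tid_def in_words)
    then show ?thesis using that by simp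
  qed
  then show ?thesis by (simp add: op_def ep_sum)
qed

lemma op_tprod: "op m n (tprod n Xs) = prod_list (map (op m n) Xs)"
  by (induction Xs) (simp_all add: tprod_def op_tid op_mult)

lemma op_diag:
  assumes "\<And>x y a b. length a = n \<Longrightarrow> length b = n \<Longrightarrow> X (x # a) (y # b) = (if x = y then Y a b else 0)"
  shows "op m (Suc n) X = op (Suc m) n Y"
proof -
  have "op m (Suc n) X = (\<Sum>x\<in>UNIV. \<Sum>a\<in>words n. \<Sum>y\<in>UNIV. \<Sum>b\<in>words n.
      if x = y then e m x x * (sca (Y a b) * ep (Suc m) a b) else 0)"
    unfolding op_def sum_words_Suc
  proof (intro sum.cong[OF HOL.refl])
    fix x y :: 'n and a b :: "'n list"
    assume "a \<in> words n" "b \<in> words n"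
    then show "sca (X (x # a) (y # b)) * ep m (x # a) (y # b)
      = (if x = y then e m x x * (sca (Y a b) * ep (Suc m) a b) else 0)"
      using assms[of a b x y] by (simp add: in_words sca_e flip: mult.assoc)
  qed
  also have "\<dots> = (\<Sum>x\<in>UNIV. \<Sum>a\<in>words n. \<Sum>b\<in>words n. e m x x * (sca (Y a b) * ep (Suc m) a b))"
  proof (intro sum.cong[OF HOL.refl])
    fix x :: 'n and a :: "'n list"
    have "(\<Sum>y\<in>UNIV. \<Sum>b\<in>words n. if x = y then e m x x * (sca (Y a b) * ep (Suc m) a b) else 0)
        = (\<Sum>y\<in>UNIV. if x = y then \<Sum>b\<in>words n. e m x x * (sca (Y a b) * ep (Suc m) a b) else 0)"
      by (intro sum.cong[OF HOL.refl]) simp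
    then show "(\<Sum>y\<in>UNIV. \<Sum>b\<in>words n. if x = y then e m x x * (sca (Y a b) * ep (Suc m) a b) else 0)
        = (\<Sum>b\<in>words n. e m x x * (sca (Y a b) * ep (Suc m) a b))" by simp
  qed
  also have "\<dots> = (\<Sum>x\<in>UNIV. e m x x) * op (Suc m) n Y"
    by (simp only: sum_distrib_right) (simp only: op_def sum_distrib_left)
  finally show ?thesis by (simp add: e_sum)
qed

lemma op_head:
  assumes "\<And>x y a b. length a = n \<Longrightarrow> length b = n \<Longrightarrow> X (x # a) (y # b) = (if a = b then Y $ x $ y else 0)"
  shows "op m (Suc n) X = one m Y"
proof -
  have "op m (Suc n) X = (\<Sum>x\<in>UNIV. \<Sum>a\<in>words n. \<Sum>y\<in>UNIV. \<Sum>b\<in>words n.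
      if a = b then sca (Y $ x $ y) * (e m x y * ep (Suc m) a b) else 0)"
    unfolding op_def sum_words_Suc
    by (intro sum.cong[OF HOL.refl]) (use assms in \<open>simp add: in_words\<close>)
  also have "\<dots> = (\<Sum>x\<in>UNIV. \<Sum>a\<in>words n. \<Sum>y\<in>UNIV. sca (Y $ x $ y) * (e m x y * ep (Suc m) a a))"
    by (intro sum.cong[OF HOL.refl]) simp
  also have "\<dots> = (\<Sum>x\<in>UNIV. \<Sum>y\<in>UNIV. \<Sum>a\<in>words n. sca (Y $ x $ y) * (e m x y * ep (Suc m) a a))"
    by (rule sum.cong[OF HOL.refl], rule sum.swap)
  finally show ?thesis
    by (simp add: one_def mh_def sum_distrib_left[symmetric] ep_sum)
qed

lemma op_head2:
  assumes "\<And>x x' y y' a b. length a = n \<Longrightarrow> length b = n \<Longrightarrow>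
    X (x # x' # a) (y # y' # b) = (if a = b then Y $ (x, x') $ (y, y') else 0)"
  shows "op m (Suc (Suc n)) X = mh (ee m) Y"
proof -
  have "op m (Suc (Suc n)) X = (\<Sum>x\<in>UNIV. \<Sum>x'\<in>UNIV. \<Sum>a\<in>words n. \<Sum>y\<in>UNIV. \<Sum>y'\<in>UNIV. \<Sum>b\<in>words n.
      if a = b then sca (Y $ (x, x') $ (y, y')) * (e m x y * (e (Suc m) x' y' * ep (Suc (Suc m)) a b)) else 0)"
    unfolding op_def sum_words_Suc
    by (intro sum.cong[OF HOL.refl]) (use assms in \<open>simp add: in_words\<close>)
  also have "\<dots> = (\<Sum>x\<in>UNIV. \<Sum>x'\<in>UNIV. \<Sum>a\<in>words n. \<Sum>y\<in>UNIV. \<Sum>y'\<in>UNIV.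
      sca (Y $ (x, x') $ (y, y')) * (e m x y * (e (Suc m) x' y' * ep (Suc (Suc m)) a a)))"
    by (intro sum.cong[OF HOL.refl]) simp
  also have "\<dots> = (\<Sum>x\<in>UNIV. \<Sum>x'\<in>UNIV. \<Sum>y\<in>UNIV. \<Sum>a\<in>words n. \<Sum>y'\<in>UNIV.
      sca (Y $ (x, x') $ (y, y')) * (e m x y * (e (Suc m) x' y' * ep (Suc (Suc m)) a a)))"
    by (rule sum.cong[OF HOL.refl], rule sum.cong[OF HOL.refl], rule sum.swap)
  also have "\<dots> = (\<Sum>x\<in>UNIV. \<Sum>x'\<in>UNIV. \<Sum>y\<in>UNIV. \<Sum>y'\<in>UNIV. \<Sum>a\<in>words n.
      sca (Y $ (x, x') $ (y, y')) * (e m x y * (e (Suc m) x' y' * ep (Suc (Suc m)) a a)))"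
    by (rule sum.cong[OF HOL.refl], rule sum.cong[OF HOL.refl], rule sum.cong[OF HOL.refl], rule sum.swap)
  finally show ?thesis
    by (simp add: mh_def ee_def sum_UNIV_prod sum_distrib_left[symmetric] ep_sum)
qed

lemma op_act1: "k < n \<Longrightarrow> op m n (act1 X k n) = one (m + k) X"
proof (induction k arbitrary: m n)
  case 0
  then obtain n' where n: "n = Suc n'" by (cases n) auto
  show ?case unfolding n
    by (subst op_head[where Y = X]) (auto simp: act1_def list_eq_iff_nth_eq All_less_Suc2)
next
  case (Suc k)
  then obtain n' where n: "n = Suc n'" "k < n'" by (cases n) auto
  have "op m (Suc n') (act1 X (Suc k) (Suc n')) = op (Suc m) n' (act1 X k n')"
  proof (rule op_diag)
    fix x y :: 'n and a b :: "'n list"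
    assume "length a = n'" "length b = n'"
    then show "act1 X (Suc k) (Suc n') (x # a) (y # b) = (if x = y then act1 X k n' a b else 0)"
      by (auto simp: act1_def All_less_Suc2)
  qed
  then show ?case using Suc.IH[OF n(2), of "Suc m"] n by simp
qed

abbreviation lft :: "('n, complex) tensor_op \<Rightarrow> ('n, 'a) tensor_op" where
  "lft X \<equiv> (\<lambda>a b. emb (X a b))"

lemma op_adj: "Suc k < n \<Longrightarrow> op m n (lft (adj X k n)) = two (m + k) X"
proof (induction k arbitrary: m n)
  case 0
  then have "n = Suc (Suc (n - 2))" by simp
  then obtain n' where n: "n = Suc (Suc n')" by blast
  show ?case unfolding n two_def
  proof (subst op_head2[where Y = "em X"])
    fix x x' y y' :: 'n and a b :: "'n list"
    assume "length a = n'" "length b = n'"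
    then show "lft (adj X 0 (Suc (Suc n'))) (x # x' # a) (y # y' # b)
      = (if a = b then em X $ (x, x') $ (y, y') else 0)"
      by (auto simp: act2_def em_def list_eq_iff_nth_eq All_less_Suc2)
  qed simp
next
  case (Suc k)
  then obtain n' where n: "n = Suc n'" "Suc k < n'" by (cases n) auto
  have "op m (Suc n') (lft (adj X (Suc k) (Suc n'))) = op (Suc m) n' (lft (adj X k n'))"
  proof (rule op_diag)
    fix x y :: 'n and a b :: "'n list"
    assume "length a = n'" "length b = n'"
    then show "lft (adj X (Suc k) (Suc n')) (x # a) (y # b) = (if x = y then lft (adj X k n') a b else 0)"
      by (auto simp: act2_def All_less_Suc2)
  qed
  then show ?case using Suc.IH[OF n(2), of "Suc m"] n by simp
qed

lemma lft_tmult: "lft (tmult n X Y) = tmult n (lft X) (lft Y)"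
  by (intro HOL.ext) (simp add: tmult_def emb_sum)

lemma lft_tid: "lft (tid n) = tid n"
  by (intro HOL.ext) (auto simp: tid_def)

lemma lft_tprod: "lft (tprod n Xs) = tprod n (map (\<lambda>X. lft X) Xs)"
proof (induction Xs)
  case Nil
  show ?case using lft_tid by (simp add: tprod_def)
next
  case (Cons X Xs)
  have "lft (tprod n (X # Xs)) = lft (tmult n X (tprod n Xs))" by (simp add: tprod_def)
  also have "\<dots> = tmult n (lft X) (lft (tprod n Xs))" by (rule lft_tmult)
  also have "lft (tprod n Xs) = tprod n (map (\<lambda>X. lft X) Xs)" by (rule Cons.IH)
  finally show ?case by (simp add: tprod_def)
qed

lemma op_lft_tprod: "op m n (lft (tprod n Xs)) = prod_list (map (\<lambda>X. op m n (lft X)) Xs)"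
  unfolding lft_tprod op_tprod by (simp add: comp_def)

lemma three_identity:
  assumes "tprod 3 (map (\<lambda>(X, k). adj X k 3) Xs) = tprod 3 (map (\<lambda>(X, k). adj X k 3) Ys)"
    and "\<forall>(X, k) \<in> set Xs \<union> set Ys. k < 2"
  shows "prod_list (map (\<lambda>(X, k). two (m + k) X) Xs) = prod_list (map (\<lambda>(X, k). two (m + k) X) Ys)"
proof -
  have eq: "op m 3 (lft (tprod 3 (map (\<lambda>(X, k). adj X k 3) Zs))) = prod_list (map (\<lambda>(X, k). two (m + k) X) Zs)"
    if "\<forall>(X, k) \<in> set Zs. k < 2" for Zs
    unfolding op_lft_tprod using that
    by (intro arg_cong[of _ _ prod_list]) (auto simp: op_adj)
  have "prod_list (map (\<lambda>(X, k). two (m + k) X) Xs) = op m 3 (lft (tprod 3 (map (\<lambda>(X, k). adj X k 3) Xs)))"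
    by (rule eq[symmetric]) (use assms(2) in auto)
  also have "\<dots> = prod_list (map (\<lambda>(X, k). two (m + k) X) Ys)"
    unfolding assms(1) by (rule eq) (use assms(2) in auto)
  finally show ?thesis .
qed

lemma T_sum: "T n (\<Sum>x\<in>I. f x) = (\<Sum>x\<in>I. T n (f x))"
proof -
  have "T n 0 = 0" by (simp add: T_def)
  then show ?thesis by (induction I rule: infinite_finite_induct) (auto simp: T_add)
qed

lemma T_e: "T n (e n x y) = (if x = y then 1 else 0)"
proof -
  have "T n (e n x y) = (\<Sum>i\<in>UNIV. if x = i then if x = y then 1 else 0 else 0)"
    unfolding T_def by (intro sum.cong[OF HOL.refl]) (auto simp: cp_e)
  then show ?thesis by simp
qed

lemma ep_A: "length a = n \<Longrightarrow> length b = n \<Longrightarrow> ep m a b \<in> A (m + n)"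
proof (induction n arbitrary: m a b)
  case (Suc n)
  then obtain x a' y b' where "a = x # a'" "b = y # b'" by (meson length_Suc_conv)
  then show ?case using Suc e_A[of m "m + Suc n" x y] Suc.IH[of a' b' "Suc m"] by (simp add: A_mult)
qed simp

lemma T_op: "T n (op 0 (Suc n) X) = op 0 n (\<lambda>a b. \<Sum>i\<in>UNIV. X (a @ [i]) (b @ [i]))"
proof -
  have Tx: "T n (sca c * ep 0 (a @ [x]) (b @ [y])) = (if x = y then sca c * ep 0 a b else 0)"
    if ab: "a \<in> words n" "b \<in> words n" for a b c x y
  proof -
    have "sca c * ep 0 a b \<in> A n" using ab ep_A[of a n b 0] by (simp add: A_mult in_words)
    then have "T n (sca c * ep 0 a b * e n x y) = sca c * ep 0 a b * T n (e n x y)" by (rule T_left)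
    then show ?thesis using ab by (simp add: ep_snoc in_words T_e mult.assoc)
  qed
  have "T n (op 0 (Suc n) X) = (\<Sum>a\<in>words n. \<Sum>x\<in>UNIV. \<Sum>b\<in>words n. \<Sum>y\<in>UNIV.
      if x = y then sca (X (a @ [x]) (b @ [y])) * ep 0 a b else 0)"
    unfolding op_def sum_words_snoc T_sum by (intro sum.cong[OF HOL.refl] Tx)
  also have "\<dots> = (\<Sum>a\<in>words n. \<Sum>x\<in>UNIV. \<Sum>b\<in>words n. sca (X (a @ [x]) (b @ [x])) * ep 0 a b)"
    by (intro sum.cong[OF HOL.refl]) simp
  also have "\<dots> = (\<Sum>a\<in>words n. \<Sum>b\<in>words n. \<Sum>x\<in>UNIV. sca (X (a @ [x]) (b @ [x])) * ep 0 a b)"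
    by (rule sum.cong[OF HOL.refl], rule sum.swap)
  finally show ?thesis by (simp only: op_def sca_sum sum_distrib_right)
qed

definition Tr :: "nat \<Rightarrow> nat \<Rightarrow> 'r \<Rightarrow> 'r" where "Tr m n x = foldr T [m..<n] x"

lemma Tr_op: "Tr k (k + n) (op 0 (k + n) X) = op 0 k (\<lambda>a b. \<Sum>c\<in>words n. X (a @ c) (b @ c))"
proof (induction n arbitrary: X)
  case (Suc n)
  have "Tr k (k + Suc n) (op 0 (k + Suc n) X) = Tr k (k + n) (T (k + n) (op 0 (Suc (k + n)) X))"
    by (simp add: Tr_def)
  then show ?case by (simp add: T_op Suc.IH sum_words_snoc)
qed (simp add: Tr_def)

end

context skew_matrices
begin

text \<open>The defined traces first multiply by \<open>D\<close> in all factors and then sum,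
  whereas the tower does both factor by factor; the \<open>D\<close> of earlier factors pass through
  the trace over a later one.\<close>

lemma Tr_D:
  "m \<le> n \<Longrightarrow> foldr E [m..<n] x = Tr m n (prod_list (map (\<lambda>k. one k (em D)) [m..<n]) * x)"
proof (induction n arbitrary: x)
  case (Suc n)
  show ?case
  proof (cases "m = Suc n")
    case False
    let ?D = "\<lambda>n. prod_list (map (\<lambda>k. one k (em D)) [m..<n])"
    have mn: "m \<le> n" using Suc False by simp
    have "?D n' \<in> A n" if "n' \<le> n" for n'
      using that by (induction n') (auto intro!: A_mult one_A)
    then have "T n (?D n * (one n (em D) * x)) = ?D n * E n x" by (simp add: T_left E_def)
    then show ?thesis using mn Suc.IH[OF mn] by (simp add: Tr_def mult.assoc)
  qed (simp add: Tr_def)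
qed (simp add: Tr_def)

end

context qma_tower
begin

lemma lft_act1: "lft (act1 X k n) = act1 (em X) k n"
  by (intro HOL.ext) (auto simp: act1_def em_def)

lemma Er_op: "tw.Er k (k + n) (op 0 (k + n) X) =
  op 0 k (\<lambda>a b. \<Sum>c\<in>words n. tmult (k + n) (tprod (k + n) (map (\<lambda>i. lft (act1 D i (k + n))) [k..<k + n])) X (a @ c) (b @ c))"
proof -
  have "prod_list (map (\<lambda>i. one i (em D)) [k..<k + n]) = op 0 (k + n) (tprod (k + n) (map (\<lambda>i. lft (act1 D i (k + n))) [k..<k + n]))"
    unfolding op_tprod lft_act1 by (intro arg_cong[of _ _ prod_list]) (simp add: op_act1)
  then show ?thesis
    unfolding tw.Er_def by (simp only: Tr_D[of k "k + n"] le_add1 op_mult[symmetric] Tr_op)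
qed

end

sublocale qma_tower \<subseteq> qd: qma_data R F emb M .

context qma_tower
begin

lemma lift_op_eq: "qd.lift_op X = lft X"
  by (intro HOL.ext) (simp add: qd.lift_op_def)

end

locale qma_translation = qma_tower sca emb e R R' \<Psi> F F' M
  for sca :: "'a::ring_1 \<Rightarrow> 'r::ring_1" and emb and e :: "nat \<Rightarrow> 'n::finite \<Rightarrow> 'n \<Rightarrow> 'r" and R R' \<Psi> F F' M +
  assumes D_eq: "D_mat R = D" and R'_eq: "matrix_inv R = R'" and F'_eq: "matrix_inv F = F'"
begin

lemma op_bar: "i < n \<Longrightarrow> op 0 n (qd.bar M i n) = Mn i"
proof (induction i)
  case (Suc i)
  then show ?case
    by (simp add: op_tprod lift_op_eq op_adj F'_eq mult.assoc)
qed (simp add: op_act1)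

lemma op_M_string: "op 0 n (qd.M_string n) = tw.str n"
proof -
  have 1: "prod_list (map Mn [0..<n]) = tw.str n" by (induction n) simp_all
  have 2: "map (\<lambda>i. op 0 n (qd.bar M i n)) [0..<n] = map Mn [0..<n]"
    by (simp add: op_bar)
  show ?thesis by (simp only: qd.M_string_def op_tprod map_map comp_def 1 2)
qed

lemma R_trace_eq: "sca (qd.R_trace n X) = tw.Er 0 n (op 0 n X)"
  using Er_op[of 0 n X]
  by (simp add: qd.R_trace_def op_def lift_op_eq D_eq words_def)

lemma R_trace_tail_eq: "one 0 (qd.R_trace_tail (Suc n) X) = tw.Er (Suc 0) (Suc n) (op 0 (Suc n) X)"
proof -
  have "op 0 (Suc 0) (\<lambda>a b. \<Sum>c\<in>words n. tmult (Suc n) (tprod (Suc n)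
      (map (\<lambda>i. lft (act1 D i (Suc n))) [Suc 0..<Suc n])) X (a @ c) (b @ c)) = one 0 (qd.R_trace_tail (Suc n) X)"
    by (rule op_head)
      (simp add: qd.R_trace_tail_def lift_op_eq D_eq words_def del: upt_Suc)
  then show ?thesis using Er_op[of "Suc 0" n X] by simp
qed

lemma xi_eq: "one 0 (qd.xi q \<mu> N) = E (Suc 0) (tw.S (one 0 N) * two 0 (K_mat q \<mu> R))"
proof -
  have "one 0 (qd.xi q \<mu> N) = tw.Er (Suc 0) (Suc (Suc 0))
      (two 0 F * (one 0 N * (two 0 F' * two 0 (K_mat q \<mu> R))))"
    using R_trace_tail_eq[of "Suc 0"]
    by (simp add: qd.xi_def numeral_2_eq_2 op_tprod lift_op_eq op_adj op_act1 F'_eq)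
  moreover have "tw.S (one 0 N) = two 0 F * one 0 N * two 0 F'"
    by (subst tw.S_eq[of _ "Suc 0"]) (simp_all add: one_A tw.Sh_def)
  ultimately show ?thesis by (simp add: tw.Er_def mult.assoc)
qed

lemma T_M_eq: "one 0 (qd.T_M q \<mu> N) = tw.Bop (two 0 (K_mat q \<mu> R)) (one 0 N)"
  by (simp add: qd.T_M_def tw.Bop_def xi_eq flip: one_mult)

end

section \<open>A ring with matrix units at every position\<close>

text \<open>The endomorphisms of the right module of functions on infinite words. They contain the operators
  on every tensor power, and left multiplication by the entries of \<open>M\<close>.\<close>

typedef (overloaded) ('i, 'a) rop = "{f :: ('i \<Rightarrow> 'a::ring_1) \<Rightarrow> 'i \<Rightarrow> 'a.
    (\<forall>\<phi> \<psi>. f (\<lambda>s. \<phi> s + \<psi> s) = (\<lambda>s. f \<phi> s + f \<psi> s)) \<and> (\<forall>\<phi> r. f (\<lambda>s. \<phi> s * r) = (\<lambda>s. f \<phi> s * r))}"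
  by (rule exI[of _ "\<lambda>\<phi>. \<phi>"]) simp

setup_lifting type_definition_rop

instantiation rop :: (type, ring_1) ring_1
begin

lift_definition zero_rop :: "('a, 'b) rop" is "\<lambda>\<phi> s. 0" by simp
lift_definition one_rop :: "('a, 'b) rop" is "\<lambda>\<phi>. \<phi>" by simp
lift_definition plus_rop :: "('a, 'b) rop \<Rightarrow> ('a, 'b) rop \<Rightarrow> ('a, 'b) rop" is "\<lambda>f g \<phi> s. f \<phi> s + g \<phi> s"
  by (simp add: algebra_simps)
lift_definition minus_rop :: "('a, 'b) rop \<Rightarrow> ('a, 'b) rop \<Rightarrow> ('a, 'b) rop" is "\<lambda>f g \<phi> s. f \<phi> s - g \<phi> s"
  by (simp add: algebra_simps)
lift_definition uminus_rop :: "('a, 'b) rop \<Rightarrow> ('a, 'b) rop" is "\<lambda>f \<phi> s. - f \<phi> s"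
  by simp
lift_definition times_rop :: "('a, 'b) rop \<Rightarrow> ('a, 'b) rop \<Rightarrow> ('a, 'b) rop" is "\<lambda>f g \<phi>. f (g \<phi>)"
  by simp

instance
proof
  fix a b c :: "('a, 'b) rop"
  show "a * b * c = a * (b * c)" "1 * a = a" "a * 1 = a" by (transfer, simp)+
  show "a + b + c = a + (b + c)" "a + b = b + a" "0 + a = a" "- a + a = 0" "a - b = a + - b"
    by (transfer, simp add: algebra_simps)+
  show "(a + b) * c = a * c + b * c" "a * (b + c) = a * b + a * c" by (transfer, simp)+
  show "(0 :: ('a, 'b) rop) \<noteq> 1" by transfer (metis zero_neq_one)
qed

end

lift_definition rop_sca :: "'a::ring_1 \<Rightarrow> ('i, 'a) rop" is "\<lambda>c \<phi> s. c * \<phi> s"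
  by (simp add: algebra_simps)

lift_definition rop_e :: "nat \<Rightarrow> 'n \<Rightarrow> 'n \<Rightarrow> (nat \<Rightarrow> 'n, 'a::ring_1) rop" is
  "\<lambda>m i j \<phi> s. if s m = i then \<phi> (s(m := j)) else 0"
  by auto

lemma rop_sum: "Rep_rop (\<Sum>x\<in>X. f x) \<phi> s = (\<Sum>x\<in>X. Rep_rop (f x) \<phi> s)"
  by (induction X rule: infinite_finite_induct) (simp_all add: zero_rop.rep_eq plus_rop.rep_eq)

lemma rop_eqI: "(\<And>\<phi> s. Rep_rop x \<phi> s = Rep_rop y \<phi> s) \<Longrightarrow> x = y"
  by (simp add: Rep_rop_inject[symmetric] fun_eq_iff)

lemma rop_right: "Rep_rop x (\<lambda>s. \<phi> s * r) s = Rep_rop x \<phi> s * r"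
  using Rep_rop[of x] by simp

lemmas rop_rep_eqs = zero_rop.rep_eq one_rop.rep_eq plus_rop.rep_eq times_rop.rep_eq
  rop_sca.rep_eq rop_e.rep_eq

lemma rop_matrix_units:
  assumes "complex_algebra emb"
  shows "matrix_units (rop_sca :: 'a::ring_1 \<Rightarrow> (nat \<Rightarrow> 'n::finite, 'a) rop) emb rop_e"
proof
  show "rop_sca 1 = (1 :: (nat \<Rightarrow> 'n, 'a) rop)"
    by (rule rop_eqI) (simp add: rop_rep_eqs)
  show "rop_sca (a + b) = rop_sca a + (rop_sca b :: (nat \<Rightarrow> 'n, 'a) rop)" for a b
    by (rule rop_eqI) (simp add: rop_rep_eqs distrib_right)
  show "rop_sca (a * b) = rop_sca a * (rop_sca b :: (nat \<Rightarrow> 'n, 'a) rop)" for a b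
    by (rule rop_eqI) (simp add: rop_rep_eqs mult.assoc)
  show "a = 0" if "rop_sca a = (0 :: (nat \<Rightarrow> 'n, 'a) rop)" for a
  proof -
    have "a = Rep_rop (rop_sca a :: (nat \<Rightarrow> 'n, 'a) rop) (\<lambda>_. 1) undefined"
      by (simp add: rop_rep_eqs)
    also have "\<dots> = 0" unfolding that by (simp add: rop_rep_eqs)
    finally show ?thesis .
  qed
  show "rop_e m i j * rop_sca a = rop_sca a * rop_e m i j" for m a and i j :: 'n
    by (rule rop_eqI) (simp add: rop_rep_eqs)
  show "rop_e m i j * rop_e m k l = (if j = k then rop_e m i l else 0 :: (nat \<Rightarrow> 'n, 'a) rop)" for m i j k l
    by (rule rop_eqI) (simp add: rop_rep_eqs)
  show "(\<Sum>i\<in>UNIV. rop_e m i i) = (1 :: (nat \<Rightarrow> 'n, 'a) rop)" for m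
    by (rule rop_eqI) (simp add: rop_sum rop_rep_eqs)
  show "rop_e m i j * rop_e n k l = rop_e n k l * (rop_e m i j :: (nat \<Rightarrow> 'n, 'a) rop)" if "m \<noteq> n" for m n i j k l
    using that by (intro rop_eqI) (simp add: rop_rep_eqs fun_upd_twist)
  show "complex_algebra emb" by fact
  have c: "emb c * a = a * emb c" for a c using assms unfolding complex_algebra_def by metis
  \<comment> \<open>Left multiplication by a central coefficient is also right multiplication, and
    ring elements are right linear by construction.\<close>
  show "x * rop_sca (emb c) = rop_sca (emb c) * x" for x :: "(nat \<Rightarrow> 'n, 'a) rop" and c
    by (rule rop_eqI) (simp only: rop_rep_eqs c rop_right)
qed

section \<open>Skew inverses and the rank of \<open>K\<close>\<close>

lemma tmult3_adj0:
  "tmult 3 (adj X 0 3) Y [a, b, c] w = (\<Sum>x\<in>UNIV. \<Sum>y\<in>UNIV. X $ (a, b) $ (x, y) * Y [x, y, c] w)"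
  for Y :: "('n::finite, complex) tensor_op"
proof -
  have "tmult 3 (adj X 0 3) Y [a, b, c] w
      = (\<Sum>x\<in>UNIV. \<Sum>y\<in>UNIV. \<Sum>z\<in>UNIV. if c = z then X $ (a, b) $ (x, y) * Y [x, y, z] w else 0)"
    unfolding tmult_def words_def[symmetric] numeral_3_eq_3 sum_words_Suc
    by (intro sum.cong[OF HOL.refl]) (auto simp: act2_def All_less_Suc2)
  then show ?thesis by simp
qed

lemma tmult3_adj1:
  "tmult 3 (adj X (Suc 0) 3) Y [a, b, c] w = (\<Sum>y\<in>UNIV. \<Sum>z\<in>UNIV. X $ (b, c) $ (y, z) * Y [a, y, z] w)"
  for Y :: "('n::finite, complex) tensor_op"
proof -
  have "tmult 3 (adj X (Suc 0) 3) Y [a, b, c] w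
      = (\<Sum>x\<in>UNIV. \<Sum>y\<in>UNIV. \<Sum>z\<in>UNIV. if a = x then X $ (b, c) $ (y, z) * Y [x, y, z] w else 0)"
    unfolding tmult_def words_def[symmetric] numeral_3_eq_3 sum_words_Suc
    by (intro sum.cong[OF HOL.refl]) (auto simp: act2_def All_less_Suc2)
  also have "\<dots> = (\<Sum>x\<in>UNIV. if a = x then \<Sum>y\<in>UNIV. \<Sum>z\<in>UNIV. X $ (b, c) $ (y, z) * Y [x, y, z] w else 0)"
    by (intro sum.cong[OF HOL.refl]) simp
  finally show ?thesis by simp
qed

lemma tmult_tid: "length w = n \<Longrightarrow> tmult n X (tid n) v w = X v w"
  for X :: "('n::finite, complex) tensor_op"
proof -
  assume w: "length w = n"
  have "tmult n X (tid n) v w = (\<Sum>c\<in>words n. if c = w then X v w else 0)"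
    unfolding tmult_def words_def[symmetric]
    by (intro sum.cong[OF HOL.refl]) (auto simp: tid_def in_words)
  then show ?thesis using w by (simp add: in_words)
qed

lemma is_skew_inverse_sum:
  assumes "is_skew_inverse X \<Psi>"
  shows "(\<Sum>c\<in>UNIV. \<Sum>f\<in>UNIV. X $ (b, c) $ (x, f) * \<Psi> $ (f, g) $ (c, h)) = (if b = h \<and> x = g then 1 else 0)"
proof -
  have "trace_mid (tmult 3 (act2 X 0 1 3) (act2 \<Psi> 1 2 3)) $ (b, g) $ (x, h) = flip $ (b, g) $ (x, h)"
    using assms by (simp add: is_skew_inverse_def)
  moreover have "tmult 3 (act2 X 0 1 3) (act2 \<Psi> 1 2 3) [b, c, g] [x, c, h]
      = (\<Sum>f\<in>UNIV. X $ (b, c) $ (x, f) * \<Psi> $ (f, g) $ (c, h))" for c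
  proof -
    have "tmult 3 (adj X 0 3) (act2 \<Psi> 1 2 3) [b, c, g] [x, c, h]
        = (\<Sum>y\<in>UNIV. if x = y then \<Sum>f\<in>UNIV. X $ (b, c) $ (x, f) * \<Psi> $ (f, g) $ (c, h) else 0)"
      unfolding tmult3_adj0
      by (intro sum.cong[OF HOL.refl]) (auto simp: act2_def All_less_Suc2 numeral_3_eq_3 numeral_2_eq_2)
    then show ?thesis by simp
  qed
  ultimately show ?thesis by (auto simp: trace_mid_def flip_def)
qed

lemma is_skew_inverse_unique:
  fixes X :: "('n::finite, complex) mat2"
  assumes "is_skew_inverse X \<Psi>" "is_skew_inverse X \<Psi>'"
  shows "\<Psi> = \<Psi>'"
proof -
  define Y :: "complex ^ ('n \<times> 'n) ^ ('n \<times> 'n)" where "Y = (\<chi> p q. X $ (fst p, fst q) $ (snd p, snd q))"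
  define Z :: "('n, complex) mat2 \<Rightarrow> complex ^ ('n \<times> 'n) ^ ('n \<times> 'n)" where
    "Z = (\<lambda>\<Psi>. \<chi> p q. \<Psi> $ (snd p, snd q) $ (fst p, fst q))"
  have prod_sum: "(\<Sum>p\<in>UNIV. f p) = (\<Sum>i\<in>UNIV. \<Sum>j\<in>UNIV. f (i, j))" for f :: "'n \<times> 'n \<Rightarrow> complex"
    by (simp add: UNIV_Times_UNIV[symmetric] sum.cartesian_product' del: UNIV_Times_UNIV)
  have YZ: "Y ** Z \<Phi> = mat 1" if "is_skew_inverse X \<Phi>" for \<Phi>
    using is_skew_inverse_sum[OF that]
    by (auto simp: vec_eq_iff matrix_matrix_mult_def mat_def Y_def Z_def prod_sum prod_eq_iff)
  have "Z \<Psi> = (Z \<Psi> ** Y) ** Z \<Psi>'"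
    using YZ[OF assms(2)] by (simp add: matrix_mul_assoc[symmetric])
  also have "Z \<Psi> ** Y = mat 1" using YZ[OF assms(1)] by (simp add: matrix_left_right_inverse)
  finally have "Z \<Psi> = Z \<Psi>'" by simp
  then show ?thesis by (simp add: Z_def vec_eq_iff)
qed

lemma is_skew_inverse_skew_inv: "skew_invertible X \<Longrightarrow> is_skew_inverse X (skew_inv X)"
  unfolding skew_invertible_def skew_inv_def
  using is_skew_inverse_unique by (metis theI_unique)

text \<open>Contracting \<open>K\<^sub>2 K\<^sub>1 = R\<^sub>1 R\<^sub>2 K\<^sub>1\<close> twice with the skew inverse of \<open>R\<close> shows that the columns of
  \<open>K\<close>, read as square matrices, satisfy the relations of a system of matrix units, which have a
  one-dimensional space of solutions.\<close>

lemma K_rank_one: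
  fixes R K \<Psi> :: "('n::finite, complex) mat2"
  assumes skew: "\<And>b x h g. (\<Sum>c\<in>UNIV. \<Sum>f\<in>UNIV. R $ (b, c) $ (x, f) * \<Psi> $ (f, g) $ (c, h)) =
      (if b = h \<and> x = g then 1 else 0)"
    and KK: "tprod 3 [adj K 1 3, adj K 0 3] = tprod 3 [adj R 0 3, adj R 1 3, adj K 0 3]"
  shows "\<exists>u v. \<forall>p r. K $ p $ r = u p * v r"
proof (cases "K = 0")
  case True
  then show ?thesis by (auto intro!: exI[of _ "\<lambda>_. 0"])
next
  case False
  have entry: "(\<Sum>y\<in>UNIV. K $ (b, c) $ (y, f) * K $ (a, y) $ d) =
      (\<Sum>p\<in>UNIV. \<Sum>q\<in>UNIV. R $ (a, b) $ (p, q) * (\<Sum>x\<in>UNIV. R $ (q, c) $ (x, f) * K $ (p, x) $ d))"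
    for a b c d f
  proof -
    obtain d1 d2 where d: "d = (d1, d2)" by force
    define Y :: "('n, complex) tensor_op" where "Y = tmult 3 (adj K 0 3) (tid 3)"
    have K0: "Y [a, b, c] [d1, d2, f] = (if c = f then K $ (a, b) $ d else 0)" for a b c
      unfolding Y_def by (subst tmult_tid) (auto simp: act2_def All_less_Suc2 numeral_3_eq_3 d)
    have "tprod 3 [adj K 1 3, adj K 0 3] [a, b, c] [d1, d2, f] = (\<Sum>y\<in>UNIV. K $ (b, c) $ (y, f) * K $ (a, y) $ d)"
      by (simp add: tprod_def Y_def[symmetric] tmult3_adj1 K0 if_distrib[of "(*) _"] cong: if_cong)
    moreover have "tprod 3 [adj R 0 3, adj R 1 3, adj K 0 3] [a, b, c] [d1, d2, f] =
      (\<Sum>p\<in>UNIV. \<Sum>q\<in>UNIV. R $ (a, b) $ (p, q) * (\<Sum>x\<in>UNIV. R $ (q, c) $ (x, f) * K $ (p, x) $ d))"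
      by (simp add: tprod_def Y_def[symmetric] tmult3_adj0 tmult3_adj1 K0 if_distrib[of "(*) _"] cong: if_cong)
    ultimately show ?thesis using KK by simp
  qed
  \<comment> \<open>Contraction with the skew inverse, which turns \<open>R\<close> into a Kronecker
    delta (\<open>Ct_R\<close>). Applied first in the indices \<open>c\<close>, \<open>f\<close> and
    then in \<open>b\<close>, \<open>h\<close>, it removes both copies of \<open>R\<close>.\<close>
  define Ct where "Ct g h G = (\<Sum>c\<in>UNIV. \<Sum>f\<in>UNIV. G c f * \<Psi> $ (f, g) $ (c, h))" for g h G
  have Ct_sum: "Ct g h (\<lambda>c f. \<Sum>p\<in>UNIV. G p c f) = (\<Sum>p\<in>UNIV. Ct g h (G p))" for g h and G :: "'n \<Rightarrow> _"
  proof -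
    have "Ct g h (\<lambda>c f. \<Sum>p\<in>UNIV. G p c f) = (\<Sum>c\<in>UNIV. \<Sum>f\<in>UNIV. \<Sum>p\<in>UNIV. G p c f * \<Psi> $ (f, g) $ (c, h))"
      by (simp only: Ct_def sum_distrib_right)
    also have "\<dots> = (\<Sum>c\<in>UNIV. \<Sum>p\<in>UNIV. \<Sum>f\<in>UNIV. G p c f * \<Psi> $ (f, g) $ (c, h))"
      by (rule sum.cong[OF HOL.refl], rule sum.swap)
    also have "\<dots> = (\<Sum>p\<in>UNIV. \<Sum>c\<in>UNIV. \<Sum>f\<in>UNIV. G p c f * \<Psi> $ (f, g) $ (c, h))"
      by (rule sum.swap)
    finally show ?thesis by (simp only: Ct_def)
  qed
  have Ct_left: "Ct g h (\<lambda>c f. k * G c f) = k * Ct g h G" for g h k G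
    by (simp only: Ct_def sum_distrib_left mult.assoc)
  have Ct_right: "Ct g h (\<lambda>c f. G c f * k) = Ct g h G * k" for g h k G
    by (simp only: Ct_def sum_distrib_right mult.assoc mult.commute[of k])
  have Ct_R: "Ct g h (\<lambda>c f. R $ (b, c) $ (x, f)) = (if b = h \<and> x = g then 1 else 0)" for b x g h
    unfolding Ct_def by (rule skew)
  define \<Theta> where "\<Theta> b y g h = Ct g h (\<lambda>c f. K $ (b, c) $ (y, f))" for b y g h
  have once: "(\<Sum>p\<in>UNIV. R $ (a, b) $ (p, h) * K $ (p, g) $ d) = (\<Sum>y\<in>UNIV. \<Theta> b y g h * K $ (a, y) $ d)"
    for a b g h d
  proof -
    have "(\<Sum>y\<in>UNIV. \<Theta> b y g h * K $ (a, y) $ d) = Ct g h (\<lambda>c f. \<Sum>y\<in>UNIV. K $ (b, c) $ (y, f) * K $ (a, y) $ d)"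
      by (simp only: \<Theta>_def Ct_sum Ct_right)
    also have "\<dots> = (\<Sum>p\<in>UNIV. \<Sum>q\<in>UNIV. R $ (a, b) $ (p, q) * (\<Sum>x\<in>UNIV. (if q = h \<and> x = g then 1 else 0) * K $ (p, x) $ d))"
      by (simp only: entry Ct_sum Ct_left Ct_right Ct_R)
    also have "\<dots> = (\<Sum>p\<in>UNIV. \<Sum>q\<in>UNIV. if q = h then R $ (a, b) $ (p, h) * K $ (p, g) $ d else 0)"
    proof (intro sum.cong[OF HOL.refl])
      fix p q
      have "(\<Sum>x\<in>UNIV. (if q = h \<and> x = g then 1 else 0) * K $ (p, x) $ d) = (if q = h then K $ (p, g) $ d else 0)"
        by (cases "q = h") (simp_all add: if_distrib[of "\<lambda>v. v * _"] cong: if_cong)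
      then show "R $ (a, b) $ (p, q) * (\<Sum>x\<in>UNIV. (if q = h \<and> x = g then 1 else 0) * K $ (p, x) $ d)
          = (if q = h then R $ (a, b) $ (p, h) * K $ (p, g) $ d else 0)" by simp
    qed
    finally show ?thesis by simp
  qed
  define \<Phi> where "\<Phi> m g l y = Ct m l (\<lambda>b h. \<Theta> b y g h)" for m g l y
  have twice: "(\<Sum>y\<in>UNIV. \<Phi> m g l y * K $ (a, y) $ d) = (if a = l then K $ (m, g) $ d else 0)" for m g l a d
  proof -
    have "(\<Sum>y\<in>UNIV. \<Phi> m g l y * K $ (a, y) $ d) = Ct m l (\<lambda>b h. \<Sum>p\<in>UNIV. R $ (a, b) $ (p, h) * K $ (p, g) $ d)"
      by (simp only: once \<Phi>_def Ct_sum Ct_right)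
    also have "\<dots> = (\<Sum>p\<in>UNIV. (if a = l \<and> p = m then 1 else 0) * K $ (p, g) $ d)"
      by (simp only: Ct_sum Ct_right Ct_R)
    also have "\<dots> = (if a = l then K $ (m, g) $ d else 0)"
      by (cases "a = l") (simp_all add: if_distrib[of "\<lambda>v. v * _"] cong: if_cong)
    finally show ?thesis .
  qed
  from False obtain m g d0 where nz: "K $ (m, g) $ d0 \<noteq> 0"
    by (auto simp: vec_eq_iff)
  \<comment> \<open>A nonzero column of \<open>K\<close>, read as a square matrix. By
    \<open>twice\<close> the same \<open>W\<close> inverts it and sends every other column to a
    multiple of the identity, so every column is a multiple of this one.\<close>
  define U :: "complex ^ 'n ^ 'n" where "U = (\<chi> r y. K $ (r, y) $ d0)"
  define W :: "complex ^ 'n ^ 'n" where "W = (\<chi> y l. \<Phi> m g l y / K $ (m, g) $ d0)"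
  have UW: "(\<Sum>y\<in>UNIV. K $ (r, y) $ d * W $ y $ l) = (if r = l then K $ (m, g) $ d / K $ (m, g) $ d0 else 0)" for r l d
    using twice[of m g l r d] by (simp add: W_def sum_divide_distrib[symmetric] mult.commute)
  have "U ** W = mat 1"
    using UW[of _ d0] nz by (simp add: vec_eq_iff matrix_matrix_mult_def U_def mat_def)
  then have WU: "W ** U = mat 1" by (simp add: matrix_left_right_inverse)
  have main: "K $ (r, y) $ d = K $ (r, y) $ d0 * (K $ (m, g) $ d / K $ (m, g) $ d0)" for r y d
  proof -
    have "K $ (r, y) $ d = (\<Sum>y'\<in>UNIV. K $ (r, y') $ d * (W ** U) $ y' $ y)"
      unfolding WU by (simp add: mat_def if_distrib[of "(*) _"] cong: if_cong)
    also have "\<dots> = (\<Sum>y'\<in>UNIV. \<Sum>l\<in>UNIV. K $ (r, y') $ d * W $ y' $ l * U $ l $ y)"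
      by (simp add: matrix_matrix_mult_def sum_distrib_left mult.assoc)
    also have "\<dots> = (\<Sum>l\<in>UNIV. \<Sum>y'\<in>UNIV. K $ (r, y') $ d * W $ y' $ l * U $ l $ y)"
      by (rule sum.swap)
    also have "\<dots> = (\<Sum>l\<in>UNIV. (if r = l then K $ (m, g) $ d / K $ (m, g) $ d0 else 0) * U $ l $ y)"
      by (simp only: sum_distrib_right[symmetric] UW)
    also have "\<dots> = (\<Sum>l\<in>UNIV. if r = l then K $ (m, g) $ d / K $ (m, g) $ d0 * U $ l $ y else 0)"
      by (intro sum.cong[OF HOL.refl]) simp
    finally show ?thesis by (simp add: U_def)
  qed
  have "K $ p $ r = K $ p $ d0 * (K $ (m, g) $ r / K $ (m, g) $ d0)" for p r
    using main[of "fst p" "snd p" r] by (simp only: prod.collapse)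
  then show ?thesis by (intro exI[of _ "\<lambda>p. K $ p $ d0"] exI[of _ "\<lambda>r. K $ (m, g) $ r / K $ (m, g) $ d0"]) blast
qed

lemma matrix_poly_2:
  fixes X :: "complex ^ 'k::finite ^ 'k"
  assumes "a2 \<noteq> 0"
  shows "matrix_poly [:a0, a1, a2:] X = mat a0 + mat a1 ** X + mat a2 ** (X ** X)"
  using assms by (simp add: matrix_poly_def numeral_2_eq_2 atMost_Suc add.commute add.left_commute)

lemma matrix_poly_3:
  fixes X :: "complex ^ 'k::finite ^ 'k"
  assumes "a3 \<noteq> 0"
  shows "matrix_poly [:a0, a1, a2, a3:] X = mat a0 + mat a1 ** X + mat a2 ** (X ** X) + mat a3 ** (X ** (X ** X))"
  using assms by (simp add: matrix_poly_def numeral_3_eq_3 atMost_Suc add.commute add.left_commute)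

section \<open>Linear extension to monoid algebras\<close>

lemma poly_mapping_add_induct:
  assumes "P 0" and "\<And>k v f. P f \<Longrightarrow> P (f + Poly_Mapping.single k v)"
  shows "P p"
proof (induction p rule: Poly_Mapping.update_induct)
  case (update f a b)
  have "Poly_Mapping.update a b f = f + Poly_Mapping.single a b"
    using update by (intro poly_mapping_eqI)
      (auto simp: Poly_Mapping.lookup_update lookup_add lookup_single when_def in_keys_iff)
  then show ?case using assms(2)[OF update(3)] by simp
qed (rule assms(1))

text \<open>Shared by the evaluation of free algebra elements and that of braid group algebra
  elements: both extend a monoid homomorphism linearly.\<close>

definition lin_ext :: "(complex \<Rightarrow> 'r::ring_1) \<Rightarrow> ('k \<Rightarrow> 'r) \<Rightarrow> ('k \<Rightarrow>\<^sub>0 complex) \<Rightarrow> 'r" where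
  "lin_ext h g p = (\<Sum>k\<in>Poly_Mapping.keys p. h (Poly_Mapping.lookup p k) * g k)"

locale scalar_hom =
  fixes h :: "complex \<Rightarrow> 'r::ring_1"
  assumes h_1: "h 1 = 1" and h_add: "h (x + y) = h x + h y" and h_mult: "h (x * y) = h x * h y"
begin

lemma h_0: "h 0 = 0"
  using h_add[of 0 0] by simp

lemma lin_ext_superset:
  assumes "finite S" "Poly_Mapping.keys p \<subseteq> S"
  shows "lin_ext h g p = (\<Sum>k\<in>S. h (Poly_Mapping.lookup p k) * g k)"
  unfolding lin_ext_def using assms
  by (intro sum.mono_neutral_left) (auto simp: in_keys_iff h_0)

lemma lin_ext_0: "lin_ext h g 0 = 0"
  by (simp add: lin_ext_def)

lemma lin_ext_add: "lin_ext h g (p + q) = lin_ext h g p + lin_ext h g q"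
proof -
  let ?S = "Poly_Mapping.keys p \<union> Poly_Mapping.keys q"
  have "Poly_Mapping.keys (p + q) \<subseteq> ?S" by (rule Poly_Mapping.keys_add)
  then show ?thesis
    by (simp add: lin_ext_superset[of ?S] lookup_add h_add distrib_right sum.distrib)
qed

lemma lin_ext_single: "lin_ext h g (Poly_Mapping.single k v) = h v * g k"
  by (simp add: lin_ext_def h_0)

lemma lin_ext_mult:
  assumes central: "\<And>c k. g k * h c = h c * g k" and g: "\<And>k l. g (k + l) = g k * g (l :: 'k::monoid_add)"
  shows "lin_ext h g (p * q) = lin_ext h g p * lin_ext h g q"
proof (induction p rule: poly_mapping_add_induct)
  case (2 k v p)
  have "lin_ext h g (Poly_Mapping.single k v * q) = h v * g k * lin_ext h g q"
  proof (induction q rule: poly_mapping_add_induct)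
    case (2 l w q)
    have "h (v * w) * g (k + l) = h v * (h w * g k) * g l"
      by (simp only: h_mult g mult.assoc)
    also have "\<dots> = h v * g k * (h w * g l)"
      by (simp only: central[of k w, symmetric] mult.assoc)
    finally show ?case using 2
      by (simp only: distrib_left lin_ext_add lin_ext_single mult_single)
  qed (simp add: lin_ext_0)
  then show ?case using 2 by (simp only: distrib_right lin_ext_add lin_ext_single)
qed (simp add: lin_ext_0)

end

lemma free_eval_lin_ext: "free_eval emb f = lin_ext emb (\<lambda>w. prod_list (map f (letters w)))"
  by (intro HOL.ext) (simp add: free_eval_def lin_ext_def)

lemma free_eval_hom:
  assumes emb: "complex_algebra emb"
  shows "free_eval emb f (p + q) = free_eval emb f p + free_eval emb f q"
    "free_eval emb f (p * q) = free_eval emb f p * free_eval emb f q"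
    "free_eval emb f (free_emb c) = emb c" "free_eval emb f (free_gen x) = f x" "free_eval emb f 0 = 0"
    "free_eval emb f 1 = 1"
proof -
  have h: "emb 1 = 1" "\<And>x y. emb (x + y) = emb x + emb y" "\<And>x y. emb (x * y) = emb x * emb y"
    and c: "\<And>c a. a * emb c = emb c * a"
    using emb unfolding complex_algebra_def by metis+
  interpret scalar_hom emb by unfold_locales (rule h)+
  let ?g = "\<lambda>w. prod_list (map f (letters w))"
  show "free_eval emb f (p + q) = free_eval emb f p + free_eval emb f q" "free_eval emb f 0 = 0"
    by (simp_all only: free_eval_lin_ext lin_ext_add lin_ext_0)
  show "free_eval emb f (p * q) = free_eval emb f p * free_eval emb f q"
    unfolding free_eval_lin_ext by (rule lin_ext_mult) (simp_all add: c plus_fmon_def)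
  have s: "free_eval emb f (Poly_Mapping.single k v) = emb v * ?g k" for k v
    unfolding free_eval_lin_ext by (rule lin_ext_single)
  show "free_eval emb f (free_emb c) = emb c" "free_eval emb f (free_gen x) = f x"
    by (simp_all add: free_emb_def free_gen_def s zero_fmon_def h)
  show "free_eval emb f 1 = 1"
    unfolding single_one[symmetric] s by (simp add: zero_fmon_def h)
qed

text \<open>The relators are built in the free algebra by the same recipe as the barred strings.
  Evaluation at the entries of \<open>M\<close> is a homomorphism, so it carries one construction to
  the other, and it kills the relators.\<close>

lemma qma_relations:
  fixes R F :: "('n::finite, complex) mat2" and M :: "('n, 'a::ring_1) mat1"
  assumes "presented_by emb (\<lambda>(i, j). M $ i $ j) (qma_relators R F)" and ab: "length a = 2" "length b = 2"
  shows "tmult 2 (\<lambda>a b. emb (adj R 0 2 a b)) (qma_data.M_string F emb M 2) a b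
    = tmult 2 (qma_data.M_string F emb M 2) (\<lambda>a b. emb (adj R 0 2 a b)) a b"
proof -
  interpret qd: qma_data R F emb M .
  interpret fr: qma_data R F free_emb "\<chi> i j. free_gen (i, j)" .
  define h where "h = free_eval emb (\<lambda>(i, j). M $ i $ j)"
  have emb: "complex_algebra emb" using assms(1) by (simp add: presented_by_def)
  note hom = free_eval_hom[OF emb, of "\<lambda>(i, j). M $ i $ j", folded h_def]
  have h_sum: "h (\<Sum>x\<in>X. f x) = (\<Sum>x\<in>X. h (f x))" for X :: "'n list set" and f :: "'n list \<Rightarrow> ('n \<times> 'n) free_algebra"
    by (induction X rule: infinite_finite_induct) (simp_all add: hom)
  have h_tmult: "h (tmult n X Y a b) = tmult n (\<lambda>a b. h (X a b)) (\<lambda>a b. h (Y a b)) a b"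
    for n a b and X Y :: "('n, ('n \<times> 'n) free_algebra) tensor_op"
    by (simp add: tmult_def h_sum hom)
  have h_tprod: "h (tprod n Xs a b) = tprod n (map (\<lambda>X a b. h (X a b)) Xs) a b"
    for n a b and Xs :: "('n, ('n \<times> 'n) free_algebra) tensor_op list"
  proof (induction Xs arbitrary: a b)
    case Nil
    show ?case by (auto simp: tprod_def tid_def hom)
  next
    case (Cons X Xs)
    then show ?case by (simp add: tprod_def h_tmult)
  qed
  have h_lift: "(\<lambda>a b. h (fr.lift_op X a b)) = qd.lift_op X" for X
    by (intro HOL.ext) (simp add: fr.lift_op_def qd.lift_op_def hom)
  have h_bar: "(\<lambda>a b. h (fr.bar (\<chi> i j. free_gen (i, j)) i n a b)) = qd.bar M i n" for i n
  proof (induction i)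
    case 0
    show ?case by (intro HOL.ext) (auto simp: act1_def hom)
  next
    case (Suc i)
    show ?case by (intro HOL.ext) (simp add: h_tprod h_lift Suc)
  qed
  have h_M: "(\<lambda>a b. h (fr.M_string n a b)) = qd.M_string n" for n
    by (intro HOL.ext) (simp add: fr.M_string_def qd.M_string_def h_tprod comp_def h_bar)
  let ?r = "tmult 2 (fr.lift_op (adj R 0 2)) (fr.M_string 2) a b - tmult 2 (fr.M_string 2) (fr.lift_op (adj R 0 2)) a b"
  have "?r \<in> qma_relators R F" unfolding qma_relators_def fr.relators_def using ab by blast
  then have "?r \<in> {p. h p = 0}"
    using assms(1) two_sided_ideal.gen unfolding presented_by_def h_def by blast
  moreover have "h (x - y) = h x - h y" for x y
    using hom(1)[of "x - y" y] by simp
  ultimately have "tmult 2 (qd.lift_op (adj R 0 2)) (qd.M_string 2) a b = tmult 2 (qd.M_string 2) (qd.lift_op (adj R 0 2)) a b"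
    by (simp add: h_tmult h_lift h_M)
  then show ?thesis by (simp add: qd.lift_op_def[abs_def])
qed

section \<open>The braid group algebra in the tower\<close>

lemma words_on_Nil [simp]: "[] \<in> words_on n"
  and words_on_Cons [simp]: "(k, s) # w \<in> words_on n \<longleftrightarrow> Suc k < n \<and> w \<in> words_on n"
  and words_on_append [simp]: "v @ w \<in> words_on n \<longleftrightarrow> v \<in> words_on n \<and> w \<in> words_on n"
  by (auto simp: words_on_def)

lemma words_on_shift: "w \<in> words_on i \<Longrightarrow> shift_word n w \<in> words_on (n + i)"
  by (auto simp: words_on_def shift_word_def)

lemma words_on_mono: "w \<in> words_on n \<Longrightarrow> n \<le> m \<Longrightarrow> w \<in> words_on m"
  by (fastforce simp: words_on_def)

lemma braid_group_0 [simp]: "0 \<in> braid_group n"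
  unfolding braid_group_def zero_braid.abs_eq by simp

lemma braid_group_add: "a \<in> braid_group n \<Longrightarrow> b \<in> braid_group n \<Longrightarrow> a + b \<in> braid_group n"
  unfolding braid_group_def
proof (elim imageE)
  fix v w assume "a = abs_braid v" "b = abs_braid w" "v \<in> words_on n" "w \<in> words_on n"
  then show "a + b \<in> abs_braid ` words_on n"
    by (intro image_eqI[of _ _ "v @ w"]) (simp_all add: plus_braid.abs_eq)
qed

lemma braid_group_mono: "n \<le> m \<Longrightarrow> braid_group n \<subseteq> braid_group m"
  unfolding braid_group_def using words_on_mono by blast

lemma braid_group_shift: "b \<in> braid_group i \<Longrightarrow> shift_braid n b \<in> braid_group (n + i)"
  unfolding braid_group_def using words_on_shift by (auto simp: shift_braid.abs_eq)

lemma group_algebra_single: "b \<in> braid_group n \<Longrightarrow> Poly_Mapping.single b c \<in> group_algebra n"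
  by (simp add: group_algebra_def)

lemma group_algebra_add: "\<alpha> \<in> group_algebra n \<Longrightarrow> \<beta> \<in> group_algebra n \<Longrightarrow> \<alpha> + \<beta> \<in> group_algebra n"
  unfolding group_algebra_def using Poly_Mapping.keys_add[of \<alpha> \<beta>] by blast

lemma group_algebra_mult: "\<alpha> \<in> group_algebra n \<Longrightarrow> \<beta> \<in> group_algebra n \<Longrightarrow> \<alpha> * \<beta> \<in> group_algebra n"
  unfolding group_algebra_def using keys_mult[of \<alpha> \<beta>] braid_group_add by blast

lemma group_algebra_mono: "\<alpha> \<in> group_algebra n \<Longrightarrow> n \<le> m \<Longrightarrow> \<alpha> \<in> group_algebra m"
  unfolding group_algebra_def using braid_group_mono by blast

lemma group_algebra_shift: "\<beta> \<in> group_algebra i \<Longrightarrow> shift_algebra n \<beta> \<in> group_algebra (n + i)"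
  unfolding group_algebra_def shift_algebra_def
proof (intro CollectI subset_trans[OF keys_sum] UN_least)
  fix b assume "b \<in> Poly_Mapping.keys \<beta>" "\<beta> \<in> {\<alpha>. Poly_Mapping.keys \<alpha> \<subseteq> braid_group i}"
  then have "shift_braid n b \<in> braid_group (n + i)" by (auto intro: braid_group_shift)
  then show "Poly_Mapping.keys (Poly_Mapping.single (shift_braid n b) (Poly_Mapping.lookup \<beta> b)) \<subseteq> braid_group (n + i)"
    by simp
qed

definition star_word :: "nat \<Rightarrow> braid_word" where
  "star_word n = map (\<lambda>k. (k, True)) (rev [0..<n]) @ map (\<lambda>k. (k, False)) [1..<n]"

lemma braid_star_group_algebra:
  assumes "\<alpha> \<in> group_algebra n" "\<beta> \<in> group_algebra i" "1 \<le> i"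
  shows "braid_star n \<alpha> \<beta> \<in> group_algebra (n + i)"
proof -
  have "star_word n \<in> words_on (n + i)"
    using assms(3) by (auto simp: star_word_def words_on_def)
  then have "abs_braid (star_word n) \<in> braid_group (n + i)" by (simp add: braid_group_def)
  then show ?thesis unfolding braid_star_def star_word_def
    by (intro group_algebra_mult group_algebra_single group_algebra_shift assms)
      (rule group_algebra_mono[OF assms(1)], simp)
qed

context qma_translation
begin

sublocale scal: scalar_hom "\<lambda>c. sca (emb c)"
  by unfold_locales (simp_all only: sc_1 sc_add sc_mult)

definition letter :: "nat \<times> bool \<Rightarrow> 'r" where
  "letter x = two (fst x) (if snd x then R else R')"

definition word_val :: "braid_word \<Rightarrow> 'r" where "word_val v = prod_list (map letter v)"

lemma word_val_append: "word_val (u @ v) = word_val u * word_val v"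
  by (simp add: word_val_def)

lemma word_val_cong: "braid_eq u v \<Longrightarrow> word_val u = word_val v"
proof (induction rule: braid_eq.induct)
  case (cancel k s)
  show ?case by (cases s) (simp_all add: word_val_def letter_def)
next
  case (far i j)
  show ?case using tw.R_far[OF far] by (simp add: word_val_def letter_def)
next
  case (near i)
  show ?case using R_braid[of i] by (simp add: word_val_def letter_def mult.assoc)
qed (simp_all add: word_val_append)

definition braid_val :: "braid \<Rightarrow> 'r" where "braid_val b = word_val (rep_braid b)"

lemma abs_rep_braid: "abs_braid (rep_braid b) = b"
  by (rule Quotient3_abs_rep[OF Quotient3_braid])

lemma braid_val_abs: "braid_val (abs_braid v) = word_val v"
proof -
  have "braid_eq (rep_braid (abs_braid v)) v"
    using abs_rep_braid[of "abs_braid v"] by (simp add: braid.abs_eq_iff)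
  then show ?thesis unfolding braid_val_def by (rule word_val_cong)
qed

lemma braid_val_add: "braid_val (a + b) = braid_val a * braid_val b"
proof -
  have "a + b = abs_braid (rep_braid a @ rep_braid b)"
    by (simp add: abs_rep_braid flip: plus_braid.abs_eq)
  then show ?thesis by (simp add: braid_val_abs word_val_append) (simp add: braid_val_def)
qed

lemma word_val_W: "v \<in> words_on n \<Longrightarrow> word_val v \<in> tw.Wset n"
proof (induction v)
  case (Cons a v)
  obtain k s where a: "a = (k, s)" by force
  then have "letter a \<in> tw.Wset n" using Cons(2) by (auto simp: letter_def)
  then show ?case using Cons a by (simp add: word_val_def tw.Wset_mult)
qed (simp add: word_val_def)

lemma word_val_shift: "v \<in> words_on i \<Longrightarrow> word_val (shift_word n v) = tw.Sk n (word_val v)"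
proof (induction v)
  case (Cons a v)
  obtain k s where a: "a = (k, s)" by force
  then have l: "letter a \<in> A i" "word_val v \<in> A i"
    using Cons(2) by (auto simp: letter_def intro: two_A tw.Wset_A word_val_W)
  have "word_val (shift_word n (a # v)) = letter (n + k, s) * tw.Sk n (word_val v)"
    using Cons a by (simp add: word_val_def shift_word_def)
  also have "letter (n + k, s) = tw.Sk n (letter a)"
    by (simp add: letter_def a add.commute)
  also have "\<dots> * tw.Sk n (word_val v) = tw.Sk n (letter a * word_val v)"
    by (rule tw.Sk_mult[OF l, symmetric])
  finally show ?case by (simp add: word_val_def)
qed (simp add: word_val_def shift_word_def)

lemma word_val_star:
  assumes "1 \<le> n"
  shows "word_val (star_word n) = tw.w n"
proof -
  let ?v = "\<lambda>n. map (\<lambda>k. (k, True)) (rev [0..<n])" and ?y = "\<lambda>n. map (\<lambda>k. (k, False)) [0..<n]"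
  have vW: "?v n \<in> words_on (Suc n)" "?y n \<in> words_on (Suc n)" for n by (auto simp: words_on_def)
  have v_Suc: "?v (Suc n) = shift_word 1 (?v n) @ [(0, True)]" for n
    by (simp add: shift_word_def upt_conv_Cons rev_map comp_def flip: map_Suc_upt del: upt_Suc)
  have y_shift: "map (\<lambda>k. (k, False)) [1..<Suc n] = shift_word 1 (?y n)" for n
    by (simp add: shift_word_def comp_def flip: map_Suc_upt del: upt_Suc)
  have v: "word_val (?v n) = tw.vs n" for n
  proof (induction n)
    case (Suc n)
    show ?case unfolding v_Suc word_val_append word_val_shift[OF vW(1)] Suc
      by (simp add: word_val_def letter_def)
  qed (simp add: word_val_def)
  have y: "word_val (?y n) = tw.ys n" for n
  proof (induction n)
    case (Suc n)
    have "?y (Suc n) = [(0, False)] @ shift_word 1 (?y n)"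
      unfolding y_shift[symmetric] by (simp add: upt_conv_Cons del: upt_Suc)
    then show ?case unfolding word_val_append word_val_shift[OF vW(2)] Suc
      by (simp only: word_val_append word_val_shift[OF vW(2)] Suc) (simp add: word_val_def letter_def)
  qed (simp add: word_val_def)
  obtain m where m: "n = Suc m" using assms by (cases n) auto
  have "word_val (star_word n) = word_val (?v (Suc m)) * word_val (shift_word 1 (?y m))"
    unfolding star_word_def m y_shift[symmetric] by (rule word_val_append)
  also have "\<dots> = tw.vs (Suc m) * tw.S (tw.ys m)"
    unfolding v word_val_shift[OF vW(2)] y by simp
  finally show ?thesis by (simp add: tw.w_def m)
qed

definition alg_val :: "braid_algebra \<Rightarrow> 'r" where
  "alg_val = lin_ext (\<lambda>c. sca (emb c)) braid_val"

lemma alg_val_add: "alg_val (\<alpha> + \<beta>) = alg_val \<alpha> + alg_val \<beta>"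
  and alg_val_single: "alg_val (Poly_Mapping.single b c) = sc c * braid_val b"
  and alg_val_mult: "alg_val (\<alpha> * \<beta>) = alg_val \<alpha> * alg_val \<beta>"
  unfolding alg_val_def
  by (rule scal.lin_ext_add scal.lin_ext_single scal.lin_ext_mult sca_emb_central braid_val_add)+

lemma alg_val_sum: "alg_val (\<Sum>x\<in>X. f x) = (\<Sum>x\<in>X. alg_val (f x))"
proof -
  have "alg_val 0 = 0" by (simp add: alg_val_def lin_ext_def)
  then show ?thesis by (induction X rule: infinite_finite_induct) (simp_all add: alg_val_add)
qed

lemma braid_val_W: "b \<in> braid_group n \<Longrightarrow> braid_val b \<in> tw.Wset n"
  unfolding braid_group_def by (auto simp: braid_val_abs word_val_W)

lemma Wset_sum: "(\<And>x. x \<in> X \<Longrightarrow> f x \<in> tw.Wset n) \<Longrightarrow> (\<Sum>x\<in>X. f x) \<in> tw.Wset n"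
proof -
  have "0 \<in> tw.Wset n" using tw.Wset_sc[OF tw.Wset_1, of 0] by simp
  then show "(\<And>x. x \<in> X \<Longrightarrow> f x \<in> tw.Wset n) \<Longrightarrow> (\<Sum>x\<in>X. f x) \<in> tw.Wset n"
    by (induction X rule: infinite_finite_induct) (simp_all add: tw.Wset_add)
qed

lemma alg_val_W: "\<alpha> \<in> group_algebra n \<Longrightarrow> alg_val \<alpha> \<in> tw.Wset n"
  unfolding alg_val_def lin_ext_def group_algebra_def
  by (intro Wset_sum tw.Wset_sc braid_val_W) blast

lemma W_alg_val:
  assumes "x \<in> tw.Wset n" shows "\<exists>\<alpha>\<in>group_algebra n. x = alg_val \<alpha>"
proof -
  obtain y where "(x, y) \<in> tw.Wp n" using assms tw.Wset_iff by blast
  then show ?thesis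
  proof (induction rule: tw.Wp.induct)
    case one
    have "alg_val (Poly_Mapping.single 0 1) = 1"
      by (simp add: alg_val_single zero_braid.abs_eq braid_val_abs word_val_def)
    then show ?case by (intro bexI[of _ "Poly_Mapping.single 0 1"]) (simp, rule group_algebra_single, simp)
  next
    case (add x y x' y')
    then show ?case using alg_val_add group_algebra_add by metis
  next
    case (scale x y c)
    then obtain \<alpha> where \<alpha>: "\<alpha> \<in> group_algebra n" "x = alg_val \<alpha>" by blast
    have "alg_val (Poly_Mapping.single 0 c * \<alpha>) = sc c * x"
      by (simp add: alg_val_mult alg_val_single zero_braid.abs_eq braid_val_abs word_val_def \<alpha>)
    then show ?case using \<alpha>(1)
      by (intro bexI[of _ "Poly_Mapping.single 0 c * \<alpha>"]) (simp_all add: group_algebra_single group_algebra_mult)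
  next
    case (gen x y k)
    then obtain \<alpha> where \<alpha>: "\<alpha> \<in> group_algebra n" "x = alg_val \<alpha>" by blast
    have "abs_braid [(k, True)] \<in> braid_group n" using gen by (simp add: braid_group_def)
    moreover have "alg_val (Poly_Mapping.single (abs_braid [(k, True)]) 1 * \<alpha>) = two k R * x"
      by (simp add: alg_val_mult alg_val_single braid_val_abs word_val_def letter_def \<alpha>)
    ultimately show ?case using \<alpha>(1)
      by (intro bexI[of _ "Poly_Mapping.single (abs_braid [(k, True)]) 1 * \<alpha>"])
        (simp_all add: group_algebra_single group_algebra_mult)
  next
    case (gen' x y k)
    then obtain \<alpha> where \<alpha>: "\<alpha> \<in> group_algebra n" "x = alg_val \<alpha>" by blast
    have "abs_braid [(k, False)] \<in> braid_group n" using gen' by (simp add: braid_group_def)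
    moreover have "alg_val (Poly_Mapping.single (abs_braid [(k, False)]) 1 * \<alpha>) = two k R' * x"
      by (simp add: alg_val_mult alg_val_single braid_val_abs word_val_def letter_def \<alpha>)
    ultimately show ?case using \<alpha>(1)
      by (intro bexI[of _ "Poly_Mapping.single (abs_braid [(k, False)]) 1 * \<alpha>"])
        (simp_all add: group_algebra_single group_algebra_mult)
  qed
qed

lemma braid_val_shift: "b \<in> braid_group i \<Longrightarrow> braid_val (shift_braid n b) = tw.Sk n (braid_val b)"
  unfolding braid_group_def by (auto simp: braid_val_abs shift_braid.abs_eq word_val_shift)

lemma Sk_sum: "(\<And>x. x \<in> X \<Longrightarrow> f x \<in> A n) \<Longrightarrow> tw.Sk k (\<Sum>x\<in>X. f x) = (\<Sum>x\<in>X. tw.Sk k (f x))"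
  by (induction X rule: infinite_finite_induct) (simp_all add: tw.Sk_add[of _ n] A_sum)

lemma alg_val_shift:
  assumes "\<beta> \<in> group_algebra i"
  shows "alg_val (shift_algebra n \<beta>) = tw.Sk n (alg_val \<beta>)"
proof -
  have keys: "b \<in> braid_group i" if "b \<in> Poly_Mapping.keys \<beta>" for b
    using assms that unfolding group_algebra_def by blast
  then have b_A: "braid_val b \<in> A i" if "b \<in> Poly_Mapping.keys \<beta>" for b
    using that by (intro tw.Wset_A braid_val_W)
  have "alg_val (shift_algebra n \<beta>) = (\<Sum>b\<in>Poly_Mapping.keys \<beta>. sc (Poly_Mapping.lookup \<beta> b) * tw.Sk n (braid_val b))"
    unfolding shift_algebra_def alg_val_sum alg_val_single
    by (intro sum.cong[OF HOL.refl]) (simp add: braid_val_shift[OF keys])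
  also have "\<dots> = (\<Sum>b\<in>Poly_Mapping.keys \<beta>. tw.Sk n (sc (Poly_Mapping.lookup \<beta> b) * braid_val b))"
    by (intro sum.cong[OF HOL.refl]) (simp add: tw.Sk_mult[of _ i] b_A)
  also have "\<dots> = tw.Sk n (alg_val \<beta>)"
    unfolding alg_val_def lin_ext_def
    by (rule Sk_sum[symmetric, of _ _ i]) (simp add: A_mult b_A)
  finally show ?thesis .
qed

lemma alg_val_star:
  assumes "\<beta> \<in> group_algebra i" "1 \<le> n"
  shows "alg_val (braid_star n \<alpha> \<beta>) = alg_val \<alpha> * tw.Sk n (alg_val \<beta>) * tw.w n"
  unfolding braid_star_def star_word_def[symmetric] alg_val_mult alg_val_shift[OF assms(1)]
    alg_val_single braid_val_abs word_val_star[OF assms(2)]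
  by simp

lemma op_rho_braid:
  assumes "b \<in> braid_group n"
  shows "op 0 n (lft (rho_braid R n b)) = braid_val b"
proof -
  \<comment> \<open>The word chosen by \<open>rho_braid\<close>; by \<open>braid_val_abs\<close> any
    other word for the same braid has the same value.\<close>
  define v where "v = (SOME v. v \<in> words_on n \<and> abs_braid v = b)"
  have v: "v \<in> words_on n" "abs_braid v = b"
    using assms someI_ex[of "\<lambda>v. v \<in> words_on n \<and> abs_braid v = b"]
    unfolding braid_group_def v_def by blast+
  have "op 0 n (lft (rho_braid R n b)) = prod_list (map (\<lambda>x. op 0 n (lft (adj (if snd x then R else R') (fst x) n))) v)"
    unfolding rho_braid_def v_def[symmetric] op_lft_tprod R'_eq
    by (simp add: comp_def case_prod_unfold)
  also have "map (\<lambda>x. op 0 n (lft (adj (if snd x then R else R') (fst x) n))) v = map letter v"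
    using v(1) by (intro map_cong[OF HOL.refl]) (auto simp: letter_def words_on_def op_adj)
  finally show ?thesis unfolding v(2)[symmetric] braid_val_abs word_val_def .
qed

lemma op_add: "op m n (\<lambda>a b. X a b + Y a b) = op m n X + op m n Y"
  by (simp add: op_def sca_add distrib_right sum.distrib)

lemma op_scale: "op m n (\<lambda>a b. emb c * X a b) = sc c * op m n X"
  by (simp add: op_def sca_mult sum_distrib_left mult.assoc)

lemma op_sum: "op m n (\<lambda>a b. \<Sum>x\<in>I. X x a b) = (\<Sum>x\<in>I. op m n (X x))"
proof -
  have "op m n (\<lambda>a b. 0) = 0" by (simp add: op_def)
  then show ?thesis by (induction I rule: infinite_finite_induct) (simp_all add: op_add)
qed

lemma op_rho:
  assumes "\<alpha> \<in> group_algebra n"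
  shows "op 0 n (lft (rho R n \<alpha>)) = alg_val \<alpha>"
proof -
  have "lft (rho R n \<alpha>) = (\<lambda>a b. \<Sum>\<beta>\<in>Poly_Mapping.keys \<alpha>. emb (Poly_Mapping.lookup \<alpha> \<beta>) * lft (rho_braid R n \<beta>) a b)"
    by (intro HOL.ext) (simp add: rho_def emb_sum)
  then have "op 0 n (lft (rho R n \<alpha>)) = (\<Sum>\<beta>\<in>Poly_Mapping.keys \<alpha>. sc (Poly_Mapping.lookup \<alpha> \<beta>) * op 0 n (lft (rho_braid R n \<beta>)))"
    by (simp only: op_sum op_scale)
  also have "\<dots> = alg_val \<alpha>"
    unfolding alg_val_def lin_ext_def using assms
    by (intro sum.cong[OF HOL.refl]) (auto simp: group_algebra_def op_rho_braid)
  finally show ?thesis .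
qed

lemma M_braid_eq: "\<alpha> \<in> group_algebra n \<Longrightarrow> 1 \<le> n \<Longrightarrow> one 0 (qd.M_braid n \<alpha>) = tw.MB n (alg_val \<alpha>)"
  by (cases n) (simp_all add: qd.M_braid_def R_trace_tail_eq op_mult op_M_string lift_op_eq op_rho tw.MB_def)

lemma ch_eq: "\<alpha> \<in> group_algebra n \<Longrightarrow> sca (qd.ch n \<alpha>) = tw.ch n (alg_val \<alpha>)"
  by (simp add: qd.ch_def R_trace_eq op_mult op_M_string lift_op_eq op_rho tw.ch_def)

end

section \<open>Quantum matrix algebras of BMW type\<close>

lemma matrix_inv_props:
  fixes X :: "complex ^ 'k::finite ^ 'k"
  assumes "invertible X"
  shows "X ** matrix_inv X = mat 1" "matrix_inv X ** X = mat 1"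
  using someI_ex[OF assms[unfolded invertible_def]] unfolding matrix_inv_def by blast+

locale bmw_qma = matrix_units sca emb e
  for sca :: "'a::ring_1 \<Rightarrow> 'r::ring_1" and emb and e :: "nat \<Rightarrow> 'n::finite \<Rightarrow> 'n \<Rightarrow> 'r" +
  fixes R F :: "('n, complex) mat2" and M :: "('n, 'a) mat1" and q \<mu> :: complex
  assumes q: "q \<notin> {0, 1, -1}" and mu: "\<mu> \<notin> {0, q, - inverse q}"
    and qma: "quantum_matrix_algebra R F emb M" and bmw: "BMW_type q \<mu> R"
begin

abbreviation K where "K \<equiv> K_mat q \<mu> R"
definition lam where "lam = q - inverse q"

lemma R_matrices: "R_matrix R" "R_matrix F"
  and skew_inverse: "is_skew_inverse R (skew_inv R)"
  and compat: "compatible R F"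
  and relations: "presented_by emb (\<lambda>(i, j). M $ i $ j) (qma_relators R F)"
  using qma is_skew_inverse_skew_inv
  unfolding quantum_matrix_algebra_def strict_skew_invertible_def by blast+

lemma R_inverse: "R ** matrix_inv R = mat 1" "matrix_inv R ** R = mat 1"
  and F_inverse: "F ** matrix_inv F = mat 1" "matrix_inv F ** F = mat 1"
  using R_matrices matrix_inv_props unfolding R_matrix_def by blast+

lemma scalars: "lam \<noteq> 0" "\<mu> \<noteq> 0" "1 - \<mu>\<^sup>2 + lam * \<mu> \<noteq> 0"
proof -
  have q0: "q \<noteq> 0" using q by simp
  show "lam \<noteq> 0"
  proof
    assume "lam = 0"
    then have "q * q = 1" using q0 by (simp add: lam_def field_simps)
    then show False using q by (simp add: square_eq_1_iff)
  qed
  show "\<mu> \<noteq> 0" using mu by simp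
  \<comment> \<open>This factorization is where the excluded values q and -1/q of \<mu>
    enter.\<close>
  have "1 - \<mu>\<^sup>2 + lam * \<mu> = (q - \<mu>) * (inverse q + \<mu>)"
    using q0 by (simp add: lam_def algebra_simps power2_eq_square)
  moreover have "inverse q + \<mu> \<noteq> 0" using mu by (auto simp: add_eq_0_iff)
  moreover have "q - \<mu> \<noteq> 0" using mu by auto
  ultimately show "1 - \<mu>\<^sup>2 + lam * \<mu> \<noteq> 0" by simp
qed

lemma min_poly: "minimal_polynomial R [:\<mu>, \<mu> * lam - 1, - \<mu> - lam, 1:]"
proof -
  have "[:q, -1:] * [:inverse q, 1:] * [:\<mu>, -1:] = [:\<mu>, \<mu> * lam - 1, - \<mu> - lam, 1:]"
    using q by (simp add: lam_def algebra_simps)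
  then show ?thesis using bmw by (simp only: BMW_type_def)
qed

lemma two_0: "two n 0 = 0"
  using two_mat[of n 0] by (simp add: mat_0)

lemma sc_minus: "sc (c - d) = sc c - sc d"
  using sc_add[of "c - d" d] by simp

lemma cubic: "two n R * (two n R * two n R) = two n R - sc \<mu> - sc \<mu> * (sc lam * two n R)
    + sc \<mu> * (two n R * two n R) + sc lam * (two n R * two n R)"
proof -
  have "matrix_poly [:\<mu>, \<mu> * lam - 1, - \<mu> - lam, 1:] R = 0"
    using min_poly by (simp only: minimal_polynomial_def)
  then have "two n (matrix_poly [:\<mu>, \<mu> * lam - 1, - \<mu> - lam, 1:] R) = 0" by (simp add: two_0)
  then have "sc \<mu> + sc (\<mu> * lam - 1) * two n R + sc (- \<mu> - lam) * (two n R * two n R)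
    + two n R * (two n R * two n R) = 0"
    by (simp add: matrix_poly_3 two_add flip: two_mult)
  moreover have "sc (\<mu> * lam - 1) = sc \<mu> * sc lam - 1" "sc (- \<mu> - lam) = - sc \<mu> - sc lam"
    by (simp_all only: sc_minus sc_mult sc_1 emb_uminus sca_uminus)
  ultimately show ?thesis
    by (simp add: algebra_simps)
qed

lemma two_K: "sc (\<mu> * lam) * two n K = 1 + sc lam * two n R - two n R * two n R"
proof -
  have q0: "q \<noteq> 0" using q by simp
  have "lam \<noteq> 0" "\<mu> \<noteq> 0" by (rule scalars)+
  have "two n K = sc (inverse (\<mu> * lam)) * ((sc q - two n R) * (sc (inverse q) + two n R))"
    by (simp only: K_mat_def lam_def two_mult[symmetric] two_mat two_diff two_add inverse_mult_distrib mult.assoc)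
  then have "sc (\<mu> * lam) * two n K = sc (\<mu> * lam) * (sc (inverse (\<mu> * lam)) * ((sc q - two n R) * (sc (inverse q) + two n R)))"
    by (simp only:)
  also have "\<dots> = sc (\<mu> * lam * inverse (\<mu> * lam)) * ((sc q - two n R) * (sc (inverse q) + two n R))"
    by (simp only: sc_mult mult.assoc)
  also have "\<mu> * lam * inverse (\<mu> * lam) = 1"
    using \<open>lam \<noteq> 0\<close> \<open>\<mu> \<noteq> 0\<close> by (intro right_inverse) simp
  finally have "sc (\<mu> * lam) * two n K = (sc q - two n R) * (sc (inverse q) + two n R)"
    by simp
  also have "\<dots> = sc q * sc (inverse q) + (sc q - sc (inverse q)) * two n R - two n R * two n R"
    by (simp add: distrib_left left_diff_distrib sca_emb_central[of "two n R" "inverse q"])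
  also have "sc q * sc (inverse q) = 1" using q0 by (simp add: sc_mult[symmetric] del: emb_simps)
  also have "sc q - sc (inverse q) = sc lam"
    by (simp only: lam_def sc_minus)
  finally show ?thesis .
qed

lemma scalar_cancel: "sc c * x = sc c * y \<Longrightarrow> c \<noteq> 0 \<Longrightarrow> x = y"
  using sc_cancel by metis

lemma bmw_RK: "two n R * two n K = sc \<mu> * two n K"
proof -
  define r where "r = two n R"
  have "sc (\<mu> * lam) * (r * two n K) = r * (sc (\<mu> * lam) * two n K)" by (rule sc_left[symmetric])
  also have "\<dots> = r * (1 + sc lam * r - r * r)" by (simp only: two_K r_def)
  also have "\<dots> = r + sc lam * (r * r) - r * (r * r)"
    by (simp only: distrib_left right_diff_distrib sc_left[of r] mult_1_right)
  also have "\<dots> = sc \<mu> * (1 + sc lam * r - r * r)"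
    unfolding cubic[of n, folded r_def] by (simp add: algebra_simps)
  also have "\<dots> = sc (\<mu> * lam) * (sc \<mu> * two n K)"
    unfolding r_def two_K[symmetric] by (simp only: sc_left[of "sc \<mu>"])
  finally show ?thesis
    unfolding r_def by (rule scalar_cancel) (use scalars in simp)
qed

text \<open>Multiplying the cubic by the inverse of \<open>R\<close> expresses the square of
  \<open>R\<close> through \<open>1\<close>, \<open>R\<close> and the inverse; substituting this
  into \<open>two_K\<close> leaves a linear relation.\<close>

lemma bmw_skein: "two n R - two n (matrix_inv R) = sc lam * (1 - two n K)"
proof -
  define r where "r = two n R"
  define r' where "r' = two n (matrix_inv R)"
  have r'r: "r' * r = 1" and r'rr: "r' * (r * x) = x" for x
    by (simp_all add: r_def r'_def two_mult R_inverse flip: mult.assoc)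
  have "r' * (r * (r * r)) = r' * (r - sc \<mu> - sc \<mu> * (sc lam * r) + sc \<mu> * (r * r) + sc lam * (r * r))"
    by (simp only: cubic[of n, folded r_def])
  also have "\<dots> = 1 - sc \<mu> * r' - sc \<mu> * sc lam + sc \<mu> * r + sc lam * r"
    by (simp only: distrib_left right_diff_distrib sc_left[of r'] sca_emb_central[of r'] r'r r'rr mult_1_right)
  finally have c: "r * r = 1 - sc \<mu> * r' - sc \<mu> * sc lam + sc \<mu> * r + sc lam * r"
    by (simp only: r'rr)
  have "sc \<mu> * (sc lam * two n K) = 1 + sc lam * r - r * r"
    using two_K[of n] by (simp only: r_def sc_mult mult.assoc)
  also have "\<dots> = sc \<mu> * (r' - r + sc lam)"
    unfolding c by (simp add: algebra_simps)
  finally have "sc lam * two n K = r' - r + sc lam" by (rule scalar_cancel) (rule scalars)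
  then show ?thesis by (simp add: r_def r'_def algebra_simps)
qed

text \<open>Up to a scalar \<open>K\<close> is quadratic in \<open>R\<close>, so its vanishing would
  contradict the minimality of the cubic.\<close>

lemma K_nz: "K \<noteq> 0"
proof
  assume "K = 0"
  then have "1 + sc lam * two 0 R - two 0 R * two 0 R = 0"
    using two_K[of 0] by (simp add: two_0)
  then have "two 0 (matrix_poly [:1, lam, -1:] R) = two 0 0"
    by (simp add: matrix_poly_2 two_add two_0 flip: two_mult)
  then have "matrix_poly [:1, lam, -1:] R = 0" by (rule two_inj)
  then show False using min_poly unfolding minimal_polynomial_def
    by (auto dest!: spec[of _ "[:1, lam, -1:]"])
qed

lemma K_products:
  "tprod 3 [adj K 1 3, adj K 0 3] = tprod 3 [adj R 0 3, adj R 1 3, adj K 0 3]"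
  "tprod 3 [adj K 1 3, adj K 0 3] = tprod 3 [adj (matrix_inv R) 0 3, adj (matrix_inv R) 1 3, adj K 0 3]"
  "tprod 3 [adj K 0 3, adj K 1 3, adj K 0 3] = tprod 3 [adj K 0 3]"
proof -
  show "tprod 3 [adj K 1 3, adj K 0 3] = tprod 3 [adj R 0 3, adj R 1 3, adj K 0 3]"
    "tprod 3 [adj K 1 3, adj K 0 3] = tprod 3 [adj (matrix_inv R) 0 3, adj (matrix_inv R) 1 3, adj K 0 3]"
    using bmw unfolding BMW_type_def Let_def by blast+
  have K3: "tprod 3 [adj K 0 3, adj K 1 3, adj K 0 3] = adj K 0 3"
    using bmw unfolding BMW_type_def Let_def by blast
  have "tprod 3 [adj K 0 3] = adj K 0 3"
  proof (intro HOL.ext)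
    fix a b :: "'n list"
    show "tprod 3 [adj K 0 3] a b = adj K 0 3 a b"
    proof (cases "length b = 3")
      case True
      then show ?thesis by (simp add: tprod_def tmult_tid)
    next
      case False
      then show ?thesis by (auto simp: tprod_def tmult_def tid_def act2_def intro!: sum.neutral)
    qed
  qed
  then show "tprod 3 [adj K 0 3, adj K 1 3, adj K 0 3] = tprod 3 [adj K 0 3]" using K3 by simp
qed

lemma bmw_rank: "\<exists>u v. \<forall>p r. K $ p $ r = u p * v r"
  using K_rank_one[OF is_skew_inverse_sum[OF skew_inverse] K_products(1)] .

definition uu where "uu = (SOME u. \<exists>v. \<forall>p r. K $ p $ r = u p * v r)"
definition vv where "vv = (SOME v. \<forall>p r. K $ p $ r = uu p * v r)"

lemma K_uu_vv: "K $ p $ r = uu p * vv r"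
proof -
  have "\<exists>v. \<forall>p r. K $ p $ r = uu p * v r" unfolding uu_def using someI_ex[OF bmw_rank] .
  from someI_ex[OF this] show ?thesis unfolding vv_def by blast
qed

lemma M_relation: "two 0 R * (one 0 M * (two 0 F * one 0 M * two 0 (matrix_inv F)))
    = one 0 M * (two 0 F * one 0 M * two 0 (matrix_inv F)) * two 0 R"
proof -
  interpret qd: qma_data R F emb M .
  have lift: "qd.lift_op X = lft X" for X by (intro HOL.ext) (simp add: qd.lift_op_def)
  have str: "op 0 2 (qd.M_string 2) = one 0 M * (two 0 F * one 0 M * two 0 (matrix_inv F))"
    by (simp add: qd.M_string_def numeral_2_eq_2 op_tprod op_act1 lift op_adj mult.assoc)
  have "op 0 2 (tmult 2 (lft (adj R 0 2)) (qd.M_string 2)) = op 0 2 (tmult 2 (qd.M_string 2) (lft (adj R 0 2)))"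
    by (rule op_cong) (rule qma_relations[OF relations])
  then show ?thesis by (simp add: op_mult str op_adj)
qed

sublocale bmw_matrices sca emb e R "matrix_inv R" "skew_inv R" F "matrix_inv F" M K lam \<mu> uu vv
proof
  fix n
  show "(\<Sum>c\<in>UNIV. \<Sum>f\<in>UNIV. R $ (b, c) $ (x, f) * skew_inv R $ (f, g) $ (c, h)) =
      (if b = h \<and> x = g then 1 else 0)" for b x h g
    by (rule is_skew_inverse_sum[OF skew_inverse])
  show "two n R * two (Suc n) R * two n R = two (Suc n) R * two n R * two (Suc n) R"
    using three_identity[of "[(R, 0), (R, 1), (R, 0)]" "[(R, 1), (R, 0), (R, 1)]" n] R_matrices
    by (simp add: R_matrix_def mult.assoc)
  show "two n F * two (Suc n) F * two n F = two (Suc n) F * two n F * two (Suc n) F"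
    using three_identity[of "[(F, 0), (F, 1), (F, 0)]" "[(F, 1), (F, 0), (F, 1)]" n] R_matrices
    by (simp add: R_matrix_def mult.assoc)
  show "two n R * two (Suc n) F * two n F = two (Suc n) F * two n F * two (Suc n) R"
    using three_identity[of "[(R, 0), (F, 1), (F, 0)]" "[(F, 1), (F, 0), (R, 1)]" n] compat
    by (simp add: compatible_def mult.assoc)
  show "two (Suc n) R * two n F * two (Suc n) F = two n F * two (Suc n) F * two n R"
    using three_identity[of "[(R, 1), (F, 0), (F, 1)]" "[(F, 0), (F, 1), (R, 0)]" n] compat
    by (simp add: compatible_def mult.assoc)
  show "two (Suc n) K * two n K = two n R * two (Suc n) R * two n K"
    using three_identity[of "[(K, 1), (K, 0)]" "[(R, 0), (R, 1), (K, 0)]" n] K_products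
    by (simp add: mult.assoc)
  show "two (Suc n) K * two n K = two n (matrix_inv R) * two (Suc n) (matrix_inv R) * two n K"
    using three_identity[of "[(K, 1), (K, 0)]" "[(matrix_inv R, 0), (matrix_inv R, 1), (K, 0)]" n] K_products
    by (simp add: mult.assoc)
  show "two n K * two (Suc n) K * two n K = two n K"
    using three_identity[of "[(K, 0), (K, 1), (K, 0)]" "[(K, 0)]" n] K_products
    by (simp add: mult.assoc)
qed (rule R_inverse F_inverse M_relation scalars bmw_skein bmw_RK K_nz K_uu_vv)+

sublocale qma_translation sca emb e R "matrix_inv R" "skew_inv R" F "matrix_inv F" M
  by unfold_locales (simp_all add: D_mat_def D_def)

end

context bmw_qma
begin

section \<open>Translation between the tower and matrices over the algebra\<close>

lemma module_mscale: "module qd.mscale" and module_emb: "module (\<lambda>c a :: 'a. emb c * a)"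
  by unfold_locales (simp_all add: qd.mscale_def vec_eq_iff algebra_simps)

lemma one_mscale: "one m (qd.mscale c X) = sc c * one m X"
proof -
  have "qd.mscale c X = mat (emb c) ** X"
    by (simp add: qd.mscale_def vec_eq_iff matrix_matrix_mult_def mat_def if_distrib[of "\<lambda>v. v * _"] cong: if_cong)
  then show ?thesis by (simp add: one_mult[symmetric])
qed

lemma one_rmult: "one m (qd.rmult X c) = one m X * sca c"
proof -
  have "qd.rmult X c = X ** mat c"
    by (simp add: qd.rmult_def vec_eq_iff matrix_matrix_mult_def mat_def if_distrib[of "(*) _"] cong: if_cong)
  then show ?thesis by (simp add: one_mult[symmetric])
qed

lemma one_0: "one m 0 = 0"
  using one_mat[of m 0] by (simp add: mat_0)

lemma one_sum: "one m (\<Sum>x\<in>X. f x) = (\<Sum>x\<in>X. one m (f x))"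
  by (induction X rule: infinite_finite_induct) (simp_all add: one_0 one_add)

lemma sca_char: "z \<in> tw.C \<Longrightarrow> \<exists>c\<in>qd.char_subalgebra. sca c = z"
proof -
  interpret module "\<lambda>c a :: 'a. emb c * a" by (rule module_emb)
  show "z \<in> tw.C \<Longrightarrow> \<exists>c\<in>qd.char_subalgebra. sca c = z"
  proof (induction rule: tw.C.induct)
    case (sc c)
    have "emb c * 1 \<in> qd.char_subalgebra"
      unfolding qd.char_subalgebra_def by (intro span_scale span_base) simp
    then show ?case by auto
  next
    case (ch x n)
    then obtain \<alpha> where "\<alpha> \<in> group_algebra n" "x = alg_val \<alpha>" using W_alg_val by blast
    moreover from this have "qd.ch n \<alpha> \<in> qd.char_subalgebra"
      unfolding qd.char_subalgebra_def using ch by (intro span_base) blast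
    ultimately show ?case by (intro bexI[of _ "qd.ch n \<alpha>"]) (simp_all add: ch_eq)
  next
    case (add a b)
    then obtain c d where cd: "c \<in> qd.char_subalgebra" "sca c = a" "d \<in> qd.char_subalgebra" "sca d = b" by blast
    then have "c + d \<in> qd.char_subalgebra" unfolding qd.char_subalgebra_def by (intro span_add)
    then show ?case using cd by (intro bexI[of _ "c + d"]) (simp_all add: sca_add)
  qed
qed

lemma char_subalgebra_iff: "c \<in> qd.char_subalgebra \<longleftrightarrow> sca c \<in> tw.C"
proof
  interpret module "\<lambda>c a :: 'a. emb c * a" by (rule module_emb)
  assume "c \<in> qd.char_subalgebra"
  then show "sca c \<in> tw.C" unfolding qd.char_subalgebra_def
  proof (induction rule: span_induct_alt)
    case base
    show ?case using tw.C.sc[of 0] by simp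
  next
    case (step k x y)
    have "sca x \<in> tw.C" using step(1) tw.C.sc[of 1]
      by (auto simp: ch_eq intro!: tw.C.ch alg_val_W)
    then show ?case using step(2) by (auto simp: sca_add sca_mult intro!: tw.C.add tw.C_sc)
  qed
next
  assume "sca c \<in> tw.C"
  then show "c \<in> qd.char_subalgebra" using sca_char sca_eq by metis
qed

lemma char_add: "c \<in> qd.char_subalgebra \<Longrightarrow> d \<in> qd.char_subalgebra \<Longrightarrow> c + d \<in> qd.char_subalgebra"
  by (simp add: char_subalgebra_iff sca_add tw.C.add)

lemma char_emb: "emb c \<in> qd.char_subalgebra"
  by (simp add: char_subalgebra_iff tw.C.sc)

text \<open>The case \<open>linear\<close> writes out the coefficient 1 so that it has the shape of
  the linearity rules of \<open>star_graph\<close>, \<open>left_op\<close> and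
  \<open>right_op\<close>.\<close>

lemma P_induct [consumes 1, case_names mat braid linear]:
  assumes "N \<in> qd.P_space"
    and mat: "\<And>c. c \<in> qd.char_subalgebra \<Longrightarrow> Q (mat c)"
    and braid: "\<And>n \<alpha>. 1 \<le> n \<Longrightarrow> \<alpha> \<in> group_algebra n \<Longrightarrow> Q (qd.M_braid n \<alpha>)"
    and linear: "\<And>k X Y. Q X \<Longrightarrow> Q Y \<Longrightarrow> Q (qd.mscale k X + qd.mscale 1 Y)"
  shows "Q N"
proof -
  interpret module qd.mscale by (rule module_mscale)
  from assms(1) show ?thesis unfolding qd.P_space_def
  proof (induction rule: span_induct_alt)
    case base
    show ?case using mat[of 0] char_emb[of 0] by (simp add: mat_0)
  next
    case (step k X Y)
    then have "Q X" using mat braid by blast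
    then show ?case using linear[OF _ step(2)] by simp
  qed
qed

lemma P_mat: "c \<in> qd.char_subalgebra \<Longrightarrow> mat c \<in> qd.P_space"
  and P_braid: "1 \<le> n \<Longrightarrow> \<alpha> \<in> group_algebra n \<Longrightarrow> qd.M_braid n \<alpha> \<in> qd.P_space"
  and P_add: "X \<in> qd.P_space \<Longrightarrow> Y \<in> qd.P_space \<Longrightarrow> X + Y \<in> qd.P_space"
proof -
  interpret module qd.mscale by (rule module_mscale)
  show "c \<in> qd.char_subalgebra \<Longrightarrow> mat c \<in> qd.P_space"
    "1 \<le> n \<Longrightarrow> \<alpha> \<in> group_algebra n \<Longrightarrow> qd.M_braid n \<alpha> \<in> qd.P_space"
    unfolding qd.P_space_def by (intro span_base; blast)+
  show "X \<in> qd.P_space \<Longrightarrow> Y \<in> qd.P_space \<Longrightarrow> X + Y \<in> qd.P_space"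
    unfolding qd.P_space_def by (rule span_add)
qed

lemma U_sc: "x \<in> bt.U \<Longrightarrow> sc c * x \<in> bt.U"
  using bt.U_C[OF _ tw.C.sc, of x c] by (simp add: sca_emb_central[of x])

lemma C_U: "c \<in> tw.C \<Longrightarrow> c \<in> bt.U"
  using bt.U.pw[of c 0] by simp

lemma P_U: "N \<in> qd.P_space \<Longrightarrow> one 0 N \<in> bt.U"
proof (induction rule: P_induct)
  case (mat c)
  then show ?case by (simp add: char_subalgebra_iff C_U)
next
  case (braid n \<alpha>)
  then show ?case by (simp add: M_braid_eq alg_val_W bt.MB_U)
next
  case (linear k X Y)
  then show ?case by (auto simp: one_add one_mscale intro: bt.U.add U_sc)
qed

text \<open>\<open>P_space\<close> is a complex linear span. It absorbs characters on the right
  because a braid matrix times a character is again the matrix of a braid, with the two words side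
  by side (\<open>MB_ch_mult\<close>).\<close>

lemma MB_C_P:
  assumes x: "x \<in> tw.Wset n" "1 \<le> n" and "c \<in> tw.C"
  shows "\<exists>N\<in>qd.P_space. one 0 N = tw.MB n x * c"
proof -
  have MB: "\<exists>N\<in>qd.P_space. one 0 N = tw.MB m y" if y: "y \<in> tw.Wset m" "1 \<le> m" for m y
    using W_alg_val[OF y(1)] y(2) P_braid M_braid_eq by metis
  show ?thesis using assms(3)
  proof (induction rule: tw.C.induct)
    case (sc c)
    have "tw.MB n x * sc c = tw.MB n (sc c * x)"
      by (simp add: tw.MB_sc sca_emb_central[of "tw.MB n x"])
    then show ?case using MB[OF tw.Wset_sc[OF x(1)] x(2)] by simp
  next
    case (ch y m)
    have "x * tw.Sk n y \<in> tw.Wset (n + m)"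
      using x(1) ch(1) by (intro tw.Wset_mult tw.Wset_Sk) (auto intro: tw.Wset_mono)
    then show ?case using MB[of "x * tw.Sk n y" "n + m"] x ch
      by (simp add: tw.MB_ch_mult tw.Wset_A)
  next
    case (add a b)
    then show ?case using P_add one_add distrib_left by metis
  qed
qed

lemma U_P: "z \<in> bt.U \<Longrightarrow> \<exists>N\<in>qd.P_space. one 0 N = z"
proof (induction rule: bt.U.induct)
  case (pw c n)
  show ?case
  proof (cases n)
    case 0
    obtain d where "d \<in> qd.char_subalgebra" "sca d = c" using sca_char[OF pw] by blast
    then show ?thesis using P_mat[of d] 0 by (intro bexI[of _ "mat d"]) simp_all
  next
    case (Suc m)
    then obtain x where "x \<in> tw.Wset n" "bt.pw n = tw.MB n x" using bt.pw_W[of n] by auto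
    then show ?thesis using MB_C_P[of x n c] pw Suc by simp
  qed
next
  case (T c n)
  obtain x where x: "x \<in> tw.Wset (n + 2)" "bt.pw (n + 2) = tw.MB (n + 2) x" using bt.pw_W[of "n + 2"] by auto
  have "tw.Bop (two 0 K) (tw.MB (n + 2) x) = tw.MB (Suc (n + 2)) (tw.S x * two 0 K)"
    "tw.S x * two 0 K \<in> tw.Wset (Suc (n + 2))"
    by (rule bt.Bop_W; use x in simp)+
  then show ?case using MB_C_P[of "tw.S x * two 0 K" "Suc (n + 2)" c] T x by simp
next
  case (add x y)
  then show ?case using P_add one_add by metis
qed

lemma P_iff: "N \<in> qd.P_space \<longleftrightarrow> one 0 N \<in> bt.U"
  using P_U U_P one_inj by metis

section \<open>Commutativity and well-definedness of the star product\<close>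

lemma star_graph_commute: "qd.star_graph X Y Z \<Longrightarrow> qd.star_graph Y X Z"
proof (induction rule: qd.star_graph.induct)
  case (braid n i \<alpha> \<beta>)
  have "one 0 (qd.M_braid (i + n) (braid_star i \<beta> \<alpha>)) = one 0 (qd.M_braid (n + i) (braid_star n \<alpha> \<beta>))"
    using braid bt.MB_star_commute[OF alg_val_W alg_val_W, of \<alpha> n \<beta> i]
    by (simp add: M_braid_eq braid_star_group_algebra alg_val_star)
  then show ?case using qd.star_graph.braid[OF braid(2,1,4,3)] one_inj by metis
qed (rule qd.star_graph.intros; assumption)+

lemma star_commute: "qd.star X Y = qd.star Y X"
proof -
  have "qd.star_graph X Y = qd.star_graph Y X" using star_graph_commute by blast
  then show ?thesis by (simp add: qd.star_def)
qed

text \<open>Multiplication depends on the chosen representative of a factor, but is linear in the other one.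
  Evaluating on the left and on the right gives the same, so that the product is well defined.\<close>

inductive left_op :: "('n, 'a) mat1 \<Rightarrow> ('r \<Rightarrow> 'r) \<Rightarrow> bool" where
  braid: "1 \<le> n \<Longrightarrow> \<alpha> \<in> group_algebra n \<Longrightarrow> left_op (qd.M_braid n \<alpha>) (tw.Lop n (alg_val \<alpha>) (tw.w n))"
| mat: "c \<in> qd.char_subalgebra \<Longrightarrow> left_op (mat c) (\<lambda>N. N * sca c)"
| linear: "left_op X f \<Longrightarrow> left_op Y g \<Longrightarrow>
    left_op (qd.mscale c X + qd.mscale d Y) (\<lambda>N. sc c * f N + sc d * g N)"

inductive right_op :: "('n, 'a) mat1 \<Rightarrow> ('r \<Rightarrow> 'r) \<Rightarrow> bool" where
  braid: "1 \<le> n \<Longrightarrow> \<alpha> \<in> group_algebra n \<Longrightarrow> right_op (qd.M_braid n \<alpha>) (tw.Lop' n (alg_val \<alpha>) (tw.u n))"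
| mat: "c \<in> qd.char_subalgebra \<Longrightarrow> right_op (mat c) (\<lambda>N. N * sca c)"
| linear: "right_op X f \<Longrightarrow> right_op Y g \<Longrightarrow>
    right_op (qd.mscale c X + qd.mscale d Y) (\<lambda>N. sc c * f N + sc d * g N)"

lemma one_comb: "one m (qd.mscale c X + qd.mscale d Y) = sc c * one m X + sc d * one m Y"
  by (simp add: one_add one_mscale)

lemma lin_of_right:
  assumes add: "\<And>N N'. N \<in> A (Suc 0) \<Longrightarrow> N' \<in> A (Suc 0) \<Longrightarrow> f (N + N') = f N + f N'"
    and right: "\<And>N c. N \<in> A (Suc 0) \<Longrightarrow> f (N * sc c) = f N * sc c"
    and N: "N \<in> A (Suc 0)" "N' \<in> A (Suc 0)"
  shows "f (sc c * N + sc d * N') = sc c * f N + sc d * f N'"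
proof -
  have "f (N * sc c + N' * sc d) = f N * sc c + f N' * sc d"
    using N by (simp add: add right A_mult)
  then show ?thesis by (simp only: sca_emb_central)
qed

lemma left_op_linear:
  assumes "left_op X f" and N: "N \<in> A (Suc 0)" "N' \<in> A (Suc 0)"
  shows "f (sc c * N + sc d * N') = sc c * f N + sc d * f N'"
  using assms(1)
proof induction
  case (braid n \<alpha>)
  show ?case
    by (rule lin_of_right[OF _ _ N])
      ((rule tw.Lop_add tw.Lop_right sca_A sca_emb_central; assumption?)+)
next
  case (linear X f Y g a b)
  show ?case unfolding linear.IH
    by (simp only: distrib_left sc_left[of "sc a" c] sc_left[of "sc a" d] sc_left[of "sc b" c] sc_left[of "sc b" d] add_ac)
qed (simp add: distrib_right mult.assoc)

lemma right_op_linear: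
  assumes "right_op X f" and N: "N \<in> A (Suc 0)" "N' \<in> A (Suc 0)"
  shows "f (sc c * N + sc d * N') = sc c * f N + sc d * f N'"
  using assms(1)
proof induction
  case (braid n \<alpha>)
  show ?case
    by (rule lin_of_right[OF _ _ N])
      ((rule tw.Lop'_add tw.Lop'_right sca_A sca_emb_central; assumption?)+)
next
  case (linear X f Y g a b)
  show ?case unfolding linear.IH
    by (simp only: distrib_left sc_left[of "sc a" c] sc_left[of "sc a" d] sc_left[of "sc b" c] sc_left[of "sc b" d] add_ac)
qed (simp add: distrib_right mult.assoc)

lemma one_0_A: "one 0 X \<in> A (Suc 0)"
  by (simp add: one_A)

text \<open>For two braid matrices both sides are the matrix of the star product of the braids. A
  braid matrix and a scalar matrix are handled by \<open>Lop_A0\<close> and \<open>Lop'_A0\<close>,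
  two scalar matrices by commutativity of \<open>C\<close>, and the rest by linearity.\<close>

lemma left_op_right_op:
  assumes "left_op X f" "right_op Y g"
  shows "f (one 0 Y) = g (one 0 X)"
  using assms
proof (induction arbitrary: Y g)
  case (braid n \<alpha>)
  note n = braid(1,2)
  from braid(3) show ?case
  proof induction
    case (braid i \<beta>)
    show ?case
      using tw.MB_star_Lop[OF alg_val_W alg_val_W, of \<alpha> n \<beta> i] tw.MB_star_Lop'[OF alg_val_W alg_val_W, of \<alpha> n \<beta> i] n braid
      by (simp add: M_braid_eq)
  next
    case (mat c)
    then have "sca c \<in> A 0" by simp
    then show ?case using n by (simp add: M_braid_eq tw.Lop_A0 alg_val_W)
  next
    case (linear Y g Y' g' a b)
    show ?case
      unfolding one_comb left_op_linear[OF left_op.braid[OF n] one_0_A one_0_A] linear.IH ..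
  qed
next
  case (mat c)
  from mat(2) show ?case
  proof induction
    case (braid i \<beta>)
    then show ?case by (simp add: M_braid_eq tw.Lop'_A0 alg_val_W)
  next
    case (mat d)
    then show ?case using \<open>c \<in> qd.char_subalgebra\<close> tw.C_commute
      by (simp add: char_subalgebra_iff)
  next
    case (linear Y g Y' g' a b)
    then show ?case by (simp add: one_comb distrib_right mult.assoc)
  qed
next
  case (linear X f X' f' a b)
  show ?case
    unfolding one_comb right_op_linear[OF linear.prems one_0_A one_0_A] linear.IH[OF linear.prems] ..
qed

lemma left_op_ex: "X \<in> qd.P_space \<Longrightarrow> \<exists>f. left_op X f"
  by (induction rule: P_induct) (blast intro: left_op.intros)+

lemma right_op_ex: "X \<in> qd.P_space \<Longrightarrow> \<exists>f. right_op X f"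
  by (induction rule: P_induct) (blast intro: right_op.intros)+

lemma star_graph_ops:
  "qd.star_graph X Y Z \<Longrightarrow> \<exists>f g. left_op X f \<and> right_op Y g \<and> one 0 Z = f (one 0 Y)"
proof (induction rule: qd.star_graph.induct)
  case (braid n i \<alpha> \<beta>)
  have "one 0 (qd.M_braid (n + i) (braid_star n \<alpha> \<beta>)) = tw.Lop n (alg_val \<alpha>) (tw.w n) (one 0 (qd.M_braid i \<beta>))"
    using braid tw.MB_star_Lop[OF alg_val_W alg_val_W, of \<alpha> n \<beta> i]
    by (simp add: M_braid_eq braid_star_group_algebra alg_val_star)
  then show ?case using braid left_op.braid right_op.braid by blast
next
  case (scalar_left c N)
  have "one 0 (qd.rmult N c) = one 0 N * sca c" by (rule one_rmult)
  then show ?case using left_op.mat[OF scalar_left(1)] right_op_ex[OF scalar_left(2)] by blast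
next
  case (scalar_right c N)
  obtain f where f: "left_op N f" using left_op_ex[OF scalar_right(2)] by blast
  have "one 0 (qd.rmult N c) = f (one 0 (mat c))"
    using left_op_right_op[OF f right_op.mat[OF scalar_right(1)]] by (simp only: one_rmult)
  then show ?case using f right_op.mat[OF scalar_right(1)] by blast
next
  case (linear_left X Y Z X' Z' c d)
  then obtain f g f' where "left_op X f" "right_op Y g" "one 0 Z = f (one 0 Y)"
    "left_op X' f'" "one 0 Z' = f' (one 0 Y)" by blast
  then show ?case
    by (intro exI[of _ "\<lambda>N. sc c * f N + sc d * f' N"] exI[of _ g])
      (simp add: left_op.linear one_comb)
next
  case (linear_right X Y Z Y' Z' c d)
  then obtain f g f' g' where f: "left_op X f" "right_op Y g" "one 0 Z = f (one 0 Y)"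
    "left_op X f'" "right_op Y' g'" "one 0 Z' = f' (one 0 Y')" by blast
  \<comment> \<open>The two derivations may have chosen different representatives of
    \<open>X\<close>; evaluating \<open>Y'\<close> from the right shows that both functions agree
    there.\<close>
  have "f' (one 0 Y') = f (one 0 Y')"
    using left_op_right_op[OF f(4,5)] left_op_right_op[OF f(1,5)] by simp
  then have "one 0 (qd.mscale c Z + qd.mscale d Z') = f (one 0 (qd.mscale c Y + qd.mscale d Y'))"
    unfolding one_comb left_op_linear[OF f(1) one_0_A one_0_A] by (simp add: f)
  then show ?case using f(1) right_op.linear[OF f(2,5)] by blast
qed

lemma star_graph_unique:
  assumes "qd.star_graph X Y Z" "qd.star_graph X Y Z'"
  shows "Z = Z'"
proof -
  obtain f g f' g' where "left_op X f" "right_op Y g" "one 0 Z = f (one 0 Y)"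
    "left_op X f'" "one 0 Z' = f' (one 0 Y)"
    using star_graph_ops[OF assms(1)] star_graph_ops[OF assms(2)] by blast
  then have "one 0 Z = one 0 Z'" using left_op_right_op by metis
  then show ?thesis by (rule one_inj)
qed

lemma star_eq: "qd.star_graph X Y Z \<Longrightarrow> qd.star X Y = Z"
  unfolding qd.star_def using star_graph_unique by blast

section \<open>Star powers and the spanning set\<close>

lemma unit_alg_val: "Poly_Mapping.single 0 1 \<in> group_algebra n" "alg_val (Poly_Mapping.single 0 1) = 1"
  using group_algebra_single[OF braid_group_0, of 1 n]
  by (simp_all only: alg_val_single zero_braid.abs_eq braid_val_abs) (simp add: word_val_def)

lemma M_braid_unit: "qd.M_braid 1 (Poly_Mapping.single 0 1) = M"
proof (rule one_inj)
  show "one 0 (qd.M_braid 1 (Poly_Mapping.single 0 1)) = one 0 M"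
    using bt.M0_MB unfolding M_braid_eq[OF unit_alg_val(1) order.refl] unit_alg_val(2) by simp
qed

lemma Aop_linear: "N \<in> A (Suc 0) \<Longrightarrow> N' \<in> A (Suc 0) \<Longrightarrow>
    tw.Bop (two 0 R) (sc c * N + sc d * N') = sc c * tw.Bop (two 0 R) N + sc d * tw.Bop (two 0 R) N'"
  by (rule lin_of_right) (simp_all add: tw.Bop_add bt.Bop_right')

text \<open>\<open>M\<close> is the matrix of the trivial braid on one strand and \<open>w 1\<close>
  is \<open>R 0\<close>, so the braid rule gives \<open>Aop\<close>. At scalar matrices the same
  holds because \<open>Aop\<close> sends 1 to \<open>M\<close>.\<close>

lemma star_graph_M:
  assumes "N \<in> qd.P_space"
  shows "\<exists>Z. qd.star_graph M N Z \<and> one 0 Z = tw.Bop (two 0 R) (one 0 N)"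
  using assms
proof (induction rule: P_induct)
  case (mat c)
  have "M \<in> qd.P_space"
    using P_braid[OF order.refl unit_alg_val(1)] by (simp only: M_braid_unit)
  then have "qd.star_graph M (mat c) (qd.rmult M c)" by (intro qd.star_graph.scalar_right mat)
  moreover have "tw.Bop (two 0 R) (1 * sca c) = tw.Bop (two 0 R) 1 * sca c"
    by (intro bt.Bop_right') simp_all
  then have "one 0 (qd.rmult M c) = tw.Bop (two 0 R) (one 0 (mat c))"
    using bt.pw_1 by (simp add: one_rmult bt.pw_Suc)
  ultimately show ?case by blast
next
  case (braid i \<beta>)
  let ?Z = "qd.M_braid (1 + i) (braid_star 1 (Poly_Mapping.single 0 1) \<beta>)"
  have "qd.star_graph M (qd.M_braid i \<beta>) ?Z"
    using qd.star_graph.braid[OF order.refl braid(1) unit_alg_val(1) braid(2)] by (simp only: M_braid_unit)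
  moreover have "one 0 ?Z = tw.MB (1 + i) (1 * tw.Sk 1 (alg_val \<beta>) * tw.w 1)"
    using braid unit_alg_val
    by (simp only: M_braid_eq braid_star_group_algebra alg_val_star order.refl le_add1)
  then have "one 0 ?Z = tw.Bop (two 0 R) (one 0 (qd.M_braid i \<beta>))"
    using bt.Bop_W(1)[of "alg_val \<beta>" i "two 0 R"] braid
    by (simp add: M_braid_eq alg_val_W tw.w_def)
  ultimately show ?case by blast
next
  case (linear k X Y)
  then obtain Z Z' where Z: "qd.star_graph M X Z" "one 0 Z = tw.Bop (two 0 R) (one 0 X)"
    "qd.star_graph M Y Z'" "one 0 Z' = tw.Bop (two 0 R) (one 0 Y)" by blast
  then have "one 0 (qd.mscale k Z + qd.mscale 1 Z') = tw.Bop (two 0 R) (one 0 (qd.mscale k X + qd.mscale 1 Y))"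
    unfolding one_comb Aop_linear[OF one_0_A one_0_A] by simp
  then show ?case using qd.star_graph.linear_right[OF Z(1,3)] by blast
qed

lemma M_power_eq: "one 0 (qd.M_power n) = bt.pw n"
proof (induction n)
  case 0
  show ?case by simp
next
  case (Suc n)
  have "one 0 (qd.M_power n) \<in> bt.U"
    using Suc bt.U.pw[OF tw.C.sc, of n 1] by simp
  then have "qd.M_power n \<in> qd.P_space" by (simp only: P_iff)
  then show ?case using star_graph_M star_eq Suc bt.pw_Suc by (metis qd.M_power.simps(2))
qed

definition gens :: "('n, 'a) mat1 set" where
  "gens = {qd.M_power n | n. True} \<union> {qd.T_M q \<mu> (qd.M_power (n + 2)) | n. True}"

lemma right_span_add:
  assumes "X \<in> qd.right_span G" "Y \<in> qd.right_span G"
  shows "X + Y \<in> qd.right_span G"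
proof -
  obtain T c T' c' where T: "finite T" "T \<subseteq> G" "\<forall>x\<in>T. c x \<in> qd.char_subalgebra" "X = (\<Sum>x\<in>T. qd.rmult x (c x))"
    and T': "finite T'" "T' \<subseteq> G" "\<forall>x\<in>T'. c' x \<in> qd.char_subalgebra" "Y = (\<Sum>x\<in>T'. qd.rmult x (c' x))"
    using assms unfolding qd.right_span_def by blast
  \<comment> \<open>The two finite sets may overlap, and a coefficient function has unspecified
    values outside its set, so each is cut off to 0 before adding.\<close>
  define d where "d x = (if x \<in> T then c x else 0) + (if x \<in> T' then c' x else 0)" for x
  have r0: "qd.rmult x 0 = 0" and radd: "qd.rmult x (a + b) = qd.rmult x a + qd.rmult x b" for x a b
    by (simp_all add: qd.rmult_def vec_eq_iff distrib_left)
  have "X = (\<Sum>x\<in>T \<union> T'. qd.rmult x (if x \<in> T then c x else 0))"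
    unfolding T(4) using T(1) T'(1) by (intro sum.mono_neutral_cong_left) (auto simp: r0)
  moreover have "Y = (\<Sum>x\<in>T \<union> T'. qd.rmult x (if x \<in> T' then c' x else 0))"
    unfolding T'(4) using T(1) T'(1) by (intro sum.mono_neutral_cong_left) (auto simp: r0)
  ultimately have "X + Y = (\<Sum>x\<in>T \<union> T'. qd.rmult x (d x))"
    by (simp add: d_def radd sum.distrib)
  moreover have "d x \<in> qd.char_subalgebra" for x
    unfolding d_def using T(3) T'(3) char_emb[of 0] by (intro char_add) auto
  ultimately show ?thesis
    unfolding qd.right_span_def using T(1,2) T'(1,2) by (auto intro!: exI[of _ "T \<union> T'"] exI[of _ d])
qed

lemma right_span_gen: "X \<in> G \<Longrightarrow> c \<in> qd.char_subalgebra \<Longrightarrow> qd.rmult X c \<in> qd.right_span G"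
  unfolding qd.right_span_def by (auto intro!: exI[of _ "{X}"] exI[of _ "\<lambda>_. c"])

lemma T_M_power: "one 0 (qd.T_M q \<mu> (qd.M_power n)) = tw.Bop (two 0 K) (bt.pw n)"
  by (simp only: T_M_eq M_power_eq)

lemma U_right_span: "z \<in> bt.U \<Longrightarrow> \<exists>N\<in>qd.right_span gens. one 0 N = z"
proof (induction rule: bt.U.induct)
  case (pw c n)
  obtain d where "d \<in> qd.char_subalgebra" "sca d = c" using sca_char[OF pw] by blast
  moreover have "qd.M_power n \<in> gens" unfolding gens_def by blast
  ultimately show ?case using right_span_gen one_rmult M_power_eq by metis
next
  case (T c n)
  obtain d where "d \<in> qd.char_subalgebra" "sca d = c" using sca_char[OF T] by blast
  moreover have "qd.T_M q \<mu> (qd.M_power (n + 2)) \<in> gens" unfolding gens_def by blast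
  ultimately show ?case using right_span_gen one_rmult T_M_power by metis
next
  case (add x y)
  then show ?case using right_span_add one_add by metis
qed

lemma right_span_U:
  assumes "N \<in> qd.right_span gens" shows "one 0 N \<in> bt.U"
proof -
  obtain T c where T: "finite T" "T \<subseteq> gens" "\<forall>x\<in>T. c x \<in> qd.char_subalgebra" "N = (\<Sum>x\<in>T. qd.rmult x (c x))"
    using assms unfolding qd.right_span_def by blast
  have gen: "one 0 X * z \<in> bt.U" if "X \<in> gens" "z \<in> tw.C" for X z
    using that unfolding gens_def
    by (auto simp only: M_power_eq T_M_power Un_iff mem_Collect_eq intro: bt.U.intros)
  have zero: "0 \<in> bt.U" using C_U[OF tw.C.sc[of 0]] by simp
  have "(\<Sum>x\<in>T. one 0 x * sca (c x)) \<in> bt.U"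
    using T(1-3)
    by (induction T rule: finite_induct) (auto simp: char_subalgebra_iff intro: bt.U.add gen zero)
  then show ?thesis by (simp add: T(4) one_sum one_rmult)
qed

lemma P_eq_right_span: "qd.P_space = qd.right_span gens"
proof (rule set_eqI)
  fix N
  have "N \<in> qd.right_span gens \<longleftrightarrow> one 0 N \<in> bt.U"
    using right_span_U U_right_span one_inj by metis
  then show "N \<in> qd.P_space \<longleftrightarrow> N \<in> qd.right_span gens" by (simp only: P_iff)
qed

end

theorem proposition4p14:
  fixes R F :: "('n::finite, complex) mat2"
    and emb :: "complex \<Rightarrow> 'a::ring_1"
    and M :: "('n, 'a) mat1"
    and q \<mu> :: complex
  assumes "q \<notin> {0, 1, -1}"
    and "\<mu> \<notin> {0, q, - inverse q}"
    and "quantum_matrix_algebra R F emb M"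
    and "BMW_type q \<mu> R"
  shows "(\<forall>X\<in>qma_data.P_space R F emb M. \<forall>Y\<in>qma_data.P_space R F emb M.
            qma_data.star R F emb M X Y = qma_data.star R F emb M Y X) \<and>
         qma_data.P_space R F emb M =
           qma_data.right_span R F emb M
             ({qma_data.M_power R F emb M n | n. True} \<union>
              {qma_data.T_M R F emb M q \<mu> (qma_data.M_power R F emb M (n + 2)) | n. True})"
proof -
  have "complex_algebra emb"
    using assms(3) by (simp add: quantum_matrix_algebra_def presented_by_def)
  \<comment> \<open>The abstract ring becomes the endomorphisms of functions on infinite words,
    where matrix units exist at every position.\<close>
  then interpret bmw_qma rop_sca emb rop_e R F M q \<mu>
    by (intro bmw_qma.intro rop_matrix_units bmw_qma_axioms.intro assms)
  show ?thesis using star_commute P_eq_right_span unfolding gens_def by blast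
qed

end
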